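(* Let $(V,\omega)$ be a complex symplectic vector space of dimension $2n$, let $\alpha_1,\alpha_2$ be two Lagrangian subspaces of $V$ with $V=\alpha_1\oplus\alpha_2$, and put $\tilde\alpha_2:=\alpha_2\times\alpha_2$. Let $\tilde\gamma\in\mathcal P_{\tau_1+\tau_2}(V)$ be the iteration of $\gamma_1\in\mathcal P_{\tau_1}(V)$ and $\gamma_2\in\mathcal P_{\tau_2}(V)$. Then $$\nu_1(\gamma_2)-2n\ \le\ i_{\tilde\alpha_2}(\tilde\gamma)-i_{\tilde\alpha_2}(\gamma_1)-i_1(\gamma_2)\ \le\ 0.$$
   Context: A symplectic form on a finite-dimensional complex vector space $V$ is a non-degenerate skew-Hermitian (sesquilinear, linear in the first variable) form $\omega$; $\mathrm{Sp}(V)$ is the group of invertible linear maps preserving $\omega$. A subspace is Lagrangian if it equals its $\omega$-annihilator. $\mathcal P_\tau(V):=\{\gamma\in C([0,\tau],\mathrm{Sp}(V)):\gamma(0)=I_V\}$. For $\gamma\in\mathcal P_\tau(V)$, $\nu_1(\gamma):=\dim\ker(\gamma(\tau)-I_V)$. Iteration of $\gamma_1,\gamma_2$: $\tilde\gamma(t)=\gamma_1(t)$ for $0\le t\le\tau_1$ and $\tilde\gamma(t)=\gamma_2(t-\tau_1)\gamma_1(\tau_1)$ for $\tau_1\le t\le\tau_1+\tau_2$. Maslov index. Let $(X,\Omega)$ be a complex symplectic vector space of dimension $2N$ possessing Lagrangian subspaces. Choose an inner product (linear in the first variable) and $J\in \mathrm{GL}(X)$ with $\Omega(x,y)=\langle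 Jx,y\rangle$; $iJ$ is self-adjoint. Let $X^-$ (resp. $X^+$) be the span of eigenvectors of $iJ$ with positive (resp. negative) eigenvalues. For a continuous path $(\lambda(s),\mu(s))$, $s\in[a,b]$, of pairs of Lagrangian subspaces, write them as graphs of $U_\lambda(s),U_\mu(s):X^-\to X^+$; the operators $U_\lambda(s)U_\mu(s)^{-1}$ are unitary on $(X^+,-i\Omega|_{X^+})$ with eigenvalues $e^{i\theta_j(s)}$, $\theta_j$ continuous real, $j=1,\dots,N$. With $E(x)$ the smallest integer $\ge x$, $\mathrm{Mas}\{\lambda,\mu\}:=\sum_j\big(E(\theta_j(b)/2\pi)-E(\theta_j(a)/2\pi)\big)$ (independent of choices). A single Lagrangian in place of a path means the constant path. Maslov-type index. $V\times V$ carries the symplectic form $(-\omega)\oplus\omega$; graphs $\mathrm{Gr}(A)=\{(x,Ax)\}$, $A\in \mathrm{Sp}(V)$, and $\tilde\alpha_2$ are Lagrangian in it. For a Lagrangian $W\subset V\times V$ and a path $\gamma$ in $\mathrm{Sp}(V)$, $i_W(\gamma):=\mathrm{Mas}\{\mathrm{Gr}\circ\gamma,W\}$, and $i_1(\gamma):=i_{\mathrm{Gr}(I_V)}(\gamma)$. *)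

theory Defs
  imports "HOL-Analysis.Analysis"
begin

section \<open>Complex vector spaces\<close>

text \<open>
  All spaces below are meant to be finite-dimensional; this is a hypothesis of the theorem, not
  part of the class. The norm only provides the topology: every finite-dimensional complex
  vector space carries such a norm, and the topology does not depend on it.
\<close>

class complex_normed_vector = real_normed_vector +
  fixes scaleC :: "complex \<Rightarrow> 'a \<Rightarrow> 'a"  (infixr "*\<^sub>C" 75)
  assumes scaleC_add_right: "a *\<^sub>C (x + y) = a *\<^sub>C x + a *\<^sub>C y"
    and scaleC_add_left: "(a + b) *\<^sub>C x = a *\<^sub>C x + b *\<^sub>C x"
    and scaleC_scaleC: "a *\<^sub>C (b *\<^sub>C x) = (a * b) *\<^sub>C x"
    and scaleC_one: "1 *\<^sub>C x = x"
    and scaleR_scaleC: "r *\<^sub>R x = complex_of_real r *\<^sub>C x"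
    and norm_scaleC: "norm (a *\<^sub>C x) = cmod a * norm x"

global_interpretation complex_vector:
  vector_space "scaleC :: complex \<Rightarrow> 'a \<Rightarrow> 'a::complex_normed_vector"
  defines csubspace = complex_vector.subspace
    and cspan = complex_vector.span
    and cdim = complex_vector.dim
  by unfold_locales (simp_all add: scaleC_add_right scaleC_add_left scaleC_scaleC scaleC_one)

abbreviation clinear :: "('a::complex_normed_vector \<Rightarrow> 'b::complex_normed_vector) \<Rightarrow> bool"
  where "clinear \<equiv> Vector_Spaces.linear scaleC scaleC"

instantiation prod :: (complex_normed_vector, complex_normed_vector) complex_normed_vector
begin

definition scaleC_prod :: "complex \<Rightarrow> 'a \<times> 'b \<Rightarrow> 'a \<times> 'b"
  where "scaleC_prod a z = (a *\<^sub>C fst z, a *\<^sub>C snd z)"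

instance
proof
  fix a b :: complex and x y :: "'a \<times> 'b" and r :: real
  show "a *\<^sub>C (x + y) = a *\<^sub>C x + a *\<^sub>C y" "(a + b) *\<^sub>C x = a *\<^sub>C x + b *\<^sub>C x"
    "a *\<^sub>C (b *\<^sub>C x) = (a * b) *\<^sub>C x" "1 *\<^sub>C x = x"
    "r *\<^sub>R x = complex_of_real r *\<^sub>C x"
    by (simp_all add: scaleC_prod_def prod_eq_iff scaleC_add_right scaleC_add_left scaleC_scaleC
        scaleC_one scaleR_scaleC)
  have "norm (a *\<^sub>C x) = sqrt ((cmod a)\<^sup>2 * ((norm (fst x))\<^sup>2 + (norm (snd x))\<^sup>2))"
    by (simp add: scaleC_prod_def norm_prod_def norm_scaleC power_mult_distrib distrib_left)
  also have "\<dots> = cmod a * norm x"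
    by (simp add: real_sqrt_mult norm_prod_def)
  finally show "norm (a *\<^sub>C x) = cmod a * norm x" .
qed

end


section \<open>Symplectic linear algebra\<close>

definition symplectic_form :: "('a::complex_normed_vector \<Rightarrow> 'a \<Rightarrow> complex) \<Rightarrow> bool" where
  "symplectic_form \<omega> \<longleftrightarrow>
     (\<forall>x x' y. \<omega> (x + x') y = \<omega> x y + \<omega> x' y) \<and>
     (\<forall>c x y. \<omega> (c *\<^sub>C x) y = c * \<omega> x y) \<and>
     (\<forall>x y. \<omega> y x = - cnj (\<omega> x y)) \<and>
     (\<forall>x. (\<forall>y. \<omega> x y = 0) \<longrightarrow> x = 0)"

definition lagrangian :: "('a::complex_normed_vector \<Rightarrow> 'a \<Rightarrow> complex) \<Rightarrow> 'a set \<Rightarrow> bool" where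
  "lagrangian \<omega> L \<longleftrightarrow> csubspace L \<and> L = {x. \<forall>y\<in>L. \<omega> x y = 0}"

definition Sp :: "('a::complex_normed_vector \<Rightarrow> 'a \<Rightarrow> complex) \<Rightarrow> ('a \<Rightarrow>\<^sub>L 'a) set" where
  "Sp \<omega> = {A. clinear (blinfun_apply A) \<and> bij (blinfun_apply A) \<and>
              (\<forall>x y. \<omega> (blinfun_apply A x) (blinfun_apply A y) = \<omega> x y)}"

definition symplectic_paths ::
  "('a::complex_normed_vector \<Rightarrow> 'a \<Rightarrow> complex) \<Rightarrow> real \<Rightarrow> (real \<Rightarrow> 'a \<Rightarrow>\<^sub>L 'a) set" where
  "symplectic_paths \<omega> \<tau> =
     {\<gamma>. continuous_on {0..\<tau>} \<gamma> \<and> \<gamma> ` {0..\<tau>} \<subseteq> Sp \<omega> \<and> \<gamma> 0 = id_blinfun}"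

definition path_iteration ::
  "real \<Rightarrow> (real \<Rightarrow> 'a::complex_normed_vector \<Rightarrow>\<^sub>L 'a) \<Rightarrow> (real \<Rightarrow> 'a \<Rightarrow>\<^sub>L 'a) \<Rightarrow> real \<Rightarrow> 'a \<Rightarrow>\<^sub>L 'a" where
  "path_iteration \<tau>\<^sub>1 \<gamma>\<^sub>1 \<gamma>\<^sub>2 t = (if t \<le> \<tau>\<^sub>1 then \<gamma>\<^sub>1 t else \<gamma>\<^sub>2 (t - \<tau>\<^sub>1) o\<^sub>L \<gamma>\<^sub>1 \<tau>\<^sub>1)"

definition nu1 :: "real \<Rightarrow> (real \<Rightarrow> 'a::complex_normed_vector \<Rightarrow>\<^sub>L 'a) \<Rightarrow> nat" where
  "nu1 \<tau> \<gamma> = cdim {x. blinfun_apply (\<gamma> \<tau> - id_blinfun) x = 0}"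


section \<open>The Maslov index\<close>

definition inner_product :: "('a::complex_normed_vector \<Rightarrow> 'a \<Rightarrow> complex) \<Rightarrow> bool" where
  "inner_product ip \<longleftrightarrow>
     (\<forall>x x' y. ip (x + x') y = ip x y + ip x' y) \<and>
     (\<forall>c x y. ip (c *\<^sub>C x) y = c * ip x y) \<and>
     (\<forall>x y. ip y x = cnj (ip x y)) \<and>
     (\<forall>x. x \<noteq> 0 \<longrightarrow> 0 < Re (ip x x))"

definition Xminus :: "('a::complex_normed_vector \<Rightarrow> 'a) \<Rightarrow> 'a set" where
  "Xminus J = cspan {x. \<exists>c::real. c > 0 \<and> \<i> *\<^sub>C J x = complex_of_real c *\<^sub>C x}"

definition Xplus :: "('a::complex_normed_vector \<Rightarrow> 'a) \<Rightarrow> 'a set" where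
  "Xplus J = cspan {x. \<exists>c::real. c < 0 \<and> \<i> *\<^sub>C J x = complex_of_real c *\<^sub>C x}"

text \<open>
  A Lagrangian \<open>L\<close> is the graph \<open>{x + U x | x \<in> X\<^sup>-}\<close> of a unique linear bijection
  \<open>U : X\<^sup>- \<rightarrow> X\<^sup>+\<close>; \<open>graph_op J L\<close> is that \<open>U\<close>. It is meaningful on \<open>X\<^sup>-\<close> only.
\<close>
definition graph_op :: "('a::complex_normed_vector \<Rightarrow> 'a) \<Rightarrow> 'a set \<Rightarrow> 'a \<Rightarrow> 'a" where
  "graph_op J L x = (THE y. y \<in> Xplus J \<and> x + y \<in> L)"

text \<open>\<open>U\<^sub>L U\<^sub>M\<^sup>-\<^sup>1\<close>, as an operator on \<open>X\<^sup>+\<close>.\<close>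
definition relative_op :: "('a::complex_normed_vector \<Rightarrow> 'a) \<Rightarrow> 'a set \<Rightarrow> 'a set \<Rightarrow> 'a \<Rightarrow> 'a" where
  "relative_op J L M y = graph_op J L (inv_into (Xminus J) (graph_op J M) y)"

text \<open>
  \<open>\<theta> 0, \<dots>, \<theta> (N - 1)\<close> are continuous arguments of the eigenvalues of the operators
  \<open>U\<^sub>\<Lambda>(s) U\<^sub>M(s)\<^sup>-\<^sup>1\<close>, listed with multiplicity. These operators are unitary, hence diagonalizable, so
  the multiplicity of \<open>z\<close> is the dimension of its eigenspace.
\<close>
definition eigen_arguments ::
  "('a::complex_normed_vector \<Rightarrow> 'a) \<Rightarrow> real \<Rightarrow> real \<Rightarrow> (real \<Rightarrow> 'a set) \<Rightarrow> (real \<Rightarrow> 'a set) \<Rightarrow>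
   nat \<Rightarrow> (nat \<Rightarrow> real \<Rightarrow> real) \<Rightarrow> bool" where
  "eigen_arguments J a b \<Lambda> M N \<theta> \<longleftrightarrow>
     (\<forall>j<N. continuous_on {a..b} (\<theta> j)) \<and>
     (\<forall>s\<in>{a..b}. \<forall>z. card {j. j < N \<and> exp (\<i> * complex_of_real (\<theta> j s)) = z} =
        cdim {x \<in> Xplus J. relative_op J (\<Lambda> s) (M s) x = z *\<^sub>C x})"

text \<open>
  The index of a continuous path of pairs of Lagrangians of \<open>\<Omega>\<close> over \<open>[a, b]\<close>. The value
  does not depend on the choice of inner product, \<open>J\<close> and \<open>\<theta>\<close>, whence the definite description.
  For paths that are not continuous or not Lagrangian the value is unspecified.
\<close>
definition maslov_index ::
  "('a::complex_normed_vector \<Rightarrow> 'a \<Rightarrow> complex) \<Rightarrow> real \<Rightarrow> real \<Rightarrow>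
   (real \<Rightarrow> 'a set) \<Rightarrow> (real \<Rightarrow> 'a set) \<Rightarrow> int" where
  "maslov_index \<Omega> a b \<Lambda> M = (THE k. \<exists>ip J N \<theta>.
     inner_product ip \<and>
     clinear J \<and> bij J \<and> (\<forall>x y. \<Omega> x y = ip (J x) y) \<and>
     cdim (UNIV :: 'a set) = 2 * N \<and>
     eigen_arguments J a b \<Lambda> M N \<theta> \<and>
     k = (\<Sum>j<N. \<lceil>\<theta> j b / (2 * pi)\<rceil> - \<lceil>\<theta> j a / (2 * pi)\<rceil>))"


section \<open>Maslov-type indices of symplectic paths\<close>

definition product_form ::
  "('a::complex_normed_vector \<Rightarrow> 'a \<Rightarrow> complex) \<Rightarrow> 'a \<times> 'a \<Rightarrow> 'a \<times> 'a \<Rightarrow> complex" where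
  "product_form \<omega> u v = - \<omega> (fst u) (fst v) + \<omega> (snd u) (snd v)"

definition Gr :: "('a::complex_normed_vector \<Rightarrow>\<^sub>L 'a) \<Rightarrow> ('a \<times> 'a) set" where
  "Gr A = {(x, blinfun_apply A x) | x. True}"

definition maslov_type_index ::
  "('a::complex_normed_vector \<Rightarrow> 'a \<Rightarrow> complex) \<Rightarrow> ('a \<times> 'a) set \<Rightarrow> real \<Rightarrow> (real \<Rightarrow> 'a \<Rightarrow>\<^sub>L 'a) \<Rightarrow> int" where
  "maslov_type_index \<omega> W \<tau> \<gamma> = maslov_index (product_form \<omega>) 0 \<tau> (\<lambda>t. Gr (\<gamma> t)) (\<lambda>_. W)"

abbreviation i1 ::
  "('a::complex_normed_vector \<Rightarrow> 'a \<Rightarrow> complex) \<Rightarrow> real \<Rightarrow> (real \<Rightarrow> 'a \<Rightarrow>\<^sub>L 'a) \<Rightarrow> int" where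
  "i1 \<omega> \<equiv> maslov_type_index \<omega> (Gr id_blinfun)"

end

theory Submission
  imports Defs "HOL-Computational_Algebra.Fundamental_Theorem_Algebra"
begin

text \<open>
  Fix a decomposition of the symplectic space into a negative and a positive subspace of the
  Hermitian form \<open>- \<i> \<Omega>\<close>. The eigenvalues of the relative unitary operator of a pair of Lagrangians
  depend continuously on the pair, and by the argument of the determinant the jump of
  \<open>\<Sum>\<lceil>\<theta>\<^sub>j / 2\<pi>\<rceil>\<close> along a path of pairs over a convex parameter set is the difference of a function of
  the end points. Applied to rectangles, this shows that the Maslov index does not depend on the
  decomposition, hence is invariant under symplectic maps.

  Cutting \<open>[0, \<tau>\<^sub>1 + \<tau>\<^sub>2]\<close> at \<open>\<tau>\<^sub>1\<close> and applying the symplectic map \<open>A \<times> 1\<close>, \<open>A = \<gamma>\<^sub>1 \<tau>\<^sub>1\<close>, to the second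
  piece turns the claim into a comparison of the indices of \<open>Gr \<gamma>\<^sub>2\<close> with respect to
  \<open>W = A \<alpha>\<^sub>2 \<times> \<alpha>\<^sub>2\<close> and to the initial point \<open>D = Gr 1\<close> of the path. Join \<open>D\<close> to \<open>W\<close> by rotating along
  common eigenvectors through angles \<open>\<beta>\<^sub>j\<close>. By the rectangle argument the difference of the two indices
  is the jump of \<open>\<Sum>\<lceil>\<theta>\<^sub>j / 2\<pi>\<rceil>\<close> along this rotation seen from \<open>Gr (\<gamma>\<^sub>2 \<tau>\<^sub>2)\<close>, minus \<open>\<Sum>\<lceil>\<beta>\<^sub>j / 2\<pi>\<rceil>\<close>.
  With all \<open>\<beta>\<^sub>j\<close> in \<open>(0, 2\<pi>]\<close> every crossing is positive and all \<open>\<nu>\<^sub>1\<close> eigenvalues at \<open>1\<close> leave it at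
  once, so the jump is at least \<open>\<nu>\<^sub>1\<close> while the sum is \<open>2n\<close>; with all \<open>\<beta>\<^sub>j\<close> in \<open>(-2\<pi>, 0]\<close> the jump is at
  most \<open>0\<close> and the sum vanishes.
\<close>

section \<open>Continuous families of angles\<close>

text \<open>Continuous labels for the eigenvalues are built along curves only. For a two-parameter
  family just the unordered tuple is followed, through the number of points on each open arc. This
  suffices because the ceiling sum equals the sum of the arguments divided by \<open>2 * pi\<close>,
  plus a defect that depends only on the points of the circle, not on the labels or the lift; the
  first term follows the determinant. Rectangles are then evaluated by two observations. An edge
  along which the two Lagrangians meet in constant dimension contributes nothing; this settles a
  change of splitting, since eigenvalue 1 has the dimension of the intersection as its multiplicity
  in every splitting. On the edge where the path still sits at \<open>D\<close>, the rotation seen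
  from \<open>D\<close> has the explicit arguments \<open>r * \<beta> j\<close>. The end points
  \<open>D\<close> and \<open>W\<close> determine the \<beta> only modulo \<open>2 * pi\<close>, and
  this freedom is what produces two inequalities from one construction.\<close>

lemma equal_fibre_cards_bij:
  fixes f :: "nat \<Rightarrow> 'a" and g :: "nat \<Rightarrow> 'a"
  assumes "\<And>z. card {j. j < N \<and> f j = z} = card {j. j < M \<and> g j = z}"
  shows "N = M" "\<exists>\<pi>. bij_betw \<pi> {..<N} {..<N} \<and> (\<forall>j<N. f j = g (\<pi> j))"
proof -
  have cnt: "count (mset (map h [0..<K])) z = card {j. j < K \<and> h j = z}" for h :: "nat \<Rightarrow> 'a" and K z
  proof -
    have "count (mset (map h [0..<K])) z = length (filter (\<lambda>j. h j = z) [0..<K])"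
      by (induction K) auto
    also have "\<dots> = card {j. j < K \<and> h j = z}"
      by (subst distinct_card[symmetric]) (auto intro!: arg_cong[where f=card])
    finally show ?thesis .
  qed
  have ms: "mset (map f [0..<N]) = mset (map g [0..<M])"
    by (rule multiset_eqI) (simp only: cnt assms)
  from mset_eq_length[OF ms] show NM: "N = M" by simp
  obtain p where p: "p permutes {..<length (map g [0..<M])}" "permute_list p (map g [0..<M]) = map f [0..<N]"
    using mset_eq_permutation[OF ms] by blast
  have "f j = g (p j)" if "j < N" for j
  proof -
    have "p j < M" using p(1) that NM permutes_in_image[OF p(1), of j] by simp
    moreover have "map f [0..<N] ! j = permute_list p (map g [0..<M]) ! j" using p(2) by simp
    ultimately show ?thesis using that NM p(1) by (simp add: permute_list_nth)
  qed
  moreover have "bij_betw p {..<N} {..<N}" using permutes_imp_bij[OF p(1)] NM by simp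
  ultimately show "\<exists>\<pi>. bij_betw \<pi> {..<N} {..<N} \<and> (\<forall>j<N. f j = g (\<pi> j))" by blast
qed

text \<open>Equality of two unordered tuples of points of the unit circle. Multiplicities are
  compared, rather than a permutation demanded, because eigenspace dimensions supply exactly these
  numbers.\<close>

definition same_args :: "nat \<Rightarrow> (nat \<Rightarrow> real) \<Rightarrow> (nat \<Rightarrow> real) \<Rightarrow> bool" where
  "same_args N f g \<longleftrightarrow> (\<forall>z. card {j. j < N \<and> cis (f j) = z} = card {j. j < N \<and> cis (g j) = z})"

lemma same_args_bij:
  assumes "same_args N f g"
  obtains \<pi> where "bij_betw \<pi> {..<N} {..<N}" "\<And>j. j < N \<Longrightarrow> cis (f j) = cis (g (\<pi> j))"
  using equal_fibre_cards_bij(2)[of N "\<lambda>j. cis (f j)" N "\<lambda>j. cis (g j)"] assms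
  unfolding same_args_def by blast

lemma card_reindex:
  assumes "bij_betw \<pi> {..<N::nat} {..<N}"
  shows "card {j. j < N \<and> P (\<pi> j)} = card {j. j < N \<and> P j}"
proof (rule bij_betw_same_card)
  show "bij_betw \<pi> {j. j < N \<and> P (\<pi> j)} {j. j < N \<and> P j}"
    using assms unfolding bij_betw_def inj_on_def by (auto simp: image_iff set_eq_iff) (metis lessThan_iff)+
qed

lemma same_args_card:
  assumes "same_args N f g"
  shows "card {j. j < N \<and> P (cis (f j))} = card {j. j < N \<and> P (cis (g j))}"
proof -
  obtain \<pi> where \<pi>: "bij_betw \<pi> {..<N} {..<N}" "\<And>j. j < N \<Longrightarrow> cis (f j) = cis (g (\<pi> j))"
    using same_args_bij[OF assms] by blast
  have "{j. j < N \<and> P (cis (f j))} = {j. j < N \<and> P (cis (g (\<pi> j)))}" using \<pi>(2) by auto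
  then show ?thesis using card_reindex[OF \<pi>(1), of "\<lambda>j. P (cis (g j))"] by simp
qed

lemma same_args_prod:
  assumes "same_args N f g"
  shows "(\<Prod>j<N. cis (f j)) = (\<Prod>j<N. cis (g j))"
proof -
  obtain \<pi> where \<pi>: "bij_betw \<pi> {..<N} {..<N}" "\<And>j. j < N \<Longrightarrow> cis (f j) = cis (g (\<pi> j))"
    using same_args_bij[OF assms] by blast
  have "(\<Prod>j<N. cis (f j)) = (\<Prod>j<N. cis (g (\<pi> j)))" using \<pi>(2) by simp
  then show ?thesis using prod.reindex_bij_betw[OF \<pi>(1), of "\<lambda>j. cis (g j)"] by simp
qed

lemma same_args_sym: "same_args N f g \<Longrightarrow> same_args N g f"
  and same_args_trans: "same_args N f g \<Longrightarrow> same_args N g h \<Longrightarrow> same_args N f h"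
  by (auto simp: same_args_def)

lemma same_args_reindex:
  assumes "bij_betw \<pi> {..<N} {..<N}" "\<And>j. j < N \<Longrightarrow> cis (f j) = cis (g (\<pi> j))"
  shows "same_args N f g"
  unfolding same_args_def
proof
  fix z
  have "{j. j < N \<and> cis (f j) = z} = {j. j < N \<and> cis (g (\<pi> j)) = z}" using assms(2) by auto
  then show "card {j. j < N \<and> cis (f j) = z} = card {j. j < N \<and> cis (g j) = z}"
    using card_reindex[OF assms(1), of "\<lambda>j. cis (g j) = z"] by simp
qed

lemma cis_eq_iff: "cis x = cis y \<longleftrightarrow> (\<exists>k::int. x = y + 2 * pi * k)"
  using sin_cos_eq_iff[of x y] by (auto simp: complex_eq_iff algebra_simps)

text \<open>Counts the points on the open arc with centre \<open>cis \<psi>\<close> and half-width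
  arccos \<kappa>. In terms of z = \<open>cis (a j)\<close> the condition is Re
  (\<open>cis (-\<psi>)\<close> z) > \<kappa>, which later turns into an inequality between
  Hermitian forms.\<close>

definition arg_count :: "nat \<Rightarrow> (nat \<Rightarrow> real) \<Rightarrow> real \<Rightarrow> real \<Rightarrow> nat" where
  "arg_count N a \<psi> \<kappa> = card {j. j < N \<and> \<kappa> < cos (a j - \<psi>)}"

lemma same_args_arg_count:
  assumes "same_args N f g" shows "arg_count N f \<psi> \<kappa> = arg_count N g \<psi> \<kappa>"
proof -
  have *: "cos (x - \<psi>) = Re (cis x * cis (-\<psi>))" for x by (simp add: cis_mult)
  show ?thesis unfolding arg_count_def * using same_args_card[OF assms, of "\<lambda>z. \<kappa> < Re (z * cis (-\<psi>))"] .
qed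

text \<open>
  Lower semicontinuity on all open arcs amounts to continuity of the unordered tuple of points \<open>e\<^bsup>i a\<^sub>j\<^esup>\<close>,
  because the total number of points is fixed. The arguments themselves may jump.
\<close>

definition lsc_args :: "'p::topological_space set \<Rightarrow> nat \<Rightarrow> ('p \<Rightarrow> nat \<Rightarrow> real) \<Rightarrow> bool" where
  "lsc_args T N a \<longleftrightarrow> (\<forall>p\<in>T. \<forall>\<psi> \<kappa>. \<forall>\<^sub>F q in at p within T. arg_count N (a p) \<psi> \<kappa> \<le> arg_count N (a q) \<psi> \<kappa>)"

text \<open>Inside one period the arc centred at the midpoint of x and y is the interval from x to
  y: the difference of the cosines is 2 sin ((b - x) / 2) sin ((y - b) / 2), both half-angles lie
  strictly between -pi and pi, and the two sines cannot both be negative because x < y.\<close>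

lemma cos_arc_iff:
  fixes b x y \<phi> :: real
  assumes "\<phi> \<le> x" "x < y" "y \<le> \<phi> + 2 * pi" "\<phi> < b" "b < \<phi> + 2 * pi"
  shows "cos ((y - x) / 2) < cos (b - (x + y) / 2) \<longleftrightarrow> x < b \<and> b < y"
proof -
  have eq: "cos (b - (x + y) / 2) - cos ((y - x) / 2) = 2 * (sin ((b - x) / 2) * sin ((y - b) / 2))"
  proof -
    have "sin ((b - x) / 2) * sin ((y - b) / 2) = (cos ((b - x) / 2 - (y - b) / 2) - cos ((b - x) / 2 + (y - b) / 2)) / 2"
      by (rule sin_times_sin)
    moreover have "(b - x) / 2 - (y - b) / 2 = b - (x + y) / 2" "(b - x) / 2 + (y - b) / 2 = (y - x) / 2"
      by (simp_all add: field_simps)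
    ultimately show ?thesis by simp
  qed
  have sgn: "(0 < sin u \<longleftrightarrow> 0 < u) \<and> (sin u < 0 \<longleftrightarrow> u < 0)" if "- pi < u" "u < pi" for u
    using sin_gt_zero[of u] sin_gt_zero[of "-u"] that by (cases u "0::real" rule: linorder_cases) auto
  have 1: "- pi < (b - x) / 2" "(b - x) / 2 < pi" "- pi < (y - b) / 2" "(y - b) / 2 < pi"
    using assms by (simp_all add: field_simps)
  have "cos ((y - x) / 2) < cos (b - (x + y) / 2) \<longleftrightarrow> 0 < sin ((b - x) / 2) * sin ((y - b) / 2)"
    using eq by linarith
  also have "\<dots> \<longleftrightarrow> x < b \<and> b < y"
    using sgn[OF 1(1,2)] sgn[OF 1(3,4)] assms(2) by (auto simp: zero_less_mult_iff)
  finally show ?thesis .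
qed

text \<open>Order statistics expressed by counts. With its mirror image below, it converts lower
  bounds for the number of points on an arc into one-sided bounds for each sorted argument.\<close>

lemma sorted_nth_gt_iff:
  fixes ys :: "real list"
  assumes "sorted ys" "j < length ys"
  shows "x < ys ! j \<longleftrightarrow> length ys - j \<le> card {k. k < length ys \<and> x < ys ! k}"
proof
  assume "x < ys ! j"
  then have "{j..<length ys} \<subseteq> {k. k < length ys \<and> x < ys ! k}"
    using assms by (auto dest: sorted_nth_mono intro: less_le_trans)
  from card_mono[OF _ this] show "length ys - j \<le> card {k. k < length ys \<and> x < ys ! k}" by simp
next
  assume *: "length ys - j \<le> card {k. k < length ys \<and> x < ys ! k}"
  show "x < ys ! j"
  proof (rule ccontr)
    assume n: "\<not> x < ys ! j"
    have "{k. k < length ys \<and> x < ys ! k} \<subseteq> {Suc j..<length ys}"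
    proof safe
      fix k assume "k < length ys" "x < ys ! k"
      then have "\<not> k \<le> j" using n assms sorted_nth_mono[of ys k j] by auto
      then show "k \<in> {Suc j..<length ys}" using \<open>k < length ys\<close> by auto
    qed
    from card_mono[OF _ this] * assms(2) show False by simp
  qed
qed

lemma sorted_nth_lt_iff:
  fixes ys :: "real list"
  assumes "sorted ys" "j < length ys"
  shows "ys ! j < x \<longleftrightarrow> j < card {k. k < length ys \<and> ys ! k < x}"
proof
  assume "ys ! j < x"
  then have "{..j} \<subseteq> {k. k < length ys \<and> ys ! k < x}"
    using assms by (auto intro: le_less_trans[OF sorted_nth_mono[OF assms(1)]])
  from card_mono[OF _ this] show "j < card {k. k < length ys \<and> ys ! k < x}" by simp
next
  assume *: "j < card {k. k < length ys \<and> ys ! k < x}"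
  show "ys ! j < x"
  proof (rule ccontr)
    assume n: "\<not> ys ! j < x"
    have "{k. k < length ys \<and> ys ! k < x} \<subseteq> {..<j}"
    proof safe
      fix k assume "k < length ys" "ys ! k < x"
      then have "\<not> j \<le> k" using n assms sorted_nth_mono[of ys j k] by auto
      then show "k < j" by simp
    qed
    from card_mono[OF _ this] * show False by simp
  qed
qed

lemma cis_period_rep:
  fixes a \<phi> :: real
  defines "b \<equiv> \<phi> + 2 * pi * frac ((a - \<phi>) / (2 * pi))"
  assumes "cis a \<noteq> cis \<phi>"
  shows "\<phi> < b" "b < \<phi> + 2 * pi" "cis b = cis a"
proof -
  have eq: "b = a + 2 * pi * real_of_int (- \<lfloor>(a - \<phi>) / (2 * pi)\<rfloor>)"
    by (simp add: b_def frac_def field_simps)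
  then show c: "cis b = cis a" unfolding cis_eq_iff by blast
  have "frac ((a - \<phi>) / (2 * pi)) \<noteq> 0"
  proof
    assume "frac ((a - \<phi>) / (2 * pi)) = 0"
    then have "b = \<phi>" unfolding b_def by (simp only: mult_zero_right add_0_right)
    then show False using c assms(2) by (simp only:)
  qed
  then have "0 < frac ((a - \<phi>) / (2 * pi))" using frac_ge_0[of "(a - \<phi>) / (2 * pi)"] by linarith
  then show "\<phi> < b" by (simp add: b_def)
  show "b < \<phi> + 2 * pi" using frac_lt_1[of "(a - \<phi>) / (2 * pi)"] by (simp add: b_def)
qed

lemma exists_cis_avoiding: "\<exists>\<phi>. \<forall>j<N::nat. cis (a j) \<noteq> cis (\<phi>::real)"
proof -
  have inj: "inj_on cis {0..1::real}"
  proof (rule inj_onI)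
    fix x y :: real assume xy: "x \<in> {0..1}" "y \<in> {0..1}" "cis x = cis y"
    then obtain k :: int where k: "x = y + 2 * pi * k" using cis_eq_iff by blast
    have p: "2 * pi > 1" using pi_gt3 by linarith
    have "k = 0"
    proof (rule ccontr)
      assume "k \<noteq> 0"
      then have "1 \<le> \<bar>real_of_int k\<bar>" by linarith
      then have "2 * pi * 1 \<le> 2 * pi * \<bar>real_of_int k\<bar>" by (intro mult_left_mono) auto
      also have "\<dots> = \<bar>x - y\<bar>" using k by (simp add: abs_mult)
      finally show False using xy p by auto
    qed
    then show "x = y" using k by simp
  qed
  have inf: "infinite (cis ` {0..1::real})" using finite_imageD[OF _ inj] infinite_Icc[of "0::real" 1] by (meson zero_less_one)
  have "\<not> cis ` {0..1::real} \<subseteq> (\<lambda>j. cis (a j)) ` {..<N}"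
  proof
    assume "cis ` {0..1::real} \<subseteq> (\<lambda>j. cis (a j)) ` {..<N}"
    then have "finite (cis ` {0..1::real})" by (rule finite_subset) simp
    with inf show False by contradiction
  qed
  then obtain \<phi> :: real where "cis \<phi> \<notin> (\<lambda>j. cis (a j)) ` {..<N}" by blast
  then have "\<forall>j<N. cis (a j) \<noteq> cis \<phi>" by force
  then show ?thesis ..
qed

lemma lsc_argsD_open:
  assumes "lsc_args T N a" "p \<in> T"
  shows "\<exists>S. open S \<and> p \<in> S \<and> (\<forall>q\<in>T \<inter> S. arg_count N (a p) \<psi> \<kappa> \<le> arg_count N (a q) \<psi> \<kappa>)"
proof -
  have "\<forall>\<^sub>F q in at p within T. arg_count N (a p) \<psi> \<kappa> \<le> arg_count N (a q) \<psi> \<kappa>"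
    using assms by (auto simp: lsc_args_def)
  then obtain S where "open S" "p \<in> S" "\<forall>q\<in>S. q \<noteq> p \<longrightarrow> q \<in> T \<longrightarrow> arg_count N (a p) \<psi> \<kappa> \<le> arg_count N (a q) \<psi> \<kappa>"
    unfolding eventually_at_topological by blast
  then show ?thesis by (intro exI[of _ S]) force
qed

text \<open>Cut the circle at a point missed by the tuple at \<open>p\<close>. Nearby tuples miss it
  as well: all \<open>N\<close> points at \<open>p\<close> lie on the complementary open arc, and
  that count cannot drop. On the remaining interval the sorted representatives are continuous,
  because \<open>x < \<theta> j q\<close> and \<open>\<theta> j q < x\<close> both amount to lower
  bounds for counts on open arcs.\<close>

lemma local_lift:
  fixes a :: "'p::topological_space \<Rightarrow> nat \<Rightarrow> real"
  assumes lsc: "lsc_args T N a" and p: "p \<in> T"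
  obtains S \<theta> where "open S" "p \<in> S" "\<And>j. j < N \<Longrightarrow> continuous_on (T \<inter> S) (\<theta> j)"
    "\<And>q. q \<in> T \<inter> S \<Longrightarrow> same_args N (\<lambda>j. \<theta> j q) (a q)"
proof -
  obtain \<phi> where \<phi>: "\<And>j. j < N \<Longrightarrow> cis (a p j) \<noteq> cis \<phi>" using exists_cis_avoiding[of N "a p"] by blast
  \<comment> \<open>The arc centred opposite to the cut with cosine bound -1 is the whole circle
    without the cut point.\<close>
  have ne1: "-1 < cos (x - (\<phi> + pi)) \<longleftrightarrow> cis x \<noteq> cis \<phi>" for x
  proof -
    have "cos (x - (\<phi> + pi)) = - cos (x - \<phi>)" using cos_minus_pi[of "x - \<phi>"] by (simp add: algebra_simps)
    moreover have "cos (x - \<phi>) = 1 \<longleftrightarrow> cis x = cis \<phi>"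
      unfolding cos_one_2pi_int cis_eq_iff by (auto simp: algebra_simps)
    moreover have "cos (x - \<phi>) < 1 \<longleftrightarrow> cos (x - \<phi>) \<noteq> 1" using cos_le_one[of "x - \<phi>"] by linarith
    ultimately show ?thesis by auto
  qed
  obtain S where S: "open S" "p \<in> S"
    and cnt: "\<And>q. q \<in> T \<inter> S \<Longrightarrow> arg_count N (a p) (\<phi> + pi) (-1) \<le> arg_count N (a q) (\<phi> + pi) (-1)"
    using lsc_argsD_open[OF lsc p, of "\<phi> + pi" "-1"] by blast
  have good: "cis (a q j) \<noteq> cis \<phi>" if "q \<in> T \<inter> S" "j < N" for q j
  proof -
    have "{j. j < N \<and> -1 < cos (a p j - (\<phi> + pi))} = {..<N}" using ne1 \<phi> by auto
    then have "arg_count N (a p) (\<phi> + pi) (-1) = N" by (simp add: arg_count_def)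
    then have "card {..<N} \<le> card {j. j < N \<and> -1 < cos (a q j - (\<phi> + pi))}"
      using cnt[OF that(1)] by (simp add: arg_count_def)
    then have "{j. j < N \<and> -1 < cos (a q j - (\<phi> + pi))} = {..<N}"
      by (intro card_seteq) auto
    then show ?thesis using ne1 that by blast
  qed
  define b where "b q j = \<phi> + 2 * pi * frac ((a q j - \<phi>) / (2 * pi))" for q j
  have b: "\<phi> < b q j" "b q j < \<phi> + 2 * pi" "cis (b q j) = cis (a q j)" if "q \<in> T \<inter> S" "j < N" for q j
    using cis_period_rep[OF good[OF that]] by (simp_all add: b_def)
  define \<theta> where "\<theta> j q = sort (map (b q) [0..<N]) ! j" for j q
  have perm: "\<exists>\<pi>. bij_betw \<pi> {..<N} {..<N} \<and> (\<forall>j<N. \<theta> j q = b q (\<pi> j))" for q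
  proof -
    obtain \<pi> where \<pi>: "\<pi> permutes {..<length (map (b q) [0..<N])}"
      "permute_list \<pi> (map (b q) [0..<N]) = sort (map (b q) [0..<N])"
      using mset_eq_permutation[of "sort (map (b q) [0..<N])" "map (b q) [0..<N]"] by auto
    have "\<theta> j q = b q (\<pi> j)" if "j < N" for j
    proof -
      have "\<pi> j < N" using \<pi>(1) that permutes_in_image[OF \<pi>(1), of j] by simp
      then show ?thesis unfolding \<theta>_def \<pi>(2)[symmetric] using that \<pi>(1) by (simp add: permute_list_nth)
    qed
    then show ?thesis using permutes_imp_bij[OF \<pi>(1)] by auto
  qed
  have same_b: "same_args N (b q) (a q)" if "q \<in> T \<inter> S" for q
    by (rule same_args_reindex[of id]) (use b[OF that] in \<open>auto simp: bij_betw_id\<close>)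
  have same: "same_args N (\<lambda>j. \<theta> j q) (a q)" if "q \<in> T \<inter> S" for q
  proof -
    obtain \<pi> where "bij_betw \<pi> {..<N} {..<N}" "\<forall>j<N. \<theta> j q = b q (\<pi> j)" using perm by blast
    then have "same_args N (\<lambda>j. \<theta> j q) (b q)" by (intro same_args_reindex) auto
    then show ?thesis using same_args_trans same_b[OF that] by blast
  qed
  have cardb: "card {k. k < N \<and> Q (\<theta> k q)} = card {k. k < N \<and> Q (b q k)}" for Q q
  proof -
    obtain \<pi> where \<pi>: "bij_betw \<pi> {..<N} {..<N}" "\<forall>j<N. \<theta> j q = b q (\<pi> j)" using perm by blast
    then have "{k. k < N \<and> Q (\<theta> k q)} = {k. k < N \<and> Q (b q (\<pi> k))}" by auto
    then show ?thesis using card_reindex[OF \<pi>(1), of "\<lambda>k. Q (b q k)"] by simp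
  qed
  have arc: "arg_count N (a q) ((x + y) / 2) (cos ((y - x) / 2)) = card {k. k < N \<and> x < \<theta> k q \<and> \<theta> k q < y}"
    if q: "q \<in> T \<inter> S" and xy: "\<phi> \<le> x" "x < y" "y \<le> \<phi> + 2 * pi" for q x y
  proof -
    have "arg_count N (a q) ((x + y) / 2) (cos ((y - x) / 2)) = arg_count N (b q) ((x + y) / 2) (cos ((y - x) / 2))"
      using same_args_arg_count[OF same_b[OF q]] by simp
    also have "\<dots> = card {k. k < N \<and> x < b q k \<and> b q k < y}"
      unfolding arg_count_def using cos_arc_iff[OF xy b(1,2)[OF q]] by (intro arg_cong[where f = card]) auto
    also have "\<dots> = card {k. k < N \<and> x < \<theta> k q \<and> \<theta> k q < y}"
      using cardb[of "\<lambda>t. x < t \<and> t < y" q] by simp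
    finally show ?thesis .
  qed
  have range: "\<phi> < \<theta> j q" "\<theta> j q < \<phi> + 2 * pi" if "q \<in> T \<inter> S" "j < N" for q j
  proof -
    obtain \<pi> where \<pi>: "bij_betw \<pi> {..<N} {..<N}" "\<forall>j<N. \<theta> j q = b q (\<pi> j)" using perm by blast
    then have "\<pi> j < N" using that bij_betw_apply by fastforce
    then show "\<phi> < \<theta> j q" "\<theta> j q < \<phi> + 2 * pi" using b(1,2)[OF that(1)] \<pi>(2) that by auto
  qed
  have ev: "\<forall>\<^sub>F q in at q0 within (T \<inter> S). q \<in> T \<inter> S \<and> arg_count N (a q0) \<psi> \<kappa> \<le> arg_count N (a q) \<psi> \<kappa>"
    if q0: "q0 \<in> T \<inter> S" for q0 \<psi> \<kappa>
  proof -
    obtain S' where S': "open S'" "q0 \<in> S'" "\<And>q. q \<in> T \<inter> S' \<Longrightarrow> arg_count N (a q0) \<psi> \<kappa> \<le> arg_count N (a q) \<psi> \<kappa>"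
      using lsc_argsD_open[OF lsc IntD1[OF q0], of \<psi> \<kappa>] by blast
    show ?thesis unfolding eventually_at_topological by (intro exI[of _ S']) (use S' in auto)
  qed
  have cont: "continuous_on (T \<inter> S) (\<theta> j)" if j: "j < N" for j
    unfolding continuous_on_def
  proof (intro ballI order_tendstoI)
    fix q0 x assume q0: "q0 \<in> T \<inter> S" and x: "x < \<theta> j q0"
    \<comment> \<open>Clipping the bound to the period makes the interval from \<open>x'\<close> to
      the end of the period a single arc.\<close>
    define x' where "x' = max x \<phi>"
    have x': "x' < \<theta> j q0" "\<phi> \<le> x'" "x' < \<phi> + 2 * pi" using x range[OF q0 j] by (auto simp: x'_def)
    have gt: "x' < \<theta> j q \<longleftrightarrow> N - j \<le> card {k. k < N \<and> x' < \<theta> k q}" for q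
      using sorted_nth_gt_iff[of "sort (map (b q) [0..<N])" j x'] j by (simp add: \<theta>_def)
    have ca: "arg_count N (a q) ((x' + (\<phi> + 2 * pi)) / 2) (cos ((\<phi> + 2 * pi - x') / 2)) = card {k. k < N \<and> x' < \<theta> k q}"
      if "q \<in> T \<inter> S" for q
      unfolding arc[OF that x'(2,3) order_refl] using range(2)[OF that] by (intro arg_cong[where f = card]) auto
    show "\<forall>\<^sub>F q in at q0 within T \<inter> S. x < \<theta> j q"
    proof (rule eventually_mono[OF ev[OF q0, of "(x' + (\<phi> + 2 * pi)) / 2" "cos ((\<phi> + 2 * pi - x') / 2)"]])
      fix q assume q: "q \<in> T \<inter> S \<and> arg_count N (a q0) ((x' + (\<phi> + 2 * pi)) / 2) (cos ((\<phi> + 2 * pi - x') / 2))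
         \<le> arg_count N (a q) ((x' + (\<phi> + 2 * pi)) / 2) (cos ((\<phi> + 2 * pi - x') / 2))"
      then have "x' < \<theta> j q" using gt[of q] gt[of q0] ca[of q] ca[OF q0] x'(1) by linarith
      then show "x < \<theta> j q" by (simp add: x'_def)
    qed
  next
    fix q0 x assume q0: "q0 \<in> T \<inter> S" and x: "\<theta> j q0 < x"
    define x' where "x' = min x (\<phi> + 2 * pi)"
    have x': "\<theta> j q0 < x'" "\<phi> < x'" "x' \<le> \<phi> + 2 * pi" using x range[OF q0 j] by (auto simp: x'_def)
    have gt: "\<theta> j q < x' \<longleftrightarrow> j < card {k. k < N \<and> \<theta> k q < x'}" for q
      using sorted_nth_lt_iff[of "sort (map (b q) [0..<N])" j x'] j by (simp add: \<theta>_def)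
    have ca: "arg_count N (a q) ((\<phi> + x') / 2) (cos ((x' - \<phi>) / 2)) = card {k. k < N \<and> \<theta> k q < x'}"
      if "q \<in> T \<inter> S" for q
      unfolding arc[OF that order_refl x'(2,3)] using range(1)[OF that] by (intro arg_cong[where f = card]) auto
    show "\<forall>\<^sub>F q in at q0 within T \<inter> S. \<theta> j q < x"
    proof (rule eventually_mono[OF ev[OF q0, of "(\<phi> + x') / 2" "cos ((x' - \<phi>) / 2)"]])
      fix q assume q: "q \<in> T \<inter> S \<and> arg_count N (a q0) ((\<phi> + x') / 2) (cos ((x' - \<phi>) / 2))
         \<le> arg_count N (a q) ((\<phi> + x') / 2) (cos ((x' - \<phi>) / 2))"
      then have "\<theta> j q < x'" using gt[of q] gt[of q0] ca[of q] ca[OF q0] x'(1) by linarith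
      then show "\<theta> j q < x" by (simp add: x'_def)
    qed
  qed
  show ?thesis by (rule that[OF S cont same])
qed

text \<open>Bisection glues local lifts. Where two pieces meet they carry the same unordered tuple,
  so the right piece is relabelled by a permutation and shifted to continue the left one.\<close>

lemma global_lift:
  fixes a :: "real \<Rightarrow> nat \<Rightarrow> real"
  assumes lsc: "lsc_args {u..v} N a" and "u \<le> v"
  shows "\<exists>\<theta>. (\<forall>j<N. continuous_on {u..v} (\<theta> j)) \<and> (\<forall>s\<in>{u..v}. same_args N (\<lambda>j. \<theta> j s) (a s))"
proof -
  define P where "P x y \<longleftrightarrow> (u \<le> x \<and> y \<le> v \<longrightarrow>
     (\<exists>\<theta>. (\<forall>j<N. continuous_on {x..y} (\<theta> j)) \<and> (\<forall>s\<in>{x..y}. same_args N (\<lambda>j. \<theta> j s) (a s))))" for x y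
  have "P u v"
    using \<open>u \<le> v\<close>
  proof (induct rule: Bolzano)
    case (trans x y z)
    show ?case unfolding P_def
    proof
      assume uv: "u \<le> x \<and> z \<le> v"
      obtain \<theta> where \<theta>: "\<And>j. j < N \<Longrightarrow> continuous_on {x..y} (\<theta> j)" "\<And>s. s \<in> {x..y} \<Longrightarrow> same_args N (\<lambda>j. \<theta> j s) (a s)"
        using trans uv unfolding P_def by (meson order_trans)
      obtain \<theta>' where \<theta>': "\<And>j. j < N \<Longrightarrow> continuous_on {y..z} (\<theta>' j)" "\<And>s. s \<in> {y..z} \<Longrightarrow> same_args N (\<lambda>j. \<theta>' j s) (a s)"
        using trans uv unfolding P_def by (meson order_trans)
      have "same_args N (\<lambda>j. \<theta> j y) (\<lambda>j. \<theta>' j y)"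
        using same_args_trans[OF \<theta>(2) same_args_sym[OF \<theta>'(2)]] trans by auto
      then obtain \<pi> where \<pi>: "bij_betw \<pi> {..<N} {..<N}" "\<And>j. j < N \<Longrightarrow> cis (\<theta> j y) = cis (\<theta>' (\<pi> j) y)"
        by (rule same_args_bij) blast
      have \<pi>N: "\<pi> j < N" if "j < N" for j using \<pi>(1) that bij_betw_apply by fastforce
      \<comment> \<open>The added constant is a multiple of \<open>2 * pi\<close>, since both
        arguments at \<open>y\<close> give the same point of the circle; so the tuple is
        unchanged.\<close>
      define \<eta> where "\<eta> j s = (if s \<le> y then \<theta> j s else \<theta>' (\<pi> j) s + (\<theta> j y - \<theta>' (\<pi> j) y))" for j s
      have "continuous_on {x..z} (\<eta> j)" if "j < N" for j
      proof -
        have "continuous_on ({x..y} \<union> {y..z}) (\<eta> j)" unfolding \<eta>_def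
        proof (rule continuous_on_cases)
          show "continuous_on {x..y} (\<theta> j)" using \<theta> that by blast
          show "continuous_on {y..z} (\<lambda>s. \<theta>' (\<pi> j) s + (\<theta> j y - \<theta>' (\<pi> j) y))"
            by (intro continuous_intros \<theta>' \<pi>N that)
        qed auto
        then show ?thesis using trans by (simp add: ivl_disj_un_two_touch)
      qed
      moreover have "same_args N (\<lambda>j. \<eta> j s) (a s)" if s: "s \<in> {x..z}" for s
      proof (cases "s \<le> y")
        case True then show ?thesis using \<theta>(2)[of s] s by (simp add: \<eta>_def)
      next
        case False
        have "cis (\<eta> j s) = cis (\<theta>' (\<pi> j) s)" if "j < N" for j
        proof -
          have "cis (\<eta> j s) = cis (\<theta>' (\<pi> j) s) * (cis (\<theta> j y) / cis (\<theta>' (\<pi> j) y))"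
            using False by (simp add: \<eta>_def cis_mult cis_divide)
          then show ?thesis using \<pi>(2)[OF that] by simp
        qed
        then have "same_args N (\<lambda>j. \<eta> j s) (\<lambda>j. \<theta>' j s)" by (intro same_args_reindex[OF \<pi>(1)])
        then show ?thesis using same_args_trans \<theta>'(2)[of s] False s by auto
      qed
      ultimately show "\<exists>\<theta>. (\<forall>j<N. continuous_on {x..z} (\<theta> j)) \<and> (\<forall>s\<in>{x..z}. same_args N (\<lambda>j. \<theta> j s) (a s))"
        by blast
    qed
  next
    case (local t)
    then have "t \<in> {u..v}" by auto
    from local_lift[OF lsc this] obtain S \<theta> where S: "open S" "t \<in> S"
      "\<And>j. j < N \<Longrightarrow> continuous_on ({u..v} \<inter> S) (\<theta> j)"
      "\<And>q. q \<in> {u..v} \<inter> S \<Longrightarrow> same_args N (\<lambda>j. \<theta> j q) (a q)" by metis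
    from S(1,2) obtain d where d: "d > 0" "\<And>s. dist s t < d \<Longrightarrow> s \<in> S" unfolding open_dist by blast
    have "P x y" if "x \<le> t \<and> t \<le> y \<and> y - x < d" for x y
      unfolding P_def
    proof
      assume "u \<le> x \<and> y \<le> v"
      then have sub: "{x..y} \<subseteq> {u..v} \<inter> S" using that d(2) by (auto simp: dist_real_def)
      show "\<exists>\<theta>. (\<forall>j<N. continuous_on {x..y} (\<theta> j)) \<and> (\<forall>s\<in>{x..y}. same_args N (\<lambda>j. \<theta> j s) (a s))"
        using S(3,4) sub continuous_on_subset by blast
    qed
    then show ?case using d(1) by blast
  qed
  then show ?thesis by (simp add: P_def)
qed

section \<open>The jump of the ceiling sum\<close>

definition ceil_sum :: "nat \<Rightarrow> (nat \<Rightarrow> real) \<Rightarrow> int" where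
  "ceil_sum N f = (\<Sum>j<N. \<lceil>f j / (2 * pi)\<rceil>)"

text \<open>The ceiling of t minus t has period 1. This is the part of the ceiling sum that needs no
  lift.\<close>

lemma ceiling_defect_cong:
  assumes "cis x = cis y"
  shows "of_int \<lceil>x / (2 * pi)\<rceil> - x / (2 * pi) = of_int \<lceil>y / (2 * pi)\<rceil> - y / (2 * pi)"
proof -
  obtain k :: int where "x = y + 2 * pi * k" using assms cis_eq_iff by blast
  then have "x / (2 * pi) = y / (2 * pi) + of_int k" by (simp add: field_simps)
  then show ?thesis by simp
qed

lemma prod_cis: "(\<Prod>j\<in>A. cis (f j)) = cis (\<Sum>j\<in>A. f j)"
  by (induction A rule: infinite_finite_induct) (simp_all add: cis_mult)

text \<open>The difference is continuous with values in the discrete set of multiples of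
  \<open>2 * pi\<close>, hence constant on the interval.\<close>

lemma continuous_cis_const_diff:
  fixes f g :: "real \<Rightarrow> real"
  assumes "continuous_on {u..v} f" "continuous_on {u..v} g" "u \<le> v"
    and "\<And>s. s \<in> {u..v} \<Longrightarrow> cis (f s) = cis (g s)"
  shows "f v - f u = g v - g u"
proof -
  have "(\<lambda>s. f s - g s) constant_on {u..v}"
  proof (rule continuous_discrete_range_constant)
    show "connected {u..v}" by simp
    show "continuous_on {u..v} (\<lambda>s. f s - g s)" by (intro continuous_intros assms)
    fix x assume x: "x \<in> {u..v}"
    have "2 * pi \<le> norm (f y - g y - (f x - g x))"
      if y: "y \<in> {u..v}" "f y - g y \<noteq> f x - g x" for y
    proof -
      obtain k :: int where k: "f y = g y + 2 * pi * k" using assms(4)[OF y(1)] cis_eq_iff by blast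
      obtain l :: int where l: "f x = g x + 2 * pi * l" using assms(4)[OF x] cis_eq_iff by blast
      have eq: "f y - g y - (f x - g x) = 2 * pi * of_int (k - l)" using k l by (simp add: algebra_simps)
      then have "k - l \<noteq> 0" using y(2) by auto
      then have "1 \<le> \<bar>real_of_int (k - l)\<bar>" by linarith
      then have "2 * pi * 1 \<le> 2 * pi * \<bar>real_of_int (k - l)\<bar>" by (intro mult_left_mono) auto
      then show ?thesis unfolding eq by (simp add: abs_mult)
    qed
    then show "\<exists>e>0. \<forall>y. y \<in> {u..v} \<and> f y - g y \<noteq> f x - g x \<longrightarrow> e \<le> norm (f y - g y - (f x - g x))"
      using pi_gt_zero by (intro exI[of _ "2 * pi"]) auto
  qed
  then obtain c where c: "\<And>s. s \<in> {u..v} \<Longrightarrow> f s - g s = c" unfolding constant_on_def by blast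
  show ?thesis using c[of u] c[of v] assms(3) by simp
qed

text \<open>Path independence of the jump, as for an exact differential form: one \<mu> serves all
  curves in \<open>T\<close> and all continuous choices of arguments along them.\<close>

definition index_potential :: "'p::real_normed_vector set \<Rightarrow> nat \<Rightarrow> ('p \<Rightarrow> nat \<Rightarrow> real) \<Rightarrow> ('p \<Rightarrow> real) \<Rightarrow> bool" where
  "index_potential T N a \<mu> \<longleftrightarrow> (\<forall>(u::real) v c \<theta>. u \<le> v \<longrightarrow> continuous_on {u..v} c \<longrightarrow> c ` {u..v} \<subseteq> T \<longrightarrow>
    (\<forall>j<N. continuous_on {u..v} (\<theta> j)) \<longrightarrow> (\<forall>s\<in>{u..v}. same_args N (\<lambda>j. \<theta> j s) (a (c s))) \<longrightarrow>
    of_int (ceil_sum N (\<lambda>j. \<theta> j v) - ceil_sum N (\<lambda>j. \<theta> j u)) = \<mu> (c v) - \<mu> (c u))"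

lemma index_potentialD:
  fixes u v :: real
  assumes "index_potential T N a \<mu>" "u \<le> v" "continuous_on {u..v} c" "c ` {u..v} \<subseteq> T"
    "\<forall>j<N. continuous_on {u..v} (\<theta> j)" "\<forall>s\<in>{u..v}. same_args N (\<lambda>j. \<theta> j s) (a (c s))"
  shows "of_int (ceil_sum N (\<lambda>j. \<theta> j v) - ceil_sum N (\<lambda>j. \<theta> j u)) = \<mu> (c v) - \<mu> (c u)"
  by (rule assms(1)[unfolded index_potential_def, THEN spec[of _ u], THEN spec[of _ v], THEN spec[of _ c], THEN spec[of _ \<theta>],
    THEN mp, OF assms(2), THEN mp, OF assms(3), THEN mp, OF assms(4), THEN mp, OF assms(5), THEN mp, OF assms(6)])

text \<open>The potential is \<open>L p / (2 * pi) + D p\<close>. Here \<open>D\<close> adds up the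
  periodic defects and is defined point by point, while \<open>L\<close> is a continuous argument of
  the product of all points of the tuple, available because a convex set is contractible. Along a
  curve the sum of the lifted arguments and \<open>L\<close> have equal increments.\<close>

theorem index_potential_exists:
  fixes a :: "'p::real_normed_vector \<Rightarrow> nat \<Rightarrow> real"
  assumes lsc: "lsc_args T N a" and T: "convex T"
  shows "\<exists>\<mu>. index_potential T N a \<mu>"
proof -
  define d where "d p = cis (\<Sum>j<N. a p j)" for p
  \<comment> \<open>The product does not depend on labels, so its continuity can be tested on a
    local lift.\<close>
  have "continuous_on T d"
    unfolding continuous_on_def
  proof
    fix p assume p: "p \<in> T"
    from local_lift[OF lsc p] obtain S \<theta> where S: "open S" "p \<in> S"
      "\<And>j. j < N \<Longrightarrow> continuous_on (T \<inter> S) (\<theta> j)"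
      "\<And>q. q \<in> T \<inter> S \<Longrightarrow> same_args N (\<lambda>j. \<theta> j q) (a q)" by metis
    have "continuous_on (T \<inter> S) (\<lambda>q. cis (\<Sum>j<N. \<theta> j q))" by (intro continuous_intros S) auto
    moreover have eq: "cis (\<Sum>j<N. \<theta> j q) = d q" if "q \<in> T \<inter> S" for q
      using same_args_prod[OF S(4)[OF that]] by (simp add: d_def prod_cis)
    ultimately have "continuous_on (T \<inter> S) d" by (rule continuous_on_eq)
    then have "(d \<longlongrightarrow> d p) (at p within (T \<inter> S))" using p S(2) by (simp add: continuous_on_def)
    moreover have "at p within (T \<inter> S) = at p within T" by (rule at_within_nhd[OF S(2,1)]) auto
    ultimately show "(d \<longlongrightarrow> d p) (at p within T)" by simp
  qed
  moreover have "contractible T" using T by (rule convex_imp_contractible)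
  moreover have "d p \<noteq> 0" for p by (simp add: d_def)
  ultimately obtain g where g: "continuous_on T g" "\<And>p. p \<in> T \<Longrightarrow> d p = exp (g p)"
    using continuous_logarithm_on_contractible[of T d] by metis
  define L where "L p = Im (g p)" for p
  have L: "continuous_on T L" unfolding L_def by (intro continuous_intros g)
  have dL: "cis (\<Sum>j<N. a p j) = cis (L p)" if "p \<in> T" for p
  proof -
    have "norm (d p) = 1" by (simp add: d_def)
    then have "Re (g p) = 0" using g(2)[OF that] by simp
    then have "exp (g p) = cis (L p)" unfolding L_def by (simp add: exp_eq_polar)
    then show ?thesis using g(2)[OF that] by (simp add: d_def)
  qed
  define D where "D p = (\<Sum>j<N. of_int \<lceil>a p j / (2 * pi)\<rceil> - a p j / (2 * pi))" for p
  have main: "of_int (ceil_sum N (\<lambda>j. \<theta> j v) - ceil_sum N (\<lambda>j. \<theta> j u)) = (L (c v) / (2 * pi) + D (c v)) - (L (c u) / (2 * pi) + D (c u))"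
    if uv: "u \<le> v" "continuous_on {u..v} c" "c ` {u..v} \<subseteq> T" "\<forall>j<N. continuous_on {u..v} (\<theta> j)"
      "\<forall>s\<in>{u..v}. same_args N (\<lambda>j. \<theta> j s) (a (c s))" for u v :: real and c \<theta>
  proof -
    have "(\<Sum>j<N. \<theta> j v) - (\<Sum>j<N. \<theta> j u) = L (c v) - L (c u)"
    proof (rule continuous_cis_const_diff[where f = "\<lambda>s. \<Sum>j<N. \<theta> j s" and g = "\<lambda>s. L (c s)"])
      show "continuous_on {u..v} (\<lambda>s. \<Sum>j<N. \<theta> j s)" using uv(4) by (intro continuous_intros) auto
      show "continuous_on {u..v} (\<lambda>s. L (c s))" using continuous_on_compose2[OF L uv(2,3)] .
      fix s assume s: "s \<in> {u..v}"
      have "cis (\<Sum>j<N. \<theta> j s) = cis (\<Sum>j<N. a (c s) j)" using same_args_prod[of N "\<lambda>j. \<theta> j s"] uv(5) s by (simp add: prod_cis)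
      moreover have "c s \<in> T" using uv(3) s by blast
      ultimately show "cis (\<Sum>j<N. \<theta> j s) = cis (L (c s))" using dL by metis
    qed fact
    moreover have "of_int (ceil_sum N (\<lambda>j. \<theta> j s)) = (\<Sum>j<N. \<theta> j s) / (2 * pi) + D (c s)" if s: "s \<in> {u..v}" for s
    proof -
      obtain \<pi> where \<pi>: "bij_betw \<pi> {..<N} {..<N}" "\<And>j. j < N \<Longrightarrow> cis (\<theta> j s) = cis (a (c s) (\<pi> j))"
        using same_args_bij[of N "\<lambda>j. \<theta> j s" "a (c s)"] uv(5) s by metis
      have "(\<Sum>j<N. of_int \<lceil>\<theta> j s / (2 * pi)\<rceil> - \<theta> j s / (2 * pi)) =
          (\<Sum>j<N. of_int \<lceil>a (c s) (\<pi> j) / (2 * pi)\<rceil> - a (c s) (\<pi> j) / (2 * pi))"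
        using ceiling_defect_cong[OF \<pi>(2)] by (intro sum.cong) auto
      also have "\<dots> = D (c s)" unfolding D_def by (rule sum.reindex_bij_betw[OF \<pi>(1)])
      finally show ?thesis by (simp add: ceil_sum_def sum_subtractf sum_divide_distrib)
    qed
    ultimately show ?thesis using uv(1) by (simp add: field_simps add_divide_distrib[symmetric] diff_divide_distrib[symmetric])
  qed
  have "index_potential T N a (\<lambda>p. L p / (2 * pi) + D p)"
    unfolding index_potential_def
  proof (intro allI impI)
    fix u v :: real and c \<theta>
    assume "u \<le> v" "continuous_on {u..v} c" "c ` {u..v} \<subseteq> T"
      "\<forall>j<N. continuous_on {u..v} (\<theta> j)" "\<forall>s\<in>{u..v}. same_args N (\<lambda>j. \<theta> j s) (a (c s))"
    from main[OF this] show "of_int (ceil_sum N (\<lambda>j. \<theta> j v) - ceil_sum N (\<lambda>j. \<theta> j u)) =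
      L (c v) / (2 * pi) + D (c v) - (L (c u) / (2 * pi) + D (c u))" .
  qed
  then show ?thesis by blast
qed

lemma cis_one_iff: "cis x = 1 \<longleftrightarrow> x / (2 * pi) \<in> \<int>"
proof -
  have "cis x = 1 \<longleftrightarrow> (\<exists>k::int. x = 2 * pi * k)" using cis_eq_iff[of x 0] by simp
  also have "\<dots> \<longleftrightarrow> (\<exists>k::int. x / (2 * pi) = of_int k)" by (intro ex_cong1) (simp add: field_simps)
  finally show ?thesis by (auto simp: Ints_def)
qed

lemma cos_eq_one_iff_cis: "cos x = 1 \<longleftrightarrow> cis x = 1"
  using cis_eq_iff[of x 0] cos_one_2pi_int[of x] by (simp add: mult.commute mult.left_commute)

text \<open>Keeps all points other than 1 off the closed arc of half-width \<open>2 * \<psi>\<close>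
  around 1. The bound pi / 4 leaves angles up to \<open>3 * \<psi>\<close> below pi, where cosine is
  still monotone.\<close>

lemma exists_small_angle:
  "\<exists>\<psi>. 0 < \<psi> \<and> \<psi> < pi / 4 \<and> (\<forall>j<N::nat. cis (x j) \<noteq> 1 \<longrightarrow> cos (x j) < cos (2 * \<psi>))"
proof -
  have "\<forall>\<^sub>F \<psi> in at_right 0. cos (x j) < cos (2 * \<psi>)" if "cis (x j) \<noteq> 1" for j
  proof -
    have "cos (x j) < 1" using that cos_eq_one_iff_cis cos_le_one[of "x j"] by (simp add: less_le)
    moreover have "((\<lambda>\<psi>::real. cos (2 * \<psi>)) \<longlongrightarrow> cos (2 * 0)) (at_right 0)" by (intro tendsto_intros)
    ultimately show ?thesis by (auto dest: order_tendstoD(1))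
  qed
  then have "\<forall>\<^sub>F \<psi> in at_right 0. \<forall>j\<in>{..<N}. cis (x j) \<noteq> 1 \<longrightarrow> cos (x j) < cos (2 * \<psi>)"
    by (intro eventually_ball_finite) (auto elim: eventually_mono)
  moreover have "\<forall>\<^sub>F \<psi> in at_right (0::real). 0 < \<psi> \<and> \<psi> < pi / 4"
    using eventually_at_right_real[of 0 "pi / 4"] by auto
  ultimately have "\<forall>\<^sub>F \<psi> in at_right (0::real). (0 < \<psi> \<and> \<psi> < pi / 4) \<and> (\<forall>j\<in>{..<N}. cis (x j) \<noteq> 1 \<longrightarrow> cos (x j) < cos (2 * \<psi>))"
    by eventually_elim auto
  then show ?thesis using eventually_happens'[OF trivial_limit_at_right_real] by fastforce
qed

text \<open>Arguments off the multiples of \<open>2 * pi\<close> keep their ceiling nearby. An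
  argument at 2 pi k has ceiling k, keeps it when it moves down and passes to k + 1 as soon as it
  moves up. So near \<open>p\<close> the ceiling sum exceeds its value at \<open>p\<close> by the
  number of arguments that have risen, and never falls below it.\<close>

lemma ceil_sum_local:
  fixes \<theta> :: "nat \<Rightarrow> real \<Rightarrow> real"
  assumes cont: "\<And>j. j < N \<Longrightarrow> continuous_on T (\<theta> j)" and p: "p \<in> T"
    and \<psi>: "0 < \<psi>" "\<And>j. j < N \<Longrightarrow> cis (\<theta> j p) \<noteq> 1 \<Longrightarrow> cos (\<theta> j p) < cos (2 * \<psi>)" "\<psi> < pi / 4"
  shows "\<exists>d>0. \<forall>r\<in>T. dist r p < d \<longrightarrow>
    ceil_sum N (\<lambda>j. \<theta> j r) = ceil_sum N (\<lambda>j. \<theta> j p) + int (card {j. j < N \<and> cis (\<theta> j p) = 1 \<and> \<theta> j p < \<theta> j r}) \<and>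
    (\<forall>j<N. cis (\<theta> j p) \<noteq> 1 \<longrightarrow> cos (\<theta> j r) < cos (2 * \<psi>)) \<and>
    (\<forall>j<N. cis (\<theta> j p) = 1 \<longrightarrow> \<bar>\<theta> j r - \<theta> j p\<bar> < 2 * \<psi>)" (is "\<exists>d>0. \<forall>r\<in>T. dist r p < d \<longrightarrow> ?R r")
proof -
  let ?c = "\<lambda>x. \<lceil>x / (2 * pi)\<rceil>"
  let ?P = "\<lambda>j r. ?c (\<theta> j r) = ?c (\<theta> j p) + (if cis (\<theta> j p) = 1 \<and> \<theta> j p < \<theta> j r then 1 else 0) \<and>
    (cis (\<theta> j p) \<noteq> 1 \<longrightarrow> cos (\<theta> j r) < cos (2 * \<psi>)) \<and>
    (cis (\<theta> j p) = 1 \<longrightarrow> \<bar>\<theta> j r - \<theta> j p\<bar> < 2 * \<psi>)"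
  have "\<forall>\<^sub>F r in at p within T. ?P j r" if j: "j < N" for j
  proof -
    have lim: "(\<theta> j \<longlongrightarrow> \<theta> j p) (at p within T)" using cont[OF j] p by (simp add: continuous_on_def)
    show ?thesis
    proof (cases "cis (\<theta> j p) = 1")
      case True
      then obtain k :: int where "\<theta> j p / (2 * pi) = of_int k" using cis_one_iff Ints_cases by metis
      then have k: "\<theta> j p = 2 * pi * of_int k" by (simp add: field_simps)
      have "\<forall>\<^sub>F r in at p within T. dist (\<theta> j r) (\<theta> j p) < 2 * \<psi>"
        using tendstoD[OF lim, of "2 * \<psi>"] \<psi>(1) by simp
      then show ?thesis
      proof eventually_elim
        case (elim r)
        then have ab: "\<bar>\<theta> j r - \<theta> j p\<bar> < 2 * \<psi>" by (simp add: dist_real_def)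
        have ck: "?c (\<theta> j p) = k" unfolding k by simp
        have b: "\<bar>\<theta> j r - 2 * pi * of_int k\<bar> < 2 * pi" using ab \<psi>(3) unfolding k by linarith
        have "?c (\<theta> j r) = k + (if \<theta> j p < \<theta> j r then 1 else 0)"
        proof (cases "\<theta> j p < \<theta> j r")
          case True
          have "of_int k < \<theta> j r / (2 * pi)" "\<theta> j r / (2 * pi) \<le> of_int k + 1"
            using True b unfolding k by (auto simp: field_simps)
          then show ?thesis using True by (simp add: ceiling_eq_iff)
        next
          case False
          have "of_int k - 1 < \<theta> j r / (2 * pi)" "\<theta> j r / (2 * pi) \<le> of_int k"
            using False b unfolding k by (auto simp: field_simps)
          then show ?thesis using False by (simp add: ceiling_eq_iff)
        qed
        then show ?case using ab ck True by simp
      qed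
    next
      case False
      define k where "k = ?c (\<theta> j p)"
      have "\<theta> j p / (2 * pi) \<noteq> of_int k" using False unfolding cis_one_iff by (metis Ints_of_int)
      then have k: "of_int k - 1 < \<theta> j p / (2 * pi)" "\<theta> j p / (2 * pi) < of_int k"
        unfolding k_def by linarith+
      have l: "((\<lambda>r. \<theta> j r / (2 * pi)) \<longlongrightarrow> \<theta> j p / (2 * pi)) (at p within T)" by (intro tendsto_intros lim) simp
      have "\<forall>\<^sub>F r in at p within T. cos (\<theta> j r) < cos (2 * \<psi>)"
        using order_tendstoD(2)[OF tendsto_cos[OF lim] \<psi>(2)[OF j False]] .
      with order_tendstoD(1)[OF l k(1)] order_tendstoD(2)[OF l k(2)] show ?thesis
      proof eventually_elim
        case (elim r)
        then have "?c (\<theta> j r) = k" by (simp add: ceiling_eq_iff)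
        then show ?case using elim False by (simp add: k_def)
      qed
    qed
  qed
  then have "\<forall>\<^sub>F r in at p within T. \<forall>j\<in>{..<N}. ?P j r" by (intro eventually_ball_finite) auto
  then obtain d where d: "d > 0" "\<forall>r\<in>T. r \<noteq> p \<and> dist r p < d \<longrightarrow> (\<forall>j\<in>{..<N}. ?P j r)"
    unfolding eventually_at by blast
  \<comment> \<open>The punctured neighbourhood above says nothing about \<open>p\<close>
    itself.\<close>
  moreover have "\<forall>j\<in>{..<N}. ?P j p" using \<psi> by auto
  ultimately have all: "\<forall>j\<in>{..<N}. ?P j r" if "r \<in> T" "dist r p < d" for r using that by metis
  have "?R r" if "r \<in> T" "dist r p < d" for r
  proof -
    note elim = all[OF that]
    have "ceil_sum N (\<lambda>j. \<theta> j r) = (\<Sum>j<N. ?c (\<theta> j p) + (if cis (\<theta> j p) = 1 \<and> \<theta> j p < \<theta> j r then 1 else 0))"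
      unfolding ceil_sum_def using elim by (intro sum.cong) auto
    also have "\<dots> = ceil_sum N (\<lambda>j. \<theta> j p) + int (card {j. j < N \<and> cis (\<theta> j p) = 1 \<and> \<theta> j p < \<theta> j r})"
    proof -
      have "(\<Sum>j<N. if cis (\<theta> j p) = 1 \<and> \<theta> j p < \<theta> j r then 1 else 0) = int (card {j. j < N \<and> cis (\<theta> j p) = 1 \<and> \<theta> j p < \<theta> j r})"
        by (simp add: sum.If_cases) (intro arg_cong[where f = card], auto)
      then show ?thesis by (simp add: sum.distrib ceil_sum_def)
    qed
    finally show ?thesis using elim by auto
  qed
  then show ?thesis using d(1) by blast
qed

text \<open>Close to \<open>p\<close> no further argument can reach a multiple of
  \<open>2 * pi\<close>, so constant multiplicity forces the same indices to remain on multiples;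
  having moved by less than one period, they have not moved at all. Thus nothing has risen.\<close>

lemma ceil_sum_const_kernel:
  fixes \<theta> :: "nat \<Rightarrow> real \<Rightarrow> real"
  assumes "u \<le> v" and cont: "\<And>j. j < N \<Longrightarrow> continuous_on {u..v} (\<theta> j)"
    and ker: "\<And>s. s \<in> {u..v} \<Longrightarrow> card {j. j < N \<and> cis (\<theta> j s) = 1} = m"
  shows "ceil_sum N (\<lambda>j. \<theta> j v) = ceil_sum N (\<lambda>j. \<theta> j u)"
proof -
  let ?S = "\<lambda>r. ceil_sum N (\<lambda>j. \<theta> j r)"
  define P where "P x y \<longleftrightarrow> (u \<le> x \<and> y \<le> v \<longrightarrow> ?S y = ?S x)" for x y
  have "P u v" using \<open>u \<le> v\<close>
  proof (induct rule: Bolzano)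
    case (trans a b c) then show ?case unfolding P_def by auto
  next
    case (local p)
    then have p: "p \<in> {u..v}" by auto
    obtain \<psi> where \<psi>: "0 < \<psi>" "\<psi> < pi / 4" "\<And>j. j < N \<Longrightarrow> cis (\<theta> j p) \<noteq> 1 \<Longrightarrow> cos (\<theta> j p) < cos (2 * \<psi>)"
      using exists_small_angle[of N "\<lambda>j. \<theta> j p"] by blast
    obtain d where d: "d > 0" and *: "\<And>r. r \<in> {u..v} \<Longrightarrow> dist r p < d \<Longrightarrow>
      ?S r = ?S p + int (card {j. j < N \<and> cis (\<theta> j p) = 1 \<and> \<theta> j p < \<theta> j r}) \<and>
      (\<forall>j<N. cis (\<theta> j p) \<noteq> 1 \<longrightarrow> cos (\<theta> j r) < cos (2 * \<psi>)) \<and>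
      (\<forall>j<N. cis (\<theta> j p) = 1 \<longrightarrow> \<bar>\<theta> j r - \<theta> j p\<bar> < 2 * \<psi>)"
      using ceil_sum_local[of N "{u..v}" \<theta>, OF cont p \<psi>(1,3,2)] by blast
    have eqS: "?S r = ?S p" if r: "r \<in> {u..v}" "dist r p < d" for r
    proof -
      let ?J = "\<lambda>s. {j. j < N \<and> cis (\<theta> j s) = 1}"
      have "?J r \<subseteq> ?J p"
      proof
        fix j assume j: "j \<in> ?J r"
        show "j \<in> ?J p"
        proof (rule ccontr)
          assume "j \<notin> ?J p"
          then have "cos (\<theta> j r) < cos (2 * \<psi>)" using *[OF r] j by auto
          then show False using j cos_eq_one_iff_cis[of "\<theta> j r"] cos_le_one[of "2 * \<psi>"] by auto
        qed
      qed
      then have eq: "?J r = ?J p" using ker r(1) p by (intro card_subset_eq) auto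
      have "\<not> \<theta> j p < \<theta> j r" if j: "j \<in> ?J p" for j
      proof -
        have "cis (\<theta> j r) = cis (\<theta> j p)" using j eq by auto
        then obtain k :: int where k: "\<theta> j r = \<theta> j p + 2 * pi * k" using cis_eq_iff by blast
        have "\<bar>\<theta> j r - \<theta> j p\<bar> < 2 * pi * 1" using *[OF r] j \<psi>(2) by auto
        then have "\<bar>real_of_int k\<bar> < 1" unfolding k by (simp add: abs_mult)
        then have "k = 0" by linarith
        then show ?thesis using k by simp
      qed
      then have "{j. j < N \<and> cis (\<theta> j p) = 1 \<and> \<theta> j p < \<theta> j r} = {}" by blast
      then show ?thesis using *[OF r] by simp
    qed
    have "P x y" if xy: "x \<le> p \<and> p \<le> y \<and> y - x < d" for x y
      unfolding P_def
    proof
      assume "u \<le> x \<and> y \<le> v"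
      then have "?S x = ?S p" "?S y = ?S p" using xy by (intro eqS; simp add: dist_real_def)+
      then show "?S y = ?S x" by simp
    qed
    then show ?case using d by blast
  qed
  then show ?thesis by (simp add: P_def)
qed

text \<open>An angle within \<psi> of a multiple of \<open>2 * pi\<close> stays within
  \<open>2 * \<psi>\<close> of it after a shift by \<psi>. Bounding |sin y| by sin \<psi> in the
  addition formulas avoids naming the multiple.\<close>

lemma cos_ge_double_angle:
  fixes y \<psi> :: real
  assumes "cos \<psi> \<le> cos y" "0 < \<psi>" "\<psi> < pi / 4"
  shows "cos (2 * \<psi>) \<le> cos (y - \<psi>)" "cos (2 * \<psi>) \<le> cos (y + \<psi>)"
proof -
  have s: "0 < sin \<psi>" using assms pi_gt_zero by (intro sin_gt_zero) linarith+
  have c: "0 < cos \<psi>" using assms pi_gt_zero by (intro cos_gt_zero) linarith+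
  have "(cos \<psi>)\<^sup>2 \<le> (cos y)\<^sup>2" using assms(1) c by (intro power_mono) auto
  then have "(sin y)\<^sup>2 \<le> (sin \<psi>)\<^sup>2" by (simp add: sin_squared_eq)
  then have sy: "\<bar>sin y\<bar> \<le> sin \<psi>" using s by (metis abs_le_square_iff abs_of_pos)
  have 1: "cos \<psi> * cos \<psi> \<le> cos y * cos \<psi>" using assms(1) c by (intro mult_right_mono) auto
  have 2: "\<bar>sin y * sin \<psi>\<bar> \<le> sin \<psi> * sin \<psi>" using sy s by (simp add: abs_mult)
  have 3: "cos (2 * \<psi>) = cos \<psi> * cos \<psi> - sin \<psi> * sin \<psi>" by (simp add: cos_double power2_eq_square)
  show "cos (2 * \<psi>) \<le> cos (y - \<psi>)" "cos (2 * \<psi>) \<le> cos (y + \<psi>)"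
    unfolding cos_diff cos_add using 1 2 3 by linarith+
qed

text \<open>The hypothesis \<open>left\<close> says that shortly before \<open>p\<close> the closed
  arc from \<open>- 2 * \<psi>\<close> to 0 carries at least as many points as sit at 1 at
  \<open>p\<close>. By the choice of \<psi> these belong to exactly the arguments that arrive at 1,
  so they come from below or rest, and the ceiling sum just before \<open>p\<close> equals its value
  at \<open>p\<close>. After \<open>p\<close> it cannot be smaller, by
  \<open>ceil_sum_local\<close>.\<close>

lemma ceil_sum_mono:
  fixes \<theta> :: "nat \<Rightarrow> real \<Rightarrow> real"
  assumes "u \<le> v" and cont: "\<And>j. j < N \<Longrightarrow> continuous_on {u..v} (\<theta> j)"
    and left: "\<And>p \<psi>. u < p \<Longrightarrow> p \<le> v \<Longrightarrow> 0 < \<psi> \<Longrightarrow> \<psi> < pi / 4 \<Longrightarrow>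
      \<exists>d>0. \<forall>r\<in>{u..<p}. p - r < d \<longrightarrow> card {j. j < N \<and> cis (\<theta> j p) = 1} \<le> card {j. j < N \<and> cos \<psi> \<le> cos (\<theta> j r + \<psi>)}"
  shows "ceil_sum N (\<lambda>j. \<theta> j u) \<le> ceil_sum N (\<lambda>j. \<theta> j v)"
proof -
  let ?S = "\<lambda>r. ceil_sum N (\<lambda>j. \<theta> j r)"
  define P where "P x y \<longleftrightarrow> (u \<le> x \<and> y \<le> v \<longrightarrow> ?S x \<le> ?S y)" for x y
  have "P u v" using \<open>u \<le> v\<close>
  proof (induct rule: Bolzano)
    case (trans a b c) then show ?case unfolding P_def by auto
  next
    case (local p)
    then have p: "p \<in> {u..v}" by auto
    obtain \<psi> where \<psi>: "0 < \<psi>" "\<psi> < pi / 4" "\<And>j. j < N \<Longrightarrow> cis (\<theta> j p) \<noteq> 1 \<Longrightarrow> cos (\<theta> j p) < cos (2 * \<psi>)"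
      using exists_small_angle[of N "\<lambda>j. \<theta> j p"] by blast
    obtain d where d: "d > 0" and *: "\<And>r. r \<in> {u..v} \<Longrightarrow> dist r p < d \<Longrightarrow>
      ?S r = ?S p + int (card {j. j < N \<and> cis (\<theta> j p) = 1 \<and> \<theta> j p < \<theta> j r}) \<and>
      (\<forall>j<N. cis (\<theta> j p) \<noteq> 1 \<longrightarrow> cos (\<theta> j r) < cos (2 * \<psi>)) \<and>
      (\<forall>j<N. cis (\<theta> j p) = 1 \<longrightarrow> \<bar>\<theta> j r - \<theta> j p\<bar> < 2 * \<psi>)"
      using ceil_sum_local[of N "{u..v}" \<theta>, OF cont p \<psi>(1,3,2)] by blast
    have right: "?S p \<le> ?S r" if "r \<in> {u..v}" "dist r p < d" for r using *[OF that] by linarith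
    have "\<exists>e>0. \<forall>r\<in>{u..<p}. p - r < e \<longrightarrow> ?S r = ?S p"
    proof (cases "u < p")
      case True
      obtain e where e: "e > 0" and le: "\<And>r. r \<in> {u..<p} \<Longrightarrow> p - r < e \<Longrightarrow>
          card {j. j < N \<and> cis (\<theta> j p) = 1} \<le> card {j. j < N \<and> cos \<psi> \<le> cos (\<theta> j r + \<psi>)}"
        using left[OF True _ \<psi>(1,2)] p by auto
      have "?S r = ?S p" if r0: "r \<in> {u..<p}" "p - r < min d e" for r
      proof -
        have r: "r \<in> {u..v}" "dist r p < d" using r0 p by (auto simp: dist_real_def)
        let ?J = "{j. j < N \<and> cis (\<theta> j p) = 1}" and ?K = "{j. j < N \<and> cos \<psi> \<le> cos (\<theta> j r + \<psi>)}"
        have "?K \<subseteq> ?J"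
        proof
          fix j assume j: "j \<in> ?K"
          then have "cos (2 * \<psi>) \<le> cos (\<theta> j r)"
            using cos_ge_double_angle(1)[of \<psi> "\<theta> j r + \<psi>"] \<psi> by auto
          then show "j \<in> ?J" using *[OF r] j by (auto simp: not_less[symmetric])
        qed
        then have KJ: "?K = ?J" using le[OF r0(1)] r0(2) by (intro card_seteq) auto
        have "\<not> \<theta> j p < \<theta> j r" if j: "j \<in> ?J" for j
        proof
          assume lt: "\<theta> j p < \<theta> j r"
          define t where "t = \<theta> j r - \<theta> j p"
          have t: "0 < t" "t < 2 * \<psi>" using lt *[OF r] j by (auto simp: t_def)
          have "cis (\<theta> j r + \<psi>) = cis (t + \<psi>) * cis (\<theta> j p)" by (simp add: cis_mult t_def algebra_simps)
          then have "cis (\<theta> j r + \<psi>) = cis (t + \<psi>)" using j by simp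
          then have "cos (\<theta> j r + \<psi>) = cos (t + \<psi>)" by (metis cis.simps(1))
          moreover have "cos (t + \<psi>) < cos \<psi>" using t \<psi> by (intro cos_monotone_0_pi) linarith+
          moreover have "j \<in> ?K" unfolding KJ by (rule j)
          ultimately show False by simp
        qed
        then have "{j. j < N \<and> cis (\<theta> j p) = 1 \<and> \<theta> j p < \<theta> j r} = {}" by blast
        then show ?thesis using *[OF r] by simp
      qed
      then show ?thesis using d e by (intro exI[of _ "min d e"]) auto
    next
      case False
      then have "{u..<p} = {}" using p by auto
      then show ?thesis by (intro exI[of _ 1]) auto
    qed
    then obtain e where e: "e > 0" "\<And>r. r \<in> {u..<p} \<Longrightarrow> p - r < e \<Longrightarrow> ?S r = ?S p" by blast
    have "?S x \<le> ?S y" if "x \<le> p \<and> p \<le> y \<and> y - x < min d e" "u \<le> x" "y \<le> v" for x y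
    proof -
      have "?S x = ?S p" using e(2)[of x] that by (cases "x = p") auto
      also have "?S p \<le> ?S y" using right[of y] that by (auto simp: dist_real_def)
      finally show ?thesis .
    qed
    then have "P x y" if "x \<le> p \<and> p \<le> y \<and> y - x < min d e" for x y
      using that unfolding P_def by blast
    moreover have "min d e > 0" using d e(1) by simp
    ultimately show ?case by blast
  qed
  then show ?thesis using \<open>u \<le> v\<close> by (simp add: P_def)
qed

text \<open>The hypothesis \<open>right\<close> says that directly after \<open>u\<close> the open
  arc from 0 to \<open>2 * \<psi>\<close> carries at least as many points as sat at 1. Hence every
  argument at 1 has left upwards and adds one to the ceiling sum. From a slightly later time on,
  \<open>ceil_sum_mono\<close> applies.\<close>

lemma ceil_sum_strict_mono:
  fixes \<theta> :: "nat \<Rightarrow> real \<Rightarrow> real"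
  assumes "u < v" and cont: "\<And>j. j < N \<Longrightarrow> continuous_on {u..v} (\<theta> j)"
    and left: "\<And>p \<psi>. u < p \<Longrightarrow> p \<le> v \<Longrightarrow> 0 < \<psi> \<Longrightarrow> \<psi> < pi / 4 \<Longrightarrow>
      \<exists>d>0. \<forall>r\<in>{u..<p}. p - r < d \<longrightarrow> card {j. j < N \<and> cis (\<theta> j p) = 1} \<le> card {j. j < N \<and> cos \<psi> \<le> cos (\<theta> j r + \<psi>)}"
    and right: "\<And>\<psi>. 0 < \<psi> \<Longrightarrow> \<psi> < pi / 4 \<Longrightarrow>
      \<exists>d>0. \<forall>r\<in>{u<..v}. r - u < d \<longrightarrow> card {j. j < N \<and> cis (\<theta> j u) = 1} \<le> card {j. j < N \<and> cos \<psi> < cos (\<theta> j r - \<psi>)}"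
  shows "ceil_sum N (\<lambda>j. \<theta> j u) + int (card {j. j < N \<and> cis (\<theta> j u) = 1}) \<le> ceil_sum N (\<lambda>j. \<theta> j v)"
proof -
  let ?S = "\<lambda>r. ceil_sum N (\<lambda>j. \<theta> j r)"
  let ?J = "{j. j < N \<and> cis (\<theta> j u) = 1}"
  have u: "u \<in> {u..v}" using assms(1) by simp
  obtain \<psi> where \<psi>: "0 < \<psi>" "\<psi> < pi / 4" "\<And>j. j < N \<Longrightarrow> cis (\<theta> j u) \<noteq> 1 \<Longrightarrow> cos (\<theta> j u) < cos (2 * \<psi>)"
    using exists_small_angle[of N "\<lambda>j. \<theta> j u"] by blast
  obtain d where d: "d > 0" and *: "\<And>r. r \<in> {u..v} \<Longrightarrow> dist r u < d \<Longrightarrow>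
    ?S r = ?S u + int (card {j. j < N \<and> cis (\<theta> j u) = 1 \<and> \<theta> j u < \<theta> j r}) \<and>
    (\<forall>j<N. cis (\<theta> j u) \<noteq> 1 \<longrightarrow> cos (\<theta> j r) < cos (2 * \<psi>)) \<and>
    (\<forall>j<N. cis (\<theta> j u) = 1 \<longrightarrow> \<bar>\<theta> j r - \<theta> j u\<bar> < 2 * \<psi>)"
    using ceil_sum_local[of N "{u..v}" \<theta>, OF cont u \<psi>(1,3,2)] by blast
  obtain e where e: "e > 0" and le: "\<And>r. r \<in> {u<..v} \<Longrightarrow> r - u < e \<Longrightarrow>
      card ?J \<le> card {j. j < N \<and> cos \<psi> < cos (\<theta> j r - \<psi>)}"
    using right[OF \<psi>(1,2)] by blast
  \<comment> \<open>A time after \<open>u\<close> close enough for both estimates and not beyond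
    \<open>v\<close>.\<close>
  define r where "r = u + min (v - u) (min (d / 2) (e / 2))"
  have r: "r \<in> {u..v}" "dist r u < d" "r \<in> {u<..v}" "r - u < e"
    using assms(1) d e by (auto simp: r_def dist_real_def min_def)
  let ?K = "{j. j < N \<and> cos \<psi> < cos (\<theta> j r - \<psi>)}"
  have "?K \<subseteq> ?J"
  proof
    fix j assume j: "j \<in> ?K"
    then have "cos (2 * \<psi>) \<le> cos (\<theta> j r)"
      using cos_ge_double_angle(2)[of \<psi> "\<theta> j r - \<psi>"] \<psi> by auto
    then show "j \<in> ?J" using *[OF r(1,2)] j by (auto simp: not_less[symmetric])
  qed
  then have KJ: "?K = ?J" using le[OF r(3,4)] by (intro card_seteq) auto
  have "\<theta> j u < \<theta> j r" if j: "j \<in> ?J" for j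
  proof (rule ccontr)
    assume lt: "\<not> \<theta> j u < \<theta> j r"
    define t where "t = \<theta> j u - \<theta> j r"
    have t: "0 \<le> t" "t < 2 * \<psi>" using lt *[OF r(1,2)] j by (auto simp: t_def)
    have "cis (\<theta> j r - \<psi>) = cis (- (t + \<psi>)) * cis (\<theta> j u)" by (simp add: cis_mult t_def algebra_simps)
    then have "cis (\<theta> j r - \<psi>) = cis (- (t + \<psi>))" using j by simp
    then have "cos (\<theta> j r - \<psi>) = cos (t + \<psi>)" by (metis cis.simps(1) cos_minus)
    moreover have "cos (t + \<psi>) \<le> cos \<psi>" using t \<psi> by (intro cos_monotone_0_pi_le) linarith+
    moreover have "j \<in> ?K" unfolding KJ by (rule j)
    ultimately show False by simp
  qed
  then have "{j. j < N \<and> cis (\<theta> j u) = 1 \<and> \<theta> j u < \<theta> j r} = ?J" by blast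
  then have "?S r = ?S u + int (card ?J)" using *[OF r(1,2)] by simp
  moreover have "?S r \<le> ?S v"
  proof (rule ceil_sum_mono)
    show "r \<le> v" using r by simp
    show "continuous_on {r..v} (\<theta> j)" if "j < N" for j
      using cont[OF that] by (rule continuous_on_subset) (use r in auto)
    fix p \<psi> :: real assume p: "r < p" "p \<le> v" "0 < \<psi>" "\<psi> < pi / 4"
    have "u < p" using r(3) p(1) by simp
    from left[OF this p(2-4)] obtain d where "d > 0" "\<And>s. s \<in> {u..<p} \<Longrightarrow> p - s < d \<Longrightarrow>
        card {j. j < N \<and> cis (\<theta> j p) = 1} \<le> card {j. j < N \<and> cos \<psi> \<le> cos (\<theta> j s + \<psi>)}"
      by blast
    then show "\<exists>d>0. \<forall>s\<in>{r..<p}. p - s < d \<longrightarrow>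
        card {j. j < N \<and> cis (\<theta> j p) = 1} \<le> card {j. j < N \<and> cos \<psi> \<le> cos (\<theta> j s + \<psi>)}"
      using r by (intro exI[of _ d]) auto
  qed
  ultimately show ?thesis by simp
qed

section \<open>Complex linear algebra and Hermitian forms\<close>

lemma clinearI:
  assumes "\<And>x y. f (x + y) = f x + f y" "\<And>c x. f (c *\<^sub>C x) = c *\<^sub>C f x"
  shows "clinear f"
  using assms by unfold_locales (auto simp: scaleC_add_right scaleC_add_left scaleC_scaleC scaleC_one)

lemma clin_add: "clinear f \<Longrightarrow> f (x + y) = f x + f y"
  using module_hom.add linear_iff_module_hom by metis

lemma clin_scale: "clinear f \<Longrightarrow> f (c *\<^sub>C x) = c *\<^sub>C f x"
  using module_hom.scale linear_iff_module_hom by metis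

lemma clin_zero: "clinear f \<Longrightarrow> f 0 = 0"
  using clin_add[of f 0 0] by simp

lemma clin_minus: "clinear f \<Longrightarrow> f (- x) = - f x"
  using clin_add[of f x "- x"] clin_zero[of f] by (simp add: eq_neg_iff_add_eq_0 add.commute)

lemma clin_diff: "clinear f \<Longrightarrow> f (x - y) = f x - f y"
  using clin_add[of f x "- y"] clin_minus[of f y] by simp

lemma clin_sum:
  assumes "clinear f" shows "f (\<Sum>i\<in>I. g i) = (\<Sum>i\<in>I. f (g i))"
  by (induction I rule: infinite_finite_induct) (simp_all add: clin_zero[OF assms] clin_add[OF assms])

lemma clin_comb:
  assumes "clinear f" shows "f (\<Sum>i\<in>I. c i *\<^sub>C w i) = (\<Sum>i\<in>I. c i *\<^sub>C f (w i))"
  by (simp add: clin_sum[OF assms] clin_scale[OF assms])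

lemma clinear_compose:
  assumes "clinear f" "clinear g" shows "clinear (\<lambda>x. f (g x))"
  by (rule clinearI) (simp_all add: clin_add[OF assms(1)] clin_scale[OF assms(1)] clin_add[OF assms(2)] clin_scale[OF assms(2)])

lemma scaleC_zero_left [simp]: "0 *\<^sub>C x = 0"
  by (rule complex_vector.scale_zero_left)

lemma scaleC_zero_right [simp]: "c *\<^sub>C (0::'a::complex_normed_vector) = 0"
  by (rule complex_vector.scale_zero_right)

lemma scaleC_minus1: "(- 1) *\<^sub>C x = - x"
  by (metis complex_vector.scale_minus_left scaleC_one)

lemma csubspace_diff: "csubspace Y \<Longrightarrow> x \<in> Y \<Longrightarrow> y \<in> Y \<Longrightarrow> x - y \<in> Y"
  by (rule complex_vector.subspace_diff)

lemmas csubspace_add = complex_vector.subspace_add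
lemmas csubspace_scale = complex_vector.subspace_scale
lemmas csubspace_0 = complex_vector.subspace_0

lemma csubspaceI:
  "0 \<in> Y \<Longrightarrow> (\<And>x y. x \<in> Y \<Longrightarrow> y \<in> Y \<Longrightarrow> x + y \<in> Y) \<Longrightarrow> (\<And>c x. x \<in> Y \<Longrightarrow> c *\<^sub>C x \<in> Y) \<Longrightarrow> csubspace Y"
  by (simp add: complex_vector.subspace_def)

lemma csubspace_comb: "csubspace Y \<Longrightarrow> (\<And>i. i \<in> I \<Longrightarrow> w i \<in> Y) \<Longrightarrow> (\<Sum>i\<in>I. c i *\<^sub>C w i) \<in> Y"
  by (intro complex_vector.subspace_sum csubspace_scale)

lemma csubspace_image:
  assumes "clinear f" "csubspace Y" shows "csubspace (f ` Y)"
proof (rule csubspaceI)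
  show "0 \<in> f ` Y" using clin_zero[OF assms(1)] csubspace_0[OF assms(2)] by (metis imageI)
  show "x + y \<in> f ` Y" if "x \<in> f ` Y" "y \<in> f ` Y" for x y
    using that clin_add[OF assms(1)] csubspace_add[OF assms(2)] by (metis (no_types, lifting) imageE imageI)
  show "c *\<^sub>C x \<in> f ` Y" if "x \<in> f ` Y" for c x
    using that clin_scale[OF assms(1)] csubspace_scale[OF assms(2)] by (metis (no_types, lifting) imageE imageI)
qed

lemma comb_in_span:
  assumes "y \<in> cspan (w ` I)" "finite I"
  obtains c where "y = (\<Sum>i\<in>I. c i *\<^sub>C w i)"
proof -
  have "csubspace {y. \<exists>c. y = (\<Sum>i\<in>I. c i *\<^sub>C w i)}" (is "csubspace ?S")
  proof (rule csubspaceI)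
    show "0 \<in> ?S" by (auto intro!: exI[of _ "\<lambda>_. 0"])
    show "x + y \<in> ?S" if "x \<in> ?S" "y \<in> ?S" for x y
    proof -
      from that obtain c d where "x = (\<Sum>i\<in>I. c i *\<^sub>C w i)" "y = (\<Sum>i\<in>I. d i *\<^sub>C w i)" by blast
      then have "x + y = (\<Sum>i\<in>I. (c i + d i) *\<^sub>C w i)" by (simp add: scaleC_add_left sum.distrib)
      then show ?thesis by (intro CollectI exI[of _ "\<lambda>i. c i + d i"])
    qed
    show "a *\<^sub>C x \<in> ?S" if "x \<in> ?S" for a x
    proof -
      from that obtain c where "x = (\<Sum>i\<in>I. c i *\<^sub>C w i)" by blast
      then have "a *\<^sub>C x = (\<Sum>i\<in>I. (a * c i) *\<^sub>C w i)" by (simp add: complex_vector.scale_sum_right scaleC_scaleC)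
      then show ?thesis by (intro CollectI exI[of _ "\<lambda>i. a * c i"])
    qed
  qed
  moreover have "w ` I \<subseteq> ?S"
  proof safe
    fix i assume i: "i \<in> I"
    have "(\<Sum>k\<in>I. (if k = i then 1 else 0) *\<^sub>C w k) = (\<Sum>k\<in>I. if k = i then w k else 0)"
      by (intro sum.cong) (auto simp: scaleC_one)
    then have "w i = (\<Sum>k\<in>I. (if k = i then 1 else 0) *\<^sub>C w k)" using i assms(2) by simp
    then show "\<exists>c. w i = (\<Sum>k\<in>I. c k *\<^sub>C w k)" by (rule exI[of _ "\<lambda>k. if k = i then 1 else 0"])
  qed
  ultimately have "cspan (w ` I) \<subseteq> ?S" by (rule complex_vector.span_minimal[rotated])
  then show ?thesis using assms(1) that by blast
qed

lemma span_comb: "(\<Sum>i\<in>I. c i *\<^sub>C w i) \<in> cspan (w ` I)"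
  by (intro csubspace_comb complex_vector.subspace_span complex_vector.span_base) simp

text \<open>Finite dimension as a property of sets, so that subspaces and the model spaces of
  frames, over several types, share one notion.\<close>

definition cfd :: "'a::complex_normed_vector set \<Rightarrow> bool" where
  "cfd Y \<longleftrightarrow> (\<exists>B. finite B \<and> Y \<subseteq> cspan B)"

lemma cfd_mono: "cfd Y \<Longrightarrow> Z \<subseteq> Y \<Longrightarrow> cfd Z"
  unfolding cfd_def by blast

lemma independent_sequence:
  fixes w :: "nat \<Rightarrow> 'a::complex_normed_vector"
  assumes "\<And>k. k < n \<Longrightarrow> w k \<notin> cspan (w ` {..<k})"
  shows "complex_vector.independent (w ` {..<n}) \<and> card (w ` {..<n}) = n"
  using assms
proof (induction n)
  case 0 then show ?case by (simp add: complex_vector.independent_empty)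
next
  case (Suc n)
  have "w n \<notin> cspan (w ` {..<n})" using Suc.prems by simp
  moreover from this have "w n \<notin> w ` {..<n}" using complex_vector.span_base[of "w n" "w ` {..<n}"] by metis
  moreover have "w ` {..<Suc n} = insert (w n) (w ` {..<n})" by (simp only: lessThan_Suc image_insert)
  ultimately show ?case using Suc by (simp add: complex_vector.independent_insert)
qed

lemma cfd_dependent_sequence:
  fixes w :: "nat \<Rightarrow> 'a::complex_normed_vector"
  assumes "cfd Y" "\<And>k. w k \<in> Y"
  shows "\<exists>k. w k \<in> cspan (w ` {..<k})"
proof (rule ccontr)
  assume n: "\<nexists>k. w k \<in> cspan (w ` {..<k})"
  obtain B where B: "finite B" "Y \<subseteq> cspan B" using assms(1) by (auto simp: cfd_def)
  have *: "complex_vector.independent (w ` {..<Suc (card B)})" "card (w ` {..<Suc (card B)}) = Suc (card B)"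
    using independent_sequence[of "Suc (card B)" w] n by blast+
  have "w ` {..<Suc (card B)} \<subseteq> cspan B" using B(2) assms(2) by blast
  from complex_vector.independent_span_bound[OF B(1) *(1) this] *(2) show False by simp
qed

lemma cfd_finite_dimensional:
  assumes "cfd (UNIV :: 'a::complex_normed_vector set)"
  obtains B :: "'a::complex_normed_vector set" where "finite_dimensional_vector_space scaleC B"
proof -
  obtain C :: "'a set" where C: "finite C" "cspan C = UNIV" using assms by (auto simp: cfd_def)
  obtain B where B: "B \<subseteq> C" "complex_vector.independent B" "C \<subseteq> cspan B"
    using complex_vector.maximal_independent_subset[of C] by metis
  have "cspan B = UNIV" using C(2) B(3) complex_vector.span_minimal[OF B(3) complex_vector.subspace_span] by auto
  then have "finite_dimensional_vector_space scaleC B"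
    using B(2) finite_subset[OF B(1) C(1)] by unfold_locales (simp_all add: cspan_def)
  then show ?thesis by (rule that)
qed

section \<open>Existence of eigenvectors\<close>

definition poly_op :: "('a::complex_normed_vector \<Rightarrow> 'a) \<Rightarrow> complex poly \<Rightarrow> 'a \<Rightarrow> 'a" where
  "poly_op P p x = (\<Sum>i\<le>degree p. coeff p i *\<^sub>C (P ^^ i) x)"

lemma poly_op_bound:
  assumes "degree p \<le> n" shows "poly_op P p x = (\<Sum>i\<le>n. coeff p i *\<^sub>C (P ^^ i) x)"
  unfolding poly_op_def using assms
  by (intro sum.mono_neutral_left) (auto simp: coeff_eq_0)

lemma poly_op_linear_factor:
  assumes "clinear P"
  shows "poly_op P ([:- z, 1:] * q) x = P (poly_op P q x) - z *\<^sub>C poly_op P q x"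
proof -
  define n where "n = degree q"
  have eq: "[:- z, 1:] * q = pCons 0 q - smult z q" by simp
  have "degree ([:- z, 1:] * q) \<le> Suc n"
    using degree_mult_le[of "[:- z, 1:]" q] by (simp add: n_def)
  then have "poly_op P ([:- z, 1:] * q) x = (\<Sum>i\<le>Suc n. coeff (pCons 0 q - smult z q) i *\<^sub>C (P ^^ i) x)"
    unfolding eq[symmetric] by (rule poly_op_bound)
  also have "\<dots> = (\<Sum>i\<le>Suc n. coeff (pCons 0 q) i *\<^sub>C (P ^^ i) x) - (\<Sum>i\<le>Suc n. coeff (smult z q) i *\<^sub>C (P ^^ i) x)"
    by (simp only: coeff_diff complex_vector.scale_left_diff_distrib sum_subtractf)
  also have "(\<Sum>i\<le>Suc n. coeff (pCons 0 q) i *\<^sub>C (P ^^ i) x) = (\<Sum>i\<le>n. coeff q i *\<^sub>C P ((P ^^ i) x))"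
    by (subst sum.atMost_Suc_shift) simp
  also have "\<dots> = P (poly_op P q x)"
    by (simp add: poly_op_bound[of q n] n_def clin_comb[OF assms])
  also have "(\<Sum>i\<le>Suc n. coeff (smult z q) i *\<^sub>C (P ^^ i) x) = z *\<^sub>C poly_op P q x"
    by (simp add: poly_op_bound[of q "Suc n"] n_def complex_vector.scale_sum_right scaleC_scaleC del: sum.atMost_Suc)
  finally show ?thesis .
qed

lemma csubspace_iterate:
  assumes "P ` Y \<subseteq> Y" "x \<in> Y" shows "(P ^^ i) x \<in> Y"
  using assms by (induction i) auto

text \<open>The vectors v, P v, P^2 v, ... are dependent, which gives a nonzero polynomial p with
  p(P) v = 0. Split off a linear factor at a root z, p = (X - z) q: if q(P) v = 0, continue with q
  of smaller degree; otherwise q(P) v is an eigenvector for z.\<close>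

lemma exists_eigenvector:
  assumes Y: "csubspace Y" "cfd Y" and P: "clinear P" "P ` Y \<subseteq> Y" and v: "v \<in> Y" "v \<noteq> 0"
  shows "\<exists>x\<in>Y. x \<noteq> 0 \<and> (\<exists>c. P x = c *\<^sub>C x)"
proof -
  obtain k where "(P ^^ k) v \<in> cspan ((\<lambda>i. (P ^^ i) v) ` {..<k})"
    using cfd_dependent_sequence[OF Y(2), of "\<lambda>i. (P ^^ i) v"] csubspace_iterate[OF P(2) v(1)] by blast
  then obtain c where c: "(P ^^ k) v = (\<Sum>i<k. c i *\<^sub>C (P ^^ i) v)" by (rule comb_in_span) simp
  define p where "p = monom 1 k - (\<Sum>i<k. monom (c i) i)"
  have cf: "coeff p i = (if i = k then 1 else if i < k then - c i else 0)" for i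
    by (auto simp: p_def coeff_sum)
  have "degree p \<le> k" by (rule degree_le) (simp add: cf)
  then have "poly_op P p v = (\<Sum>i\<le>k. coeff p i *\<^sub>C (P ^^ i) v)" by (rule poly_op_bound)
  also have "\<dots> = (P ^^ k) v - (\<Sum>i<k. c i *\<^sub>C (P ^^ i) v)"
    by (simp add: cf scaleC_one lessThan_Suc_atMost[symmetric] sum_negf)
  finally have p0: "poly_op P p v = 0" using c by simp
  have pn: "p \<noteq> 0" using cf[of k] by auto
  have "poly_op P p v = 0 \<Longrightarrow> p \<noteq> 0 \<Longrightarrow> ?thesis" for p
  proof (induction "degree p" arbitrary: p rule: less_induct)
    case less
    show ?case
    proof (cases "degree p = 0")
      case True
      then obtain a where a: "p = [:a:]" by (metis degree_eq_zeroE)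
      then have "a *\<^sub>C v = 0" using less.prems(1) by (simp add: poly_op_def)
      then show ?thesis using v a less.prems(2) by (simp add: complex_vector.scale_eq_0_iff)
    next
      case False
      then obtain z where "poly p z = 0"
        using fundamental_theorem_of_algebra[of p] by (auto simp: constant_degree)
      then obtain q where q: "p = [:- z, 1:] * q" by (metis poly_eq_0_iff_dvd dvdE)
      have qn: "q \<noteq> 0" using q less.prems(2) by auto
      have dq: "degree p = Suc (degree q)" unfolding q using qn by (subst degree_mult_eq) auto
      show ?thesis
      proof (cases "poly_op P q v = 0")
        case True then show ?thesis using less.hyps[of q] dq qn by simp
      next
        case False
        have "P (poly_op P q v) = z *\<^sub>C poly_op P q v"
          using less.prems(1) poly_op_linear_factor[OF P(1), of z q v] q by simp
        moreover have "poly_op P q v \<in> Y" unfolding poly_op_def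
          by (intro csubspace_comb Y csubspace_iterate P v)
        ultimately show ?thesis using False by blast
      qed
    qed
  qed
  then show ?thesis using p0 pn by blast
qed

section \<open>Sesquilinear forms, orthonormal systems and the spectral theorem\<close>

definition sesq :: "('a::complex_normed_vector \<Rightarrow> 'a \<Rightarrow> complex) \<Rightarrow> bool" where
  "sesq f \<longleftrightarrow> (\<forall>x x' y. f (x + x') y = f x y + f x' y) \<and> (\<forall>c x y. f (c *\<^sub>C x) y = c * f x y) \<and>
    (\<forall>x y y'. f x (y + y') = f x y + f x y') \<and> (\<forall>c x y. f x (c *\<^sub>C y) = cnj c * f x y)"

definition herm :: "('a::complex_normed_vector \<Rightarrow> 'a \<Rightarrow> complex) \<Rightarrow> bool" where
  "herm f \<longleftrightarrow> (\<forall>x x' y. f (x + x') y = f x y + f x' y) \<and> (\<forall>c x y. f (c *\<^sub>C x) y = c * f x y) \<and>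
    (\<forall>x y. f y x = cnj (f x y))"

lemma sesq_add1: "sesq f \<Longrightarrow> f (x + x') y = f x y + f x' y"
  and sesq_add2: "sesq f \<Longrightarrow> f x (y + y') = f x y + f x y'"
  and sesq_scale1: "sesq f \<Longrightarrow> f (c *\<^sub>C x) y = c * f x y"
  and sesq_scale2: "sesq f \<Longrightarrow> f x (c *\<^sub>C y) = cnj c * f x y"
  unfolding sesq_def by blast+

lemma sesq_zero1: assumes "sesq f" shows "f 0 y = 0"
  using sesq_scale1[OF assms, of 0 0 y] by simp

lemma sesq_zero2: assumes "sesq f" shows "f x 0 = 0"
  using sesq_scale2[OF assms, of x 0 0] by simp

lemma sesq_minus1: assumes "sesq f" shows "f (- x) y = - f x y"
  using sesq_scale1[OF assms, of "-1" x y] by (simp add: scaleC_minus1)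

lemma sesq_minus2: assumes "sesq f" shows "f x (- y) = - f x y"
  using sesq_scale2[OF assms, of x "-1" y] by (simp add: scaleC_minus1)

lemma sesq_diff1: assumes "sesq f" shows "f (x - x') y = f x y - f x' y"
  using sesq_add1[OF assms, of x "- x'" y] by (simp add: sesq_minus1[OF assms])

lemma sesq_diff2: assumes "sesq f" shows "f x (y - y') = f x y - f x y'"
  using sesq_add2[OF assms, of x y "- y'"] by (simp add: sesq_minus2[OF assms])

lemma sesq_comb1: assumes "sesq f" shows "f (\<Sum>i\<in>I. c i *\<^sub>C w i) y = (\<Sum>i\<in>I. c i * f (w i) y)"
  by (induction I rule: infinite_finite_induct)
    (simp_all add: sesq_zero1[OF assms] sesq_add1[OF assms] sesq_scale1[OF assms])

lemma sesq_comb2: assumes "sesq f" shows "f y (\<Sum>i\<in>I. c i *\<^sub>C w i) = (\<Sum>i\<in>I. cnj (c i) * f y (w i))"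
  by (induction I rule: infinite_finite_induct)
    (simp_all add: sesq_zero2[OF assms] sesq_add2[OF assms] sesq_scale2[OF assms])

lemma herm_sym: "herm f \<Longrightarrow> f y x = cnj (f x y)"
  unfolding herm_def by blast

lemma herm_imp_sesq: assumes "herm f" shows "sesq f"
proof -
  have s: "f y x = cnj (f x y)" for x y by (rule herm_sym[OF assms])
  have a: "f (x + x') y = f x y + f x' y" and b: "f (c *\<^sub>C x) y = c * f x y" for x x' y c
    using assms unfolding herm_def by blast+
  have "f x (y + y') = f x y + f x y'" for x y y'
    using s[of x "y + y'"] s[of x y] s[of x y'] a[of y y' x] by simp
  moreover have "f x (c *\<^sub>C y) = cnj c * f x y" for c x y
    using s[of x "c *\<^sub>C y"] s[of x y] b[of c y x] by simp
  ultimately show ?thesis using a b unfolding sesq_def by blast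
qed

lemma herm_real: assumes "herm f" shows "f x x = of_real (Re (f x x))"
  using herm_sym[OF assms, of x x] by (simp add: complex_eq_iff)

lemma hermI:
  assumes "\<And>x x' y. f (x + x') y = f x y + f x' y" "\<And>c x y. f (c *\<^sub>C x) y = c * f x y"
    "\<And>x y. f y x = cnj (f x y)"
  shows "herm f"
  using assms unfolding herm_def by blast

lemma herm_neg:
  assumes "herm f" shows "herm (\<lambda>x y. - f x y)"
proof (rule hermI)
  have sf: "sesq f" by (rule herm_imp_sesq[OF assms])
  show "- f (x + x') y = - f x y + - f x' y" for x x' y by (simp add: sesq_add1[OF sf])
  show "- f (c *\<^sub>C x) y = c * - f x y" for c x y by (simp add: sesq_scale1[OF sf])
  show "- f y x = cnj (- f x y)" for x y using herm_sym[OF assms, of y x] by simp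
qed

lemma sesq_compose:
  assumes "sesq f" "clinear P" "clinear Q" shows "sesq (\<lambda>x y. f (P x) (Q y))"
  unfolding sesq_def
  by (simp add: clin_add[OF assms(2)] clin_add[OF assms(3)] clin_scale[OF assms(2)] clin_scale[OF assms(3)]
    sesq_add1[OF assms(1)] sesq_add2[OF assms(1)] sesq_scale1[OF assms(1)] sesq_scale2[OF assms(1)])

definition orthonormal :: "('a \<Rightarrow> 'a \<Rightarrow> complex) \<Rightarrow> nat \<Rightarrow> (nat \<Rightarrow> 'a) \<Rightarrow> bool" where
  "orthonormal f N x \<longleftrightarrow> (\<forall>i<N. \<forall>j<N. f (x i) (x j) = (if i = j then 1 else 0))"

lemma orthonormal_coeff:
  assumes "sesq f" "orthonormal f N x" "S \<subseteq> {..<N}" "i < N"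
  shows "f (\<Sum>j\<in>S. c j *\<^sub>C x j) (x i) = (if i \<in> S then c i else 0)"
proof -
  have "f (\<Sum>j\<in>S. c j *\<^sub>C x j) (x i) = (\<Sum>j\<in>S. if j = i then c j else 0)"
    unfolding sesq_comb1[OF assms(1)] using assms(2-4)
    by (intro sum.cong) (auto simp: orthonormal_def)
  then show ?thesis using finite_subset[OF assms(3)] by simp
qed

lemma orthonormal_form:
  assumes "sesq f" "orthonormal f N x" "S \<subseteq> {..<N}"
  shows "f (\<Sum>j\<in>S. c j *\<^sub>C x j) (\<Sum>j\<in>S. d j *\<^sub>C x j) = (\<Sum>j\<in>S. c j * cnj (d j))"
proof -
  have "f (\<Sum>j\<in>S. c j *\<^sub>C x j) (\<Sum>j\<in>S. d j *\<^sub>C x j) = (\<Sum>i\<in>S. cnj (d i) * f (\<Sum>j\<in>S. c j *\<^sub>C x j) (x i))"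
    by (rule sesq_comb2[OF assms(1)])
  also have "\<dots> = (\<Sum>i\<in>S. c i * cnj (d i))"
    using assms by (intro sum.cong refl) (auto simp: orthonormal_coeff[OF assms])
  finally show ?thesis .
qed

text \<open>Pairing a relation for \<open>x k\<close> with \<open>x k\<close> itself gives 1 = 0.
  The argument uses the Gram matrix alone, so it serves h on the positive and - h on the negative
  subspace alike.\<close>

lemma orthonormal_independent:
  assumes "sesq f" "orthonormal f N x"
  shows "complex_vector.independent (x ` {..<N})" "card (x ` {..<N}) = N"
proof -
  have "x k \<notin> cspan (x ` {..<k})" if "k < N" for k
  proof
    assume "x k \<in> cspan (x ` {..<k})"
    then obtain c where c: "x k = (\<Sum>j<k. c j *\<^sub>C x j)" by (rule comb_in_span) simp
    have "f (\<Sum>j<k. c j *\<^sub>C x j) (x k) = (if k \<in> {..<k} then c k else 0)"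
      using that by (intro orthonormal_coeff[OF assms]) auto
    then have "f (x k) (x k) = 0" using c by simp
    then show False using assms(2) that by (simp add: orthonormal_def)
  qed
  then show "complex_vector.independent (x ` {..<N})" "card (x ` {..<N}) = N"
    using independent_sequence[of N x] by auto
qed

lemma orthonormal_dim:
  assumes "sesq f" "orthonormal f N x" "csubspace Y" "\<And>j. j < N \<Longrightarrow> x j \<in> Y"
    "\<And>y. y \<in> Y \<Longrightarrow> \<exists>c. y = (\<Sum>j<N. c j *\<^sub>C x j)"
  shows "cdim Y = N"
proof -
  have "Y \<subseteq> cspan (x ` {..<N})"
  proof
    fix y assume "y \<in> Y"
    then obtain c where c: "y = (\<Sum>j<N. c j *\<^sub>C x j)" using assms(5) by blast
    show "y \<in> cspan (x ` {..<N})" unfolding c by (rule span_comb)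
  qed
  moreover have "x ` {..<N} \<subseteq> Y" using assms(4) by auto
  ultimately show ?thesis
    using complex_vector.basis_card_eq_dim[of "x ` {..<N}" Y] orthonormal_independent[OF assms(1,2)] by simp
qed

text \<open>Take an orthonormal system of eigenvectors of maximal length. If it missed a vector of
  \<open>Y\<close>, the orthogonal complement in \<open>Y\<close> would be nonzero and, by
  \<open>inv\<close>, mapped into itself, so it would contain one more eigenvector. The condition
  \<open>inv\<close> is common to unitary and self-adjoint operators, and both kinds occur
  below.\<close>

lemma spectral_theorem:
  fixes f :: "'a::complex_normed_vector \<Rightarrow> 'a \<Rightarrow> complex"
  assumes Y: "csubspace Y" "cfd Y" and f: "herm f"
    and pos: "\<And>y. y \<in> Y \<Longrightarrow> y \<noteq> 0 \<Longrightarrow> 0 < Re (f y y)"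
    and P: "clinear P" "\<And>y. y \<in> Y \<Longrightarrow> P y \<in> Y"
    and inv: "\<And>x y c. x \<in> Y \<Longrightarrow> x \<noteq> 0 \<Longrightarrow> y \<in> Y \<Longrightarrow> P x = c *\<^sub>C x \<Longrightarrow> f y x = 0 \<Longrightarrow> f (P y) x = 0"
  shows "\<exists>x c. (\<forall>j<cdim Y. x j \<in> Y \<and> P (x j) = c j *\<^sub>C x j) \<and> orthonormal f (cdim Y) x \<and>
    (\<forall>y\<in>Y. y = (\<Sum>j<cdim Y. f y (x j) *\<^sub>C x j))"
proof -
  have sf: "sesq f" by (rule herm_imp_sesq[OF f])
  define Q where "Q k \<longleftrightarrow> (\<exists>x c. (\<forall>j<k. x j \<in> Y \<and> P (x j) = c j *\<^sub>C x j) \<and> orthonormal f k x)" for k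
  have Q0: "Q 0" by (simp add: Q_def orthonormal_def)
  obtain B where B: "finite B" "Y \<subseteq> cspan B" using Y(2) by (auto simp: cfd_def)
  have bound: "k \<le> card B" if "Q k" for k
  proof -
    obtain x c where x: "\<forall>j<k. x j \<in> Y \<and> P (x j) = c j *\<^sub>C x j" "orthonormal f k x"
      using \<open>Q k\<close> unfolding Q_def by blast
    have "x ` {..<k} \<subseteq> cspan B" using x(1) B(2) by auto
    from complex_vector.independent_span_bound[OF B(1) orthonormal_independent(1)[OF sf x(2)] this]
    show ?thesis using orthonormal_independent(2)[OF sf x(2)] by simp
  qed
  define k where "k = Greatest Q"
  have Qk: "Q k" unfolding k_def using GreatestI_nat[of Q 0 "card B"] Q0 bound by blast
  have nQ: "\<not> Q (Suc k)" using Greatest_le_nat[of Q "Suc k" "card B"] bound unfolding k_def by fastforce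
  obtain x c where x: "\<And>j. j < k \<Longrightarrow> x j \<in> Y" "\<And>j. j < k \<Longrightarrow> P (x j) = c j *\<^sub>C x j" and on: "orthonormal f k x"
    using Qk unfolding Q_def by blast
  have xn: "x j \<noteq> 0" if "j < k" for j
  proof
    assume "x j = 0"
    then have "f (x j) (x j) = 0" using sesq_zero1[OF sf, of 0] by simp
    moreover have "f (x j) (x j) = 1" using on that unfolding orthonormal_def by simp
    ultimately show False by simp
  qed
  have exp: "y = (\<Sum>j<k. f y (x j) *\<^sub>C x j)" if y: "y \<in> Y" for y
  proof (rule ccontr)
    assume ne: "y \<noteq> (\<Sum>j<k. f y (x j) *\<^sub>C x j)"
    define z where "z = y - (\<Sum>j<k. f y (x j) *\<^sub>C x j)"
    define F where "F = {u \<in> Y. \<forall>j<k. f u (x j) = 0}"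
    have zF: "z \<in> F"
    proof -
      have "z \<in> Y" unfolding z_def using y x(1) by (intro csubspace_diff csubspace_comb Y) auto
      moreover have "f z (x i) = 0" if "i < k" for i
        unfolding z_def sesq_diff1[OF sf] using orthonormal_coeff[OF sf on order_refl that] that by simp
      ultimately show ?thesis by (simp add: F_def)
    qed
    have "csubspace F" unfolding F_def
      by (rule csubspaceI) (use Y in \<open>auto simp: sesq_zero1[OF sf] sesq_add1[OF sf] sesq_scale1[OF sf]
        intro: csubspace_0 csubspace_add csubspace_scale\<close>)
    moreover have "cfd F" using Y(2) by (rule cfd_mono) (auto simp: F_def)
    moreover have "P ` F \<subseteq> F" using P(2) inv x xn by (fastforce simp: F_def)
    moreover have "z \<noteq> 0" using ne by (simp add: z_def)
    ultimately obtain v d where v: "v \<in> F" "v \<noteq> 0" "P v = d *\<^sub>C v"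
      using exists_eigenvector[OF _ _ P(1), of F z] zF by blast
    define r where "r = Re (f v v)"
    have r: "r > 0" "f v v = of_real r" using pos[of v] v herm_real[OF f, of v] by (auto simp: F_def r_def)
    \<comment> \<open>The factor that normalises the new eigenvector, as \<open>f v v\<close> is the
      positive number \<open>r\<close>.\<close>
    define t where "t = 1 / sqrt r"
    have t: "t * (t * r) = 1" using r(1) by (simp add: t_def field_simps)
    define w where "w = complex_of_real t *\<^sub>C v"
    have w: "w \<in> Y" "P w = d *\<^sub>C w" "f w w = 1" "\<And>j. j < k \<Longrightarrow> f w (x j) = 0"
    proof -
      show "w \<in> Y" unfolding w_def using v(1) by (intro csubspace_scale Y) (simp add: F_def)
      show "P w = d *\<^sub>C w" unfolding w_def by (simp add: clin_scale[OF P(1)] v(3) scaleC_scaleC mult.commute)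
      have "f w w = complex_of_real (t * (t * r))"
        by (simp add: w_def sesq_scale1[OF sf] sesq_scale2[OF sf] r(2))
      then show "f w w = 1" unfolding t by simp
      show "f w (x j) = 0" if "j < k" for j using v(1) that by (simp add: w_def F_def sesq_scale1[OF sf])
    qed
    have "f (x j) w = 0" if "j < k" for j using w(4)[OF that] herm_sym[OF f, of "x j" w] by simp
    then have "orthonormal f (Suc k) (x(k := w))"
      using on w(3,4) by (auto simp: orthonormal_def less_Suc_eq)
    moreover have "\<forall>j<Suc k. (x(k := w)) j \<in> Y \<and> P ((x(k := w)) j) = (c(k := d)) j *\<^sub>C (x(k := w)) j"
      using x w by (auto simp: less_Suc_eq)
    ultimately have "Q (Suc k)" unfolding Q_def by blast
    then show False using nQ by simp
  qed
  have kd: "cdim Y = k"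
  proof (rule orthonormal_dim[OF sf on Y(1) x(1)])
    show "\<exists>c. y = (\<Sum>j<k. c j *\<^sub>C x j)" if "y \<in> Y" for y using exp[OF that] by (rule exI[of _ "\<lambda>j. f y (x j)"])
  qed
  show ?thesis unfolding kd using x on exp by blast
qed

text \<open>The spectral theorem for the zero operator, for which every vector is an
  eigenvector.\<close>

lemma exists_orthonormal_basis:
  fixes f :: "'a::complex_normed_vector \<Rightarrow> 'a \<Rightarrow> complex"
  assumes "csubspace Y" "cfd Y" "herm f" "\<And>y. y \<in> Y \<Longrightarrow> y \<noteq> 0 \<Longrightarrow> 0 < Re (f y y)"
  shows "\<exists>x. (\<forall>j<cdim Y. x j \<in> Y) \<and> orthonormal f (cdim Y) x \<and>
    (\<forall>y\<in>Y. y = (\<Sum>j<cdim Y. f y (x j) *\<^sub>C x j))"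
proof -
  have zero: "clinear (\<lambda>x::'a. 0::'a)" by (rule clinearI) simp_all
  have "\<exists>x c. (\<forall>j<cdim Y. x j \<in> Y \<and> 0 = c j *\<^sub>C x j) \<and> orthonormal f (cdim Y) x \<and>
    (\<forall>y\<in>Y. y = (\<Sum>j<cdim Y. f y (x j) *\<^sub>C x j))"
    by (rule spectral_theorem[OF assms zero])
      (simp_all add: csubspace_0[OF assms(1)] sesq_zero1[OF herm_imp_sesq[OF assms(3)]])
  then show ?thesis by blast
qed

section \<open>Counting eigenvalues on arcs by dimension arguments\<close>

lemma homogeneous_system_nontrivial:
  fixes W :: "'i \<Rightarrow> nat \<Rightarrow> complex"
  assumes "finite I" "finite S" "card S < card I"
  shows "\<exists>c. (\<exists>i\<in>I. c i \<noteq> 0) \<and> (\<forall>j\<in>S. (\<Sum>i\<in>I. c i * W i j) = 0)"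
  using assms(2,1,3)
proof (induction S arbitrary: I W rule: finite_induct)
  case empty
  then obtain i where "i \<in> I" by (metis card_gt_0_iff card.empty all_not_in_conv)
  then show ?case by (intro exI[of _ "\<lambda>_. 1"]) auto
next
  case (insert j S)
  show ?case
  proof (cases "\<forall>i\<in>I. W i j = 0")
    case True
    have "card S < card I" using insert.prems insert.hyps by simp
    from insert.IH[OF insert.prems(1) this, of W] True show ?thesis by auto
  next
    case False
    then obtain k where k: "k \<in> I" "W k j \<noteq> 0" by blast
    define I' where "I' = I - {k}"
    have I': "finite I'" "card S < card I'" "I = insert k I'" "k \<notin> I'"
      using insert.prems insert.hyps k by (auto simp: I'_def)
    \<comment> \<open>Gaussian elimination: equation \<open>j\<close> is used to remove the unknown
      \<open>k\<close> from the other equations; afterwards the value of the unknown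
      \<open>k\<close> is recovered from equation \<open>j\<close>.\<close>
    define W' where "W' i l = W i l - W i j / W k j * W k l" for i l
    obtain c where c: "\<exists>i\<in>I'. c i \<noteq> 0" "\<forall>l\<in>S. (\<Sum>i\<in>I'. c i * W' i l) = 0"
      using insert.IH[OF I'(1,2), of W'] by blast
    define d where "d i = (if i = k then - (\<Sum>i\<in>I'. c i * W i j) / W k j else c i)" for i
    have sumd: "(\<Sum>i\<in>I. d i * W i l) = (\<Sum>i\<in>I'. c i * W' i l)" for l
    proof -
      have "(\<Sum>i\<in>I'. d i * W i l) = (\<Sum>i\<in>I'. c i * W i l)" using I'(4) by (intro sum.cong) (auto simp: d_def)
      then have "(\<Sum>i\<in>I. d i * W i l) = - (\<Sum>i\<in>I'. c i * W i j) / W k j * W k l + (\<Sum>i\<in>I'. c i * W i l)"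
        using I' by (simp add: d_def)
      also have "\<dots> = (\<Sum>i\<in>I'. c i * W' i l)"
      proof -
        have "(\<Sum>i\<in>I'. c i * W' i l) = (\<Sum>i\<in>I'. c i * W i l - (c i * W i j) * (W k l / W k j))"
          by (simp add: W'_def algebra_simps)
        also have "\<dots> = (\<Sum>i\<in>I'. c i * W i l) - (\<Sum>i\<in>I'. c i * W i j) * (W k l / W k j)"
          by (simp only: sum_subtractf sum_distrib_right)
        finally show ?thesis by simp
      qed
      finally show ?thesis .
    qed
    have "(\<Sum>i\<in>I'. c i * W' i j) = 0" using k(2) by (simp add: W'_def)
    then have "\<forall>l\<in>insert j S. (\<Sum>i\<in>I. d i * W i l) = 0" using sumd c(2) by auto
    moreover have "\<exists>i\<in>I. d i \<noteq> 0" using c(1) I'(3,4) by (auto simp: d_def)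
    ultimately show ?thesis by blast
  qed
qed

text \<open>If \<open>x\<close> is also \<open>B\<close>-orthonormal, this says that the pencil of
  \<open>A\<close> relative to \<open>B\<close> is that of a unitary operator with eigenvalues
  \<open>cis (a i)\<close>. Working with the two forms replaces the operator.\<close>

definition cis_diagonal :: "('a \<Rightarrow> 'a \<Rightarrow> complex) \<Rightarrow> nat \<Rightarrow> (nat \<Rightarrow> 'a) \<Rightarrow> (nat \<Rightarrow> real) \<Rightarrow> bool" where
  "cis_diagonal A N x a \<longleftrightarrow> (\<forall>i<N. \<forall>j<N. A (x i) (x j) = (if i = j then cis (a i) else 0))"

lemma diagonal_pencil_values:
  assumes A: "sesq A" and B: "sesq B" and on: "orthonormal B N x"
    and diag: "cis_diagonal A N x a"
  shows "Re (B (\<Sum>j<N. d j *\<^sub>C x j) (\<Sum>j<N. d j *\<^sub>C x j)) = (\<Sum>j<N. (cmod (d j))\<^sup>2)"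
    "Re (cis (- \<psi>) * A (\<Sum>j<N. d j *\<^sub>C x j) (\<Sum>j<N. d j *\<^sub>C x j)) = (\<Sum>j<N. cos (a j - \<psi>) * (cmod (d j))\<^sup>2)"
proof -
  define w where "w d = (\<Sum>j<N. d j *\<^sub>C x j)" for d
  have sq: "z * cnj z = complex_of_real ((cmod z)\<^sup>2)" for z by (rule complex_norm_square[symmetric])
  have "B (w d) (w d) = (\<Sum>j<N. d j * cnj (d j))"
    unfolding w_def by (rule orthonormal_form[OF B on order_refl])
  then show "Re (B (\<Sum>j<N. d j *\<^sub>C x j) (\<Sum>j<N. d j *\<^sub>C x j)) = (\<Sum>j<N. (cmod (d j))\<^sup>2)"
    unfolding w_def[symmetric] by (simp only: sq Re_sum Re_complex_of_real)
  have "A (w d) (w d) = (\<Sum>i<N. cnj (d i) * (\<Sum>j<N. d j * A (x j) (x i)))"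
    unfolding w_def sesq_comb2[OF A] sesq_comb1[OF A] ..
  also have "\<dots> = (\<Sum>i<N. cis (a i) * complex_of_real ((cmod (d i))\<^sup>2))"
  proof (rule sum.cong[OF refl])
    fix i assume i: "i \<in> {..<N}"
    have "(\<Sum>j<N. d j * A (x j) (x i)) = (\<Sum>j<N. if j = i then d i * cis (a i) else 0)"
      using i diag by (intro sum.cong) (auto simp: cis_diagonal_def)
    also have "\<dots> = d i * cis (a i)" using i by simp
    finally show "cnj (d i) * (\<Sum>j<N. d j * A (x j) (x i)) = cis (a i) * complex_of_real ((cmod (d i))\<^sup>2)"
      by (simp only: sq[symmetric] mult_ac)
  qed
  finally have "cis (- \<psi>) * A (w d) (w d) = (\<Sum>i<N. cis (a i - \<psi>) * complex_of_real ((cmod (d i))\<^sup>2))"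
    by (simp add: sum_distrib_left mult.assoc[symmetric] cis_mult)
  then show "Re (cis (- \<psi>) * A (\<Sum>j<N. d j *\<^sub>C x j) (\<Sum>j<N. d j *\<^sub>C x j)) = (\<Sum>j<N. cos (a j - \<psi>) * (cmod (d j))\<^sup>2)"
    unfolding w_def[symmetric] by (simp add: mult.commute)
qed

lemma comb_comb:
  assumes "finite I" "\<And>i. i \<in> I \<Longrightarrow> w i = (\<Sum>j<N::nat. W i j *\<^sub>C x j)"
  shows "(\<Sum>i\<in>I. c i *\<^sub>C w i) = (\<Sum>j<N. (\<Sum>i\<in>I. c i * W i j) *\<^sub>C x j)"
proof -
  have "(\<Sum>i\<in>I. c i *\<^sub>C w i) = (\<Sum>i\<in>I. \<Sum>j<N. (c i * W i j) *\<^sub>C x j)"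
    using assms(2) by (intro sum.cong) (simp_all add: complex_vector.scale_sum_right scaleC_scaleC)
  also have "\<dots> = (\<Sum>j<N. \<Sum>i\<in>I. (c i * W i j) *\<^sub>C x j)" by (rule sum.swap)
  finally show ?thesis by (simp add: complex_vector.scale_sum_left)
qed

text \<open>One half of the Courant-Fischer principle. If \<open>I\<close> had more elements than
  there are eigenvalues on the arc, some nontrivial combination of the \<open>w i\<close> would have
  zero coordinates along all eigenvectors of the arc, and on such a vector the rotated form of
  \<open>A\<close> is at most \<kappa> times that of \<open>B\<close>.\<close>

lemma arg_count_ge:
  assumes A: "sesq A" and B: "sesq B" and on: "orthonormal B N x"
    and diag: "cis_diagonal A N x a"
    and I: "finite I" "\<And>i. i \<in> I \<Longrightarrow> \<exists>W. w i = (\<Sum>j<N. W j *\<^sub>C x j)"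
    and pos: "\<And>c. \<exists>i\<in>I. c i \<noteq> 0 \<Longrightarrow> \<kappa> * Re (B (\<Sum>i\<in>I. c i *\<^sub>C w i) (\<Sum>i\<in>I. c i *\<^sub>C w i)) <
      Re (cis (- \<psi>) * A (\<Sum>i\<in>I. c i *\<^sub>C w i) (\<Sum>i\<in>I. c i *\<^sub>C w i))"
  shows "card I \<le> arg_count N a \<psi> \<kappa>"
proof (rule ccontr)
  define S where "S = {j. j < N \<and> \<kappa> < cos (a j - \<psi>)}"
  assume "\<not> card I \<le> arg_count N a \<psi> \<kappa>"
  then have lt: "card S < card I" by (simp add: arg_count_def S_def)
  obtain W where W: "\<And>i. i \<in> I \<Longrightarrow> w i = (\<Sum>j<N. W i j *\<^sub>C x j)" using I(2) by metis
  have "finite S" by (simp add: S_def)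
  from homogeneous_system_nontrivial[OF I(1) this lt, of W]
  obtain c where c: "\<exists>i\<in>I. c i \<noteq> 0" "\<And>j. j \<in> S \<Longrightarrow> (\<Sum>i\<in>I. c i * W i j) = 0" by blast
  define d where "d j = (\<Sum>i\<in>I. c i * W i j)" for j
  have eq: "(\<Sum>i\<in>I. c i *\<^sub>C w i) = (\<Sum>j<N. d j *\<^sub>C x j)" unfolding d_def by (rule comb_comb[OF I(1) W])
  have "(\<Sum>j<N. cos (a j - \<psi>) * (cmod (d j))\<^sup>2) \<le> (\<Sum>j<N. \<kappa> * (cmod (d j))\<^sup>2)"
  proof (rule sum_mono)
    fix j assume "j \<in> {..<N}"
    then show "cos (a j - \<psi>) * (cmod (d j))\<^sup>2 \<le> \<kappa> * (cmod (d j))\<^sup>2"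
      using c(2)[of j] by (cases "j \<in> S") (auto simp: d_def S_def intro!: mult_right_mono)
  qed
  then show False
    using pos[OF c(1)] unfolding eq diagonal_pencil_values[OF A B on diag] by (simp add: sum_distrib_left)
qed

text \<open>The same for closed arcs. Now strictness comes from the coordinates off the arc:
  positivity of \<open>B\<close> makes one of them nonzero.\<close>

lemma arg_count_ge_weak:
  assumes A: "sesq A" and B: "sesq B" and on: "orthonormal B N x"
    and diag: "cis_diagonal A N x a"
    and I: "finite I" "\<And>i. i \<in> I \<Longrightarrow> \<exists>W. w i = (\<Sum>j<N. W j *\<^sub>C x j)"
    and pos: "\<And>c. \<exists>i\<in>I. c i \<noteq> 0 \<Longrightarrow> 0 < Re (B (\<Sum>i\<in>I. c i *\<^sub>C w i) (\<Sum>i\<in>I. c i *\<^sub>C w i)) \<and>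
      \<kappa> * Re (B (\<Sum>i\<in>I. c i *\<^sub>C w i) (\<Sum>i\<in>I. c i *\<^sub>C w i)) \<le>
      Re (cis (- \<psi>) * A (\<Sum>i\<in>I. c i *\<^sub>C w i) (\<Sum>i\<in>I. c i *\<^sub>C w i))"
  shows "card I \<le> card {j. j < N \<and> \<kappa> \<le> cos (a j - \<psi>)}"
proof (rule ccontr)
  define S where "S = {j. j < N \<and> \<kappa> \<le> cos (a j - \<psi>)}"
  assume "\<not> card I \<le> card {j. j < N \<and> \<kappa> \<le> cos (a j - \<psi>)}"
  then have lt: "card S < card I" by (simp add: S_def)
  obtain W where W: "\<And>i. i \<in> I \<Longrightarrow> w i = (\<Sum>j<N. W i j *\<^sub>C x j)" using I(2) by metis
  have "finite S" by (simp add: S_def)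
  from homogeneous_system_nontrivial[OF I(1) this lt, of W]
  obtain c where c: "\<exists>i\<in>I. c i \<noteq> 0" "\<And>j. j \<in> S \<Longrightarrow> (\<Sum>i\<in>I. c i * W i j) = 0" by blast
  define d where "d j = (\<Sum>i\<in>I. c i * W i j)" for j
  have eq: "(\<Sum>i\<in>I. c i *\<^sub>C w i) = (\<Sum>j<N. d j *\<^sub>C x j)" unfolding d_def by (rule comb_comb[OF I(1) W])
  have le: "cos (a j - \<psi>) * (cmod (d j))\<^sup>2 \<le> \<kappa> * (cmod (d j))\<^sup>2" if "j \<in> {..<N}" for j
    using c(2)[of j] that by (cases "j \<in> S") (auto simp: d_def S_def intro!: mult_right_mono)
  have "\<exists>j\<in>{..<N}. d j \<noteq> 0"
  proof (rule ccontr)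
    assume "\<not> (\<exists>j\<in>{..<N}. d j \<noteq> 0)"
    then have "(\<Sum>j<N. (cmod (d j))\<^sup>2) = 0" by simp
    then show False using pos[OF c(1)] unfolding eq diagonal_pencil_values(1)[OF A B on diag] by simp
  qed
  then obtain j where j: "j \<in> {..<N}" "d j \<noteq> 0" by blast
  have "j \<notin> S" using c(2)[of j] j(2) by (auto simp: d_def)
  then have "cos (a j - \<psi>) * (cmod (d j))\<^sup>2 < \<kappa> * (cmod (d j))\<^sup>2"
    using j by (intro mult_strict_right_mono) (auto simp: S_def)
  then have "(\<Sum>j<N. cos (a j - \<psi>) * (cmod (d j))\<^sup>2) < (\<Sum>j<N. \<kappa> * (cmod (d j))\<^sup>2)"
    using le j(1) by (intro sum_strict_mono_ex1) auto
  then show False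
    using pos[OF c(1)] unfolding eq diagonal_pencil_values[OF A B on diag] by (simp add: sum_distrib_left)
qed

text \<open>Diagonal dominance. With m = card I, errors of at most \<delta> / (2 m) in the m * m
  entries change the form by at most \<delta> / 2 times the sum of the |c i|^2, half of what the
  diagonal guarantees.\<close>

lemma perturbed_diagonal_form_pos:
  fixes g :: "nat \<Rightarrow> nat \<Rightarrow> complex"
  assumes I: "finite I" and \<delta>: "0 < \<delta>"
    and g: "\<And>i k. i \<in> I \<Longrightarrow> k \<in> I \<Longrightarrow> cmod (g i k - (if i = k then D i else 0)) * (2 * real (card I)) \<le> \<delta>"
    and D: "\<And>i. i \<in> I \<Longrightarrow> \<delta> \<le> Re (D i)" and c: "\<exists>i\<in>I. c i \<noteq> 0"
  shows "0 < Re (\<Sum>i\<in>I. \<Sum>k\<in>I. c i * cnj (c k) * g i k)"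
proof -
  let ?e = "\<lambda>i k. g i k - (if i = k then D i else 0)"
  define m where "m = real (card I)"
  have m: "m > 0" using I c by (auto simp: m_def card_gt_0_iff)
  have "(\<Sum>k\<in>I. c i * cnj (c k) * g i k) = D i * complex_of_real ((cmod (c i))\<^sup>2) + (\<Sum>k\<in>I. c i * cnj (c k) * ?e i k)"
    if i: "i \<in> I" for i
  proof -
    have "(\<Sum>k\<in>I. c i * cnj (c k) * g i k) = (\<Sum>k\<in>I. c i * cnj (c k) * ?e i k + (if k = i then c i * cnj (c i) * D i else 0))"
      by (intro sum.cong) (auto simp: algebra_simps)
    also have "\<dots> = (\<Sum>k\<in>I. c i * cnj (c k) * ?e i k) + c i * cnj (c i) * D i"
      using i I by (simp add: sum.distrib)
    finally show ?thesis by (simp only: complex_norm_square[symmetric] mult_ac add.commute)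
  qed
  then have "Re (\<Sum>i\<in>I. \<Sum>k\<in>I. c i * cnj (c k) * g i k) =
     (\<Sum>i\<in>I. Re (D i) * (cmod (c i))\<^sup>2) + Re (\<Sum>i\<in>I. \<Sum>k\<in>I. c i * cnj (c k) * ?e i k)"
    by (simp add: sum.distrib)
  moreover have "(\<Sum>i\<in>I. Re (D i) * (cmod (c i))\<^sup>2) \<ge> \<delta> * (\<Sum>i\<in>I. (cmod (c i))\<^sup>2)"
    unfolding sum_distrib_left using D by (intro sum_mono mult_right_mono) auto
  moreover have "\<bar>Re (\<Sum>i\<in>I. \<Sum>k\<in>I. c i * cnj (c k) * ?e i k)\<bar> \<le> \<delta> / 2 * (\<Sum>i\<in>I. (cmod (c i))\<^sup>2)"
  proof -
    have "\<bar>Re (\<Sum>i\<in>I. \<Sum>k\<in>I. c i * cnj (c k) * ?e i k)\<bar> \<le> cmod (\<Sum>i\<in>I. \<Sum>k\<in>I. c i * cnj (c k) * ?e i k)"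
      by (rule abs_Re_le_cmod)
    also have "\<dots> \<le> (\<Sum>i\<in>I. \<Sum>k\<in>I. cmod (c i * cnj (c k) * ?e i k))"
      by (intro order_trans[OF norm_sum] sum_mono norm_sum)
    also have "\<dots> \<le> (\<Sum>i\<in>I. \<Sum>k\<in>I. ((cmod (c i))\<^sup>2 + (cmod (c k))\<^sup>2) / 2 * (\<delta> / (2 * m)))"
    proof (intro sum_mono)
      fix i k assume ik: "i \<in> I" "k \<in> I"
      have "cmod (c i) * cmod (c k) \<le> ((cmod (c i))\<^sup>2 + (cmod (c k))\<^sup>2) / 2"
        using sum_squares_bound[of "cmod (c i)" "cmod (c k)"] by simp
      moreover have "cmod (?e i k) \<le> \<delta> / (2 * m)"
        using g[OF ik] m by (simp add: m_def field_simps)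
      ultimately have "cmod (c i) * cmod (c k) * cmod (?e i k) \<le> ((cmod (c i))\<^sup>2 + (cmod (c k))\<^sup>2) / 2 * (\<delta> / (2 * m))"
        using \<delta> m by (intro mult_mono) auto
      then show "cmod (c i * cnj (c k) * ?e i k) \<le> ((cmod (c i))\<^sup>2 + (cmod (c k))\<^sup>2) / 2 * (\<delta> / (2 * m))"
        by (simp only: norm_mult complex_mod_cnj)
    qed
    also have "\<dots> = (\<Sum>i\<in>I. \<Sum>k\<in>I. ((cmod (c i))\<^sup>2 + (cmod (c k))\<^sup>2)) * (\<delta> / (4 * m))"
      by (simp only: sum_distrib_right) (intro sum.cong refl, simp)
    also have "(\<Sum>i\<in>I. \<Sum>k\<in>I. ((cmod (c i))\<^sup>2 + (cmod (c k))\<^sup>2)) = 2 * m * (\<Sum>i\<in>I. (cmod (c i))\<^sup>2)"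
      by (simp add: sum.distrib m_def sum_distrib_left algebra_simps)
    also have "2 * m * (\<Sum>i\<in>I. (cmod (c i))\<^sup>2) * (\<delta> / (4 * m)) = \<delta> / 2 * (\<Sum>i\<in>I. (cmod (c i))\<^sup>2)"
      using m by (simp add: field_simps)
    finally show ?thesis .
  qed
  moreover have "0 < (\<Sum>i\<in>I. (cmod (c i))\<^sup>2)"
  proof -
    obtain i where i: "i \<in> I" "c i \<noteq> 0" using c by blast
    show ?thesis using sum_pos2[OF I i(1), of "\<lambda>i. (cmod (c i))\<^sup>2"] i(2) by simp
  qed
  then have "\<delta> / 2 * (\<Sum>i\<in>I. (cmod (c i))\<^sup>2) < \<delta> * (\<Sum>i\<in>I. (cmod (c i))\<^sup>2)" using \<delta> by simp
  ultimately show ?thesis by linarith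
qed

text \<open>On the span of the eigenvectors at \<open>p\<close> that belong to an arc, the real part
  of \<open>cis (- \<psi>)\<close> A - \<kappa> B is positive definite at \<open>p\<close>, because
  its matrix is diagonal. Only finitely many continuous entries are involved, so it stays positive
  at nearby \<open>q\<close>, and \<open>arg_count_ge\<close> finds as many eigenvalues on the arc
  at \<open>q\<close>. The eigenvectors \<open>x q\<close> may jump.\<close>

theorem lsc_args_pencil:
  fixes A B :: "'p::topological_space \<Rightarrow> 'a::complex_normed_vector \<Rightarrow> 'a \<Rightarrow> complex"
  assumes A: "\<And>p. p \<in> T \<Longrightarrow> sesq (A p)" and B: "\<And>p. p \<in> T \<Longrightarrow> sesq (B p)"
    and on: "\<And>p. p \<in> T \<Longrightarrow> orthonormal (B p) N (x p)"
    and diag: "\<And>p. p \<in> T \<Longrightarrow> cis_diagonal (A p) N (x p) (a p)"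
    and xY: "\<And>p i. p \<in> T \<Longrightarrow> i < N \<Longrightarrow> x p i \<in> Y"
    and span: "\<And>p y. p \<in> T \<Longrightarrow> y \<in> Y \<Longrightarrow> \<exists>c. y = (\<Sum>j<N. c j *\<^sub>C x p j)"
    and contA: "\<And>y z. y \<in> Y \<Longrightarrow> z \<in> Y \<Longrightarrow> continuous_on T (\<lambda>p. A p y z)"
    and contB: "\<And>y z. y \<in> Y \<Longrightarrow> z \<in> Y \<Longrightarrow> continuous_on T (\<lambda>p. B p y z)"
  shows "lsc_args T N a"
  unfolding lsc_args_def
proof (intro ballI allI)
  fix p \<psi> \<kappa> assume p: "p \<in> T"
  define I where "I = {j. j < N \<and> \<kappa> < cos (a p j - \<psi>)}"
  have I: "finite I" "\<And>i. i \<in> I \<Longrightarrow> i < N" by (auto simp: I_def)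
  define g where "g q i k = cis (- \<psi>) * A q (x p i) (x p k) - complex_of_real \<kappa> * B q (x p i) (x p k)" for q i k
  define D where "D i = cis (a p i - \<psi>) - complex_of_real \<kappa>" for i
  have "\<exists>\<delta>>0. \<forall>i\<in>I. \<delta> \<le> Re (D i)"
  proof (cases "I = {}")
    case False
    have "\<forall>i\<in>I. 0 < Re (D i)" by (auto simp: I_def D_def)
    then show ?thesis using I(1) False by (intro exI[of _ "Min ((\<lambda>i. Re (D i)) ` I)"]) auto
  qed (auto intro: exI[of _ 1])
  then obtain \<delta> where \<delta>: "\<delta> > 0" "\<And>i. i \<in> I \<Longrightarrow> \<delta> \<le> Re (D i)" by blast
  \<comment> \<open>The summand 1 keeps the denominator positive when no eigenvalue lies on the
    arc.\<close>
  define \<epsilon> where "\<epsilon> = \<delta> / (2 * (real (card I) + 1))"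
  have \<epsilon>: "\<epsilon> > 0" "\<epsilon> * (2 * real (card I)) \<le> \<delta>" using \<delta>(1) by (auto simp: \<epsilon>_def field_simps)
  have gp: "g p i k = (if i = k then D i else 0)" if "i \<in> I" "k \<in> I" for i k
    using diag[OF p] on[OF p] I(2)[OF that(1)] I(2)[OF that(2)]
    by (auto simp: g_def D_def orthonormal_def cis_diagonal_def cis_mult)
  have "\<forall>\<^sub>F q in at p within T. dist (g q i k) (g p i k) < \<epsilon>" if "i \<in> I" "k \<in> I" for i k
  proof -
    have "continuous_on T (\<lambda>q. g q i k)" unfolding g_def
      by (intro continuous_intros contA contB xY p I(2) that)
    then show ?thesis using p \<epsilon>(1) by (auto simp: continuous_on_def dest: tendstoD)
  qed
  then have "\<forall>\<^sub>F q in at p within T. \<forall>i\<in>I. \<forall>k\<in>I. dist (g q i k) (g p i k) < \<epsilon>"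
    by (intro eventually_ball_finite I(1) ballI)
  moreover have "\<forall>\<^sub>F q in at p within T. q \<in> T" by (simp add: eventually_at_filter)
  ultimately show "\<forall>\<^sub>F q in at p within T. arg_count N (a p) \<psi> \<kappa> \<le> arg_count N (a q) \<psi> \<kappa>"
  proof eventually_elim
    case (elim q)
    have "card I \<le> arg_count N (a q) \<psi> \<kappa>"
    proof (rule arg_count_ge[OF A[OF elim(2)] B[OF elim(2)] on[OF elim(2)] diag[OF elim(2)] I(1), of "x p"])
      show "\<exists>W. x p i = (\<Sum>j<N. W j *\<^sub>C x q j)" if "i \<in> I" for i
        by (rule span[OF elim(2) xY[OF p I(2)[OF that]]])
      fix c assume c: "\<exists>i\<in>I. c i \<noteq> (0::complex)"
      let ?w = "\<Sum>i\<in>I. c i *\<^sub>C x p i"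
      have small: "cmod (g q i k - (if i = k then D i else 0)) * (2 * real (card I)) \<le> \<delta>" if "i \<in> I" "k \<in> I" for i k
      proof -
        have "cmod (g q i k - (if i = k then D i else 0)) \<le> \<epsilon>"
          using elim(1) that unfolding gp[OF that, symmetric] by (auto simp: dist_norm less_imp_le)
        then have "cmod (g q i k - (if i = k then D i else 0)) * (2 * real (card I)) \<le> \<epsilon> * (2 * real (card I))"
          by (intro mult_right_mono) auto
        then show ?thesis using \<epsilon>(2) by linarith
      qed
      have "0 < Re (\<Sum>i\<in>I. \<Sum>k\<in>I. c i * cnj (c k) * g q i k)"
        by (rule perturbed_diagonal_form_pos[OF I(1) \<delta>(1) small \<delta>(2) c])
      also have "(\<Sum>i\<in>I. \<Sum>k\<in>I. c i * cnj (c k) * g q i k) = cis (- \<psi>) * A q ?w ?w - complex_of_real \<kappa> * B q ?w ?w"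
      proof -
        have *: "F ?w ?w = (\<Sum>i\<in>I. \<Sum>k\<in>I. c i * cnj (c k) * F (x p i) (x p k))" if "sesq F" for F
        proof -
          have "F ?w ?w = (\<Sum>i\<in>I. c i * F (x p i) ?w)" by (rule sesq_comb1[OF that])
          then show ?thesis by (simp only: sesq_comb2[OF that] sum_distrib_left mult.assoc)
        qed
        show ?thesis unfolding *[OF A[OF elim(2)]] *[OF B[OF elim(2)]]
          by (simp add: g_def sum_distrib_left sum_subtractf[symmetric] algebra_simps)
      qed
      finally show "\<kappa> * Re (B q ?w ?w) < Re (cis (- \<psi>) * A q ?w ?w)" by simp
    qed
    then show ?case by (simp add: arg_count_def I_def)
  qed
qed

section \<open>Lagrangian subspaces as graphs\<close>

text \<open>A fundamental decomposition in the sense of Krein spaces. For the form - \<i> \<Omega>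
  it takes the place of the two eigenspans of \<i> J, detached from inner product and
  \<open>J\<close>, so that it can be deformed and transported.\<close>

definition splitting :: "('a::complex_normed_vector \<Rightarrow> 'a \<Rightarrow> complex) \<Rightarrow> 'a set \<Rightarrow> 'a set \<Rightarrow> bool" where
  "splitting h Fm Fp \<longleftrightarrow> csubspace Fm \<and> csubspace Fp \<and>
    (\<forall>x\<in>Fm. x \<noteq> 0 \<longrightarrow> Re (h x x) < 0) \<and> (\<forall>x\<in>Fp. x \<noteq> 0 \<longrightarrow> 0 < Re (h x x)) \<and>
    (\<forall>x\<in>Fm. \<forall>y\<in>Fp. h x y = 0) \<and> (\<lambda>(u, v). u + v) ` (Fm \<times> Fp) = UNIV"

definition proj :: "'a::complex_normed_vector set \<Rightarrow> 'a set \<Rightarrow> 'a \<Rightarrow> 'a" where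
  "proj Fm Fp x = (THE u. u \<in> Fm \<and> x - u \<in> Fp)"

text \<open>The graph map of \<open>L\<close> from \<open>Fm\<close> to \<open>Fp\<close>,
  precomposed with the projection onto \<open>Fm\<close>: this makes it linear on the whole space,
  as \<open>clinear\<close> requires.\<close>

definition gmap :: "'a::complex_normed_vector set \<Rightarrow> 'a set \<Rightarrow> 'a set \<Rightarrow> 'a \<Rightarrow> 'a" where
  "gmap Fm Fp L x = (THE y. y \<in> Fp \<and> proj Fm Fp x + y \<in> L)"

context
  fixes h :: "'a::complex_normed_vector \<Rightarrow> 'a \<Rightarrow> complex" and Fm Fp :: "'a set"
  assumes h: "herm h" and sp: "splitting h Fm Fp"
begin

lemma splitting_subspaces: "csubspace Fm" "csubspace Fp"
  using sp by (simp_all add: splitting_def)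

lemma splitting_neg: "x \<in> Fm \<Longrightarrow> x \<noteq> 0 \<Longrightarrow> Re (h x x) < 0"
  using sp by (simp_all add: splitting_def)

lemma splitting_pos: "x \<in> Fp \<Longrightarrow> x \<noteq> 0 \<Longrightarrow> 0 < Re (h x x)"
  using sp by (simp_all add: splitting_def)

lemma splitting_orth: "x \<in> Fm \<Longrightarrow> y \<in> Fp \<Longrightarrow> h x y = 0" "x \<in> Fm \<Longrightarrow> y \<in> Fp \<Longrightarrow> h y x = 0"
proof -
  show 1: "x \<in> Fm \<Longrightarrow> y \<in> Fp \<Longrightarrow> h x y = 0" for x y using sp by (simp add: splitting_def)
  show "x \<in> Fm \<Longrightarrow> y \<in> Fp \<Longrightarrow> h y x = 0" using 1[of x y] herm_sym[OF h, of y x] by simp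
qed

lemma splitting_decomp: "\<exists>u v. u \<in> Fm \<and> v \<in> Fp \<and> x = u + v"
proof -
  have "x \<in> (\<lambda>(u, v). u + v) ` (Fm \<times> Fp)" using sp by (simp add: splitting_def)
  then show ?thesis by auto
qed

lemma splitting_Int: "x \<in> Fm \<Longrightarrow> x \<in> Fp \<Longrightarrow> x = 0"
  using splitting_neg[of x] splitting_pos[of x] by (cases "x = 0") (simp, linarith)

text \<open>Replacing h by - h exchanges the summands, so every fact about \<open>Fm\<close> has a
  twin for \<open>Fp\<close>. In particular a Lagrangian is also a graph over \<open>Fp\<close>,
  which provides the inverse of its graph map.\<close>

lemma splitting_swap: "splitting (\<lambda>x y. - h x y) Fp Fm"
proof -
  have "x \<in> (\<lambda>(u, v). u + v) ` (Fp \<times> Fm)" for x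
  proof -
    obtain u v where uv: "u \<in> Fm" "v \<in> Fp" "x = u + v" using splitting_decomp by blast
    have "x = (\<lambda>(u, v). u + v) (v, u)" using uv(3) by (simp add: add.commute)
    then show ?thesis using uv(1,2) by (intro image_eqI[of _ _ "(v, u)"]) auto
  qed
  then have "(\<lambda>(u, v). u + v) ` (Fp \<times> Fm) = UNIV" by blast
  moreover have "\<forall>x\<in>Fp. x \<noteq> 0 \<longrightarrow> Re (- h x x) < 0" "\<forall>x\<in>Fm. x \<noteq> 0 \<longrightarrow> 0 < Re (- h x x)"
    "\<forall>x\<in>Fp. \<forall>y\<in>Fm. - h x y = 0"
    using splitting_neg splitting_pos splitting_orth(2) by simp_all
  ultimately show ?thesis unfolding splitting_def using splitting_subspaces by (intro conjI)
qed

lemma proj_eq: assumes "u \<in> Fm" "x - u \<in> Fp" shows "proj Fm Fp x = u"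
  unfolding proj_def
proof (rule the_equality)
  show "u \<in> Fm \<and> x - u \<in> Fp" using assms by simp
  fix v assume v: "v \<in> Fm \<and> x - v \<in> Fp"
  have "v - u \<in> Fm" using v assms splitting_subspaces by (auto intro: csubspace_diff)
  moreover have "v - u \<in> Fp" using csubspace_diff[OF splitting_subspaces(2) assms(2), of "x - v"] v by simp
  ultimately show "v = u" using splitting_Int by fastforce
qed

lemma proj_in: "proj Fm Fp x \<in> Fm" and proj_compl: "x - proj Fm Fp x \<in> Fp"
proof -
  obtain u v where uv: "u \<in> Fm" "v \<in> Fp" "x = u + v" using splitting_decomp by blast
  then have "proj Fm Fp x = u" by (intro proj_eq) auto
  then show "proj Fm Fp x \<in> Fm" "x - proj Fm Fp x \<in> Fp" using uv by auto
qed

lemma proj_Fm: "x \<in> Fm \<Longrightarrow> proj Fm Fp x = x"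
  by (rule proj_eq) (simp_all add: csubspace_0[OF splitting_subspaces(2)])

lemma clinear_proj: "clinear (proj Fm Fp)"
proof (rule clinearI)
  fix x y and c :: complex
  have "x + y - (proj Fm Fp x + proj Fm Fp y) = (x - proj Fm Fp x) + (y - proj Fm Fp y)" by simp
  then show "proj Fm Fp (x + y) = proj Fm Fp x + proj Fm Fp y"
    by (intro proj_eq) (simp_all only: csubspace_add[OF splitting_subspaces(1)]
      csubspace_add[OF splitting_subspaces(2)] proj_in proj_compl)
  have "c *\<^sub>C x - c *\<^sub>C proj Fm Fp x = c *\<^sub>C (x - proj Fm Fp x)" by (simp add: complex_vector.scale_right_diff_distrib)
  then show "proj Fm Fp (c *\<^sub>C x) = c *\<^sub>C proj Fm Fp x"
    by (intro proj_eq) (simp_all only: csubspace_scale[OF splitting_subspaces(1)]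
      csubspace_scale[OF splitting_subspaces(2)] proj_in proj_compl)
qed

lemma splitting_form:
  assumes "u \<in> Fm" "v \<in> Fp" "u' \<in> Fm" "v' \<in> Fp"
  shows "h (u + v) (u' + v') = h u u' + h v v'"
  using assms splitting_orth by (simp add: sesq_add1[OF herm_imp_sesq[OF h]] sesq_add2[OF herm_imp_sesq[OF h]])

context
  fixes L :: "'a set"
  assumes L: "lagrangian h L" and fd: "cfd (UNIV :: 'a set)"
begin

lemma lag_sub: "csubspace L"
  using L unfolding lagrangian_def by (rule conjunct1)

lemma lag_isotropic: "x \<in> L \<Longrightarrow> y \<in> L \<Longrightarrow> h x y = 0"
  using L unfolding lagrangian_def by blast

lemma lag_maximal: "(\<And>y. y \<in> L \<Longrightarrow> h x y = 0) \<Longrightarrow> x \<in> L"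
  using L unfolding lagrangian_def by blast

lemma lag_Fm: "x \<in> L \<Longrightarrow> x \<in> Fm \<Longrightarrow> x = 0"
  using lag_isotropic[of x x] splitting_neg[of x] by (cases "x = 0") simp_all

lemma lag_Fp: "x \<in> L \<Longrightarrow> x \<in> Fp \<Longrightarrow> x = 0"
  using lag_isotropic[of x x] splitting_pos[of x] by (cases "x = 0") simp_all

text \<open>Let \<open>S\<close> be the projection of \<open>L\<close> to \<open>Fm\<close> and
  \<open>z\<close> the part of \<open>x\<close> orthogonal to \<open>S\<close>. Then
  \<open>z\<close> is orthogonal to both components of every element of \<open>L\<close>, so
  \<open>z\<close> lies in \<open>L\<close> by maximality; an isotropic vector of the definite space
  \<open>Fm\<close> is 0. Hence \<open>x\<close> lies in \<open>S\<close>.\<close>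

lemma graph_exists:
  assumes x: "x \<in> Fm" shows "\<exists>y\<in>Fp. x + y \<in> L"
proof -
  have sf: "sesq h" by (rule herm_imp_sesq[OF h])
  let ?n = "\<lambda>x y. - h x y"
  have n: "herm ?n" by (rule herm_neg[OF h])
  define S where "S = proj Fm Fp ` L"
  have S: "csubspace S" "S \<subseteq> Fm" unfolding S_def using clinear_proj lag_sub proj_in by (auto intro: csubspace_image)
  have pos: "0 < Re (- h y y)" if "y \<in> S" "y \<noteq> 0" for y using splitting_neg[of y] that S(2) by auto
  obtain e where e: "\<And>j. j < cdim S \<Longrightarrow> e j \<in> S" "orthonormal ?n (cdim S) e"
    "\<And>y. y \<in> S \<Longrightarrow> y = (\<Sum>j<cdim S. ?n y (e j) *\<^sub>C e j)"
  proof -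
    have "\<exists>e. (\<forall>j<cdim S. e j \<in> S) \<and> orthonormal ?n (cdim S) e \<and> (\<forall>y\<in>S. y = (\<Sum>j<cdim S. ?n y (e j) *\<^sub>C e j))"
      by (rule exists_orthonormal_basis[OF S(1) cfd_mono[OF fd subset_UNIV] n]) (fact pos)
    then show ?thesis using that by blast
  qed
  define z where "z = x - (\<Sum>j<cdim S. ?n x (e j) *\<^sub>C e j)"
  have sumS: "(\<Sum>j<cdim S. ?n x (e j) *\<^sub>C e j) \<in> S" by (intro csubspace_comb S e) simp
  from sumS have zx: "x - z \<in> S" by (simp add: z_def)
  have zF: "z \<in> Fm" unfolding z_def using sumS S(2) x by (intro csubspace_diff splitting_subspaces) auto
  have ze: "h z (e i) = 0" if "i < cdim S" for i
  proof -
    have "?n (\<Sum>j<cdim S. ?n x (e j) *\<^sub>C e j) (e i) = ?n x (e i)"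
      using orthonormal_coeff[OF herm_imp_sesq[OF n] e(2) order_refl that, of "\<lambda>j. - h x (e j)"] that
      by (simp only: lessThan_iff if_True)
    then show ?thesis by (simp add: z_def sesq_diff1[OF sf])
  qed
  have "z \<in> L"
  proof (rule lag_maximal)
    fix l assume l: "l \<in> L"
    have "proj Fm Fp l \<in> S" using l by (simp add: S_def)
    from e(3)[OF this] obtain c where c: "proj Fm Fp l = (\<Sum>j<cdim S. c j *\<^sub>C e j)" by metis
    have "h z (proj Fm Fp l) = 0" unfolding c sesq_comb2[OF sf] using ze by simp
    moreover have "h z (l - proj Fm Fp l) = 0" using splitting_orth(1)[OF zF proj_compl] .
    ultimately show "h z l = 0" by (simp add: sesq_diff2[OF sf])
  qed
  then have "z = 0" using lag_Fm zF by blast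
  then have "x \<in> S" using zx by simp
  then obtain l where l: "l \<in> L" "x = proj Fm Fp l" by (auto simp: S_def)
  show ?thesis using l proj_compl[of l] by (intro bexI[of _ "l - x"]) auto
qed

lemma gmap_eq:
  assumes "y \<in> Fp" "proj Fm Fp x + y \<in> L" shows "gmap Fm Fp L x = y"
  unfolding gmap_def
proof (rule the_equality)
  show "y \<in> Fp \<and> proj Fm Fp x + y \<in> L" using assms by simp
  fix z assume z: "z \<in> Fp \<and> proj Fm Fp x + z \<in> L"
  have "z - y \<in> L" using csubspace_diff[OF lag_sub, of "proj Fm Fp x + z" "proj Fm Fp x + y"] z assms by simp
  moreover have "z - y \<in> Fp" using z assms splitting_subspaces by (auto intro: csubspace_diff)
  ultimately show "z = y" using lag_Fp by fastforce
qed

lemma gmap_in: "gmap Fm Fp L x \<in> Fp" and gmap_graph: "proj Fm Fp x + gmap Fm Fp L x \<in> L"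
proof -
  obtain y where y: "y \<in> Fp" "proj Fm Fp x + y \<in> L" using graph_exists[OF proj_in] by blast
  then have "gmap Fm Fp L x = y" by (rule gmap_eq)
  then show "gmap Fm Fp L x \<in> Fp" "proj Fm Fp x + gmap Fm Fp L x \<in> L" using y by auto
qed

lemma gmap_eqI: "x \<in> Fm \<Longrightarrow> y \<in> Fp \<Longrightarrow> x + y \<in> L \<Longrightarrow> gmap Fm Fp L x = y"
  by (rule gmap_eq) (simp_all add: proj_Fm)

lemma gmap_graph_Fm: "x \<in> Fm \<Longrightarrow> x + gmap Fm Fp L x \<in> L"
  using gmap_graph[of x] by (simp add: proj_Fm)

lemma clinear_gmap: "clinear (gmap Fm Fp L)"
proof (rule clinearI)
  fix x y and c :: complex
  have "proj Fm Fp (x + y) + (gmap Fm Fp L x + gmap Fm Fp L y) =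
    (proj Fm Fp x + gmap Fm Fp L x) + (proj Fm Fp y + gmap Fm Fp L y)"
    by (simp add: clin_add[OF clinear_proj])
  then show "gmap Fm Fp L (x + y) = gmap Fm Fp L x + gmap Fm Fp L y"
    by (intro gmap_eq) (simp_all only: csubspace_add[OF lag_sub] csubspace_add[OF splitting_subspaces(2)] gmap_in gmap_graph)
  have "proj Fm Fp (c *\<^sub>C x) + c *\<^sub>C gmap Fm Fp L x = c *\<^sub>C (proj Fm Fp x + gmap Fm Fp L x)"
    by (simp add: clin_scale[OF clinear_proj] scaleC_add_right)
  then show "gmap Fm Fp L (c *\<^sub>C x) = c *\<^sub>C gmap Fm Fp L x"
    by (intro gmap_eq) (simp_all only: csubspace_scale[OF lag_sub] csubspace_scale[OF splitting_subspaces(2)] gmap_in gmap_graph)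
qed

text \<open>Isotropy of the graph written out; the mixed terms vanish because the summands are
  orthogonal.\<close>

lemma gmap_isometry: "x \<in> Fm \<Longrightarrow> y \<in> Fm \<Longrightarrow> h (gmap Fm Fp L x) (gmap Fm Fp L y) = - h x y"
  using lag_isotropic[OF gmap_graph_Fm gmap_graph_Fm, of x y] splitting_form[OF _ gmap_in _ gmap_in, of x y x y]
  by (simp add: eq_neg_iff_add_eq_0 add.commute)

end

end

lemma lagrangian_neg: "lagrangian (\<lambda>x y. - h x y) L \<longleftrightarrow> lagrangian h L"
  by (simp add: lagrangian_def)

text \<open>With U and V the graph maps of \<open>L\<close> and \<open>M\<close>, an orthonormal
  basis of eigenvectors of the unitary operator V^{-1} U on \<open>Fm\<close>, in a form that
  mentions no inverse. The sign in - h makes the form positive on \<open>Fm\<close>.\<close>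

definition eigen_system :: "('a::complex_normed_vector \<Rightarrow> 'a \<Rightarrow> complex) \<Rightarrow> 'a set \<Rightarrow> 'a set \<Rightarrow> 'a set \<Rightarrow> 'a set \<Rightarrow>
    nat \<Rightarrow> (nat \<Rightarrow> 'a) \<Rightarrow> (nat \<Rightarrow> real) \<Rightarrow> bool" where
  "eigen_system h Fm Fp L M N x a \<longleftrightarrow> (\<forall>j<N. x j \<in> Fm) \<and> orthonormal (\<lambda>x y. - h x y) N x \<and>
    (\<forall>y\<in>Fm. \<exists>c. y = (\<Sum>j<N. c j *\<^sub>C x j)) \<and>
    (\<forall>j<N. gmap Fm Fp L (x j) = cis (a j) *\<^sub>C gmap Fm Fp M (x j))"

text \<open>The eigenspace for \<open>z\<close> of U V^{-1} on \<open>Fp\<close>, with U and V the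
  graph maps of \<open>L\<close> and \<open>M\<close>: the vector \<open>x\<close> is V^{-1} y.
  Phrased by membership alone, it is visibly compatible with linear bijections.\<close>

definition eigsp :: "'a::complex_normed_vector set \<Rightarrow> 'a set \<Rightarrow> 'a set \<Rightarrow> 'a set \<Rightarrow> complex \<Rightarrow> 'a set" where
  "eigsp Fm Fp L M z = {y \<in> Fp. \<exists>x\<in>Fm. x + y \<in> M \<and> x + z *\<^sub>C y \<in> L}"

text \<open>The operator \<open>P\<close> is V^{-1} U, where V^{-1} is the graph map of
  \<open>M\<close> for the swapped splitting. Both graph maps reverse the sign of h, so
  \<open>P\<close> preserves h on \<open>Fm\<close>; its eigenvalues therefore have modulus 1 and
  the spectral theorem applies to - h.\<close>

lemma eigen_system_exists:
  fixes h :: "'a::complex_normed_vector \<Rightarrow> 'a \<Rightarrow> complex"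
  assumes h: "herm h" and sp: "splitting h Fm Fp" and fd: "cfd (UNIV :: 'a set)"
    and L: "lagrangian h L" and M: "lagrangian h M"
  shows "\<exists>x a. eigen_system h Fm Fp L M (cdim Fm) x a"
proof -
  let ?n = "\<lambda>x y. - h x y"
  note n = herm_neg[OF h] and sw = splitting_swap[OF h sp]
  have Mn: "lagrangian ?n M" using M by (simp add: lagrangian_neg)
  have sn: "sesq ?n" by (rule herm_imp_sesq[OF n])
  let ?U = "gmap Fm Fp L" and ?V = "gmap Fm Fp M" and ?V' = "gmap Fp Fm M"
  define P where "P x = ?V' (?U x)" for x
  have P: "clinear P" unfolding P_def
    by (rule clinear_compose[OF clinear_gmap[OF n sw Mn fd] clinear_gmap[OF h sp L fd]])
  have PF: "P y \<in> Fm" for y unfolding P_def by (rule gmap_in[OF n sw Mn fd])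
  have VP: "?V (P x) = ?U x" for x
  proof (rule gmap_eqI[OF h sp M fd PF gmap_in[OF h sp L fd]])
    have "?U x + P x \<in> M" unfolding P_def
      by (rule gmap_graph_Fm[OF n sw Mn fd gmap_in[OF h sp L fd]])
    then show "P x + ?U x \<in> M" by (simp add: add.commute)
  qed
  have iso: "h (P x) (P y) = h x y" if "x \<in> Fm" "y \<in> Fm" for x y
    using gmap_isometry[OF h sp M fd PF PF, of x y] gmap_isometry[OF h sp L fd that] by (simp add: VP)
  have pos: "0 < Re (- h y y)" if "y \<in> Fm" "y \<noteq> 0" for y using splitting_neg[OF h sp that] by simp
  have unit: "cmod c = 1" if "x \<in> Fm" "x \<noteq> 0" "P x = c *\<^sub>C x" for x c
  proof -
    have hs: "sesq h" by (rule herm_imp_sesq[OF h])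
    have "h x x = c * cnj c * h x x"
      using iso[OF that(1) that(1)] unfolding that(3) by (simp add: sesq_scale1[OF hs] sesq_scale2[OF hs] mult_ac)
    moreover have "h x x \<noteq> 0" using pos[OF that(1,2)] by auto
    ultimately have "c * cnj c = 1" by simp
    then have "(cmod c)\<^sup>2 = 1" by (metis complex_norm_square of_real_eq_1_iff)
    then show ?thesis by (metis norm_ge_zero one_power2 power2_eq_imp_eq zero_le_one)
  qed
  have inv: "- h (P y) x = 0" if a: "x \<in> Fm" "x \<noteq> 0" "y \<in> Fm" "P x = c *\<^sub>C x" "- h y x = 0" for x y c
  proof -
    have "cnj c * h (P y) x = h (P y) (P x)" unfolding a(4) by (rule sesq_scale2[OF herm_imp_sesq[OF h], symmetric])
    also have "\<dots> = 0" using iso[OF a(3,1)] a(5) by simp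
    finally have "cnj c * h (P y) x = 0" .
    then show ?thesis using unit[OF a(1,2,4)] by auto
  qed
  have "\<exists>x c. (\<forall>j<cdim Fm. x j \<in> Fm \<and> P (x j) = c j *\<^sub>C x j) \<and> orthonormal ?n (cdim Fm) x \<and>
    (\<forall>y\<in>Fm. y = (\<Sum>j<cdim Fm. ?n y (x j) *\<^sub>C x j))"
  proof (rule spectral_theorem[OF splitting_subspaces(1)[OF h sp] cfd_mono[OF fd subset_UNIV] n])
    show "0 < Re (- h y y)" if "y \<in> Fm" "y \<noteq> 0" for y by (rule pos[OF that])
    show "clinear P" by (rule P)
    show "P y \<in> Fm" for y by (rule PF)
    show "- h (P y) x = 0" if "x \<in> Fm" "x \<noteq> 0" "y \<in> Fm" "P x = c *\<^sub>C x" "- h y x = 0" for x y c by (rule inv[OF that])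
  qed
  then obtain x c where x: "\<And>j. j < cdim Fm \<Longrightarrow> x j \<in> Fm" "\<And>j. j < cdim Fm \<Longrightarrow> P (x j) = c j *\<^sub>C x j"
    "orthonormal ?n (cdim Fm) x" "\<And>y. y \<in> Fm \<Longrightarrow> y = (\<Sum>j<cdim Fm. ?n y (x j) *\<^sub>C x j)"
    by blast
  have "x j \<noteq> 0" if "j < cdim Fm" for j
  proof
    assume "x j = 0"
    then have "?n (x j) (x j) = 0" using sesq_zero1[OF sn, of 0] by simp
    moreover have "?n (x j) (x j) = 1" using x(3) that unfolding orthonormal_def by simp
    ultimately show False by simp
  qed
  then have c: "cmod (c j) = 1" if "j < cdim Fm" for j using unit x(1,2) that by blast
  have "?U (x j) = cis (Arg (c j)) *\<^sub>C ?V (x j)" if "j < cdim Fm" for j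
  proof -
    have "c j \<noteq> 0" using c[OF that] by auto
    then have "cis (Arg (c j)) = c j" using c[OF that] cis_Arg[of "c j"] by (simp add: sgn_div_norm)
    then show ?thesis using VP[of "x j"] x(2)[OF that] clin_scale[OF clinear_gmap[OF h sp M fd]] by simp
  qed
  moreover have "\<exists>c. y = (\<Sum>j<cdim Fm. c j *\<^sub>C x j)" if "y \<in> Fm" for y
    using x(4)[OF that] by (rule exI[of _ "\<lambda>j. - h y (x j)"])
  ultimately have "eigen_system h Fm Fp L M (cdim Fm) x (\<lambda>j. Arg (c j))"
    unfolding eigen_system_def using x(1,3) by blast
  then show ?thesis by blast
qed

text \<open>The images of the eigenbasis under the graph map of \<open>M\<close> are orthonormal in
  \<open>Fp\<close>. Comparing coefficients in this system shows that those with eigenvalue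
  \<open>z\<close> span the eigenspace.\<close>

lemma eigsp_dim:
  fixes h :: "'a::complex_normed_vector \<Rightarrow> 'a \<Rightarrow> complex"
  assumes h: "herm h" and sp: "splitting h Fm Fp" and fd: "cfd (UNIV :: 'a set)"
    and L: "lagrangian h L" and M: "lagrangian h M" and e: "eigen_system h Fm Fp L M N x a"
  shows "cdim (eigsp Fm Fp L M z) = card {j. j < N \<and> cis (a j) = z}"
proof -
  let ?U = "gmap Fm Fp L" and ?V = "gmap Fm Fp M"
  have sh: "sesq h" by (rule herm_imp_sesq[OF h])
  note U = clinear_gmap[OF h sp L fd] and V = clinear_gmap[OF h sp M fd]
  note Fm = splitting_subspaces(1)[OF h sp]
  have x: "\<And>j. j < N \<Longrightarrow> x j \<in> Fm" "orthonormal (\<lambda>x y. - h x y) N x"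
    "\<And>y. y \<in> Fm \<Longrightarrow> \<exists>c. y = (\<Sum>j<N. c j *\<^sub>C x j)" "\<And>j. j < N \<Longrightarrow> ?U (x j) = cis (a j) *\<^sub>C ?V (x j)"
    using e by (auto simp: eigen_system_def)
  define y where "y j = ?V (x j)" for j
  have on: "orthonormal h N y"
    unfolding orthonormal_def y_def using x(1,2) gmap_isometry[OF h sp M fd] by (simp add: orthonormal_def)
  define J where "J = {j. j < N \<and> cis (a j) = z}"
  have J: "J \<subseteq> {..<N}" by (auto simp: J_def)
  have ind: "complex_vector.independent (y ` J)"
    using orthonormal_independent(1)[OF sh on] J by (meson complex_vector.independent_mono image_mono)
  have "inj_on y {..<N}" using orthonormal_independent(2)[OF sh on] by (simp add: eq_card_imp_inj_on)
  then have crd: "card (y ` J) = card J" using J by (intro card_image) (rule inj_on_subset)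
  have sub: "y ` J \<subseteq> eigsp Fm Fp L M z"
  proof
    fix v assume "v \<in> y ` J"
    then obtain j where j: "j < N" "cis (a j) = z" "v = y j" by (auto simp: J_def)
    have "x j + v \<in> M" using gmap_graph_Fm[OF h sp M fd x(1)[OF j(1)]] j by (simp add: y_def)
    moreover have "x j + z *\<^sub>C v \<in> L" using gmap_graph_Fm[OF h sp L fd x(1)[OF j(1)]] j x(4)[OF j(1)] by (simp add: y_def)
    moreover have "v \<in> Fp" using j gmap_in[OF h sp M fd] by (simp add: y_def)
    ultimately show "v \<in> eigsp Fm Fp L M z" using x(1)[OF j(1)] unfolding eigsp_def by blast
  qed
  have "eigsp Fm Fp L M z \<subseteq> cspan (y ` J)"
  proof
    fix v assume "v \<in> eigsp Fm Fp L M z"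
    then obtain u where u: "v \<in> Fp" "u \<in> Fm" "u + v \<in> M" "u + z *\<^sub>C v \<in> L" by (auto simp: eigsp_def)
    obtain d where d: "u = (\<Sum>j<N. d j *\<^sub>C x j)" using x(3)[OF u(2)] by blast
    have Vu: "?V u = v" by (rule gmap_eqI[OF h sp M fd u(2,1,3)])
    have Uu: "?U u = z *\<^sub>C v" by (rule gmap_eqI[OF h sp L fd u(2) csubspace_scale[OF splitting_subspaces(2)[OF h sp] u(1)] u(4)])
    have v: "v = (\<Sum>j<N. d j *\<^sub>C y j)" using Vu unfolding d clin_comb[OF V] y_def by simp
    have "(\<Sum>j<N. (d j * cis (a j)) *\<^sub>C y j) = ?U u"
      unfolding d clin_comb[OF U] by (intro sum.cong) (simp_all add: x(4) y_def scaleC_scaleC)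
    also have "\<dots> = (\<Sum>j<N. (z * d j) *\<^sub>C y j)"
      unfolding Uu v complex_vector.scale_sum_right by (simp add: scaleC_scaleC)
    finally have eq: "(\<Sum>j<N. (d j * cis (a j)) *\<^sub>C y j) = (\<Sum>j<N. (z * d j) *\<^sub>C y j)" .
    have dz: "d i = 0" if "i \<in> {..<N} - J" for i
    proof -
      have i: "i < N" using that by simp
      have "h (\<Sum>j<N. (d j * cis (a j)) *\<^sub>C y j) (y i) = d i * cis (a i)"
        "h (\<Sum>j<N. (z * d j) *\<^sub>C y j) (y i) = z * d i"
        using orthonormal_coeff[OF sh on order_refl i] i by (simp_all only: lessThan_iff if_True)
      then have "d i * cis (a i) = z * d i" using eq by (simp only:)
      moreover have "cis (a i) \<noteq> z" using that by (auto simp: J_def)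
      ultimately show ?thesis by (metis mult.commute mult_right_cancel)
    qed
    have "v = (\<Sum>j\<in>J. d j *\<^sub>C y j)" unfolding v
      by (rule sum.mono_neutral_right) (use J dz in auto)
    then show "v \<in> cspan (y ` J)" using span_comb[of d y J] by metis
  qed
  from complex_vector.basis_card_eq_dim[OF sub this ind] crd show ?thesis by (simp add: J_def)
qed

section \<open>Continuity of the eigenvalues\<close>

lemma bounded_bilinear_scaleC:
  "bounded_bilinear (scaleC :: complex \<Rightarrow> 'a::complex_normed_vector \<Rightarrow> 'a)"
proof
  show "\<exists>K. \<forall>(c::complex) (x::'a). norm (c *\<^sub>C x) \<le> norm c * norm x * K"
    by (rule exI[of _ 1]) (simp add: norm_scaleC)
qed (simp_all add: scaleC_add_left scaleC_add_right scaleR_scaleC scaleC_scaleC scaleR_conv_of_real mult.commute)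

lemmas continuous_on_scaleC [continuous_intros] = bounded_bilinear.continuous_on[OF bounded_bilinear_scaleC]
lemmas tendsto_scaleC = bounded_bilinear.tendsto[OF bounded_bilinear_scaleC]

text \<open>Equivalence of norms in disguise, by induction on the number of vectors and completeness
  of the complex numbers.\<close>

lemma independent_coefficients_bounded:
  fixes w :: "'i \<Rightarrow> 'a::complex_normed_vector"
  assumes "finite I" "\<And>c. (\<Sum>i\<in>I. c i *\<^sub>C w i) = 0 \<Longrightarrow> \<forall>i\<in>I. c i = 0"
  shows "\<exists>C>0. \<forall>c. \<forall>i\<in>I. cmod (c i) \<le> C * norm (\<Sum>i\<in>I. c i *\<^sub>C w i)"
  using assms
proof (induction I rule: finite_induct)
  case empty then show ?case by (intro exI[of _ 1]) simp
next
  case (insert k I)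
  have "\<forall>i\<in>I. c i = 0" if "(\<Sum>i\<in>I. c i *\<^sub>C w i) = 0" for c
  proof -
    have "(\<Sum>i\<in>insert k I. (if i = k then 0 else c i) *\<^sub>C w i) = (\<Sum>i\<in>I. c i *\<^sub>C w i)"
      using insert.hyps by (simp, intro sum.cong) auto
    then have "\<forall>i\<in>insert k I. (if i = k then 0 else c i) = 0" using that by (intro insert.prems) simp
    then show ?thesis using insert.hyps(2) by (metis insertI2)
  qed
  from insert.IH[OF this] obtain C where C: "C > 0"
    "\<And>c i. i \<in> I \<Longrightarrow> cmod (c i) \<le> C * norm (\<Sum>i\<in>I. c i *\<^sub>C w i)" by blast
  \<comment> \<open>The new vector has positive distance from the span of the old ones. Otherwise
    vectors of that span converge to \<open>- w k\<close>; by the induction hypothesis their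
    coefficients are Cauchy, and the limits give a linear relation.\<close>
  have "\<exists>\<delta>>0. \<forall>c. \<delta> \<le> norm (w k + (\<Sum>i\<in>I. c i *\<^sub>C w i))"
  proof (rule ccontr)
    assume n: "\<not> (\<exists>\<delta>>0. \<forall>c. \<delta> \<le> norm (w k + (\<Sum>i\<in>I. c i *\<^sub>C w i)))"
    have "\<exists>c. norm (w k + (\<Sum>i\<in>I. c i *\<^sub>C w i)) < inverse (real (Suc m))" for m
      using n by (metis inverse_positive_iff_positive not_less of_nat_0_less_iff zero_less_Suc)
    then obtain c where c: "\<And>m. norm (w k + (\<Sum>i\<in>I. c m i *\<^sub>C w i)) < inverse (real (Suc m))" by metis
    define s where "s m = (\<Sum>i\<in>I. c m i *\<^sub>C w i)" for m
    have lim: "(\<lambda>m. w k + s m) \<longlonglongrightarrow> 0"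
      by (rule tendsto_norm_zero_cancel, rule tendsto_sandwich[OF _ _ tendsto_const LIMSEQ_inverse_real_of_nat])
        (use c in \<open>auto simp: s_def less_imp_le\<close>)
    then have "(\<lambda>m. (w k + s m) - w k) \<longlonglongrightarrow> 0 - w k" by (intro tendsto_intros)
    then have slim: "s \<longlonglongrightarrow> - w k" by simp
    have "convergent (\<lambda>m. c m i)" if i: "i \<in> I" for i
    proof -
      have "Cauchy (\<lambda>m. c m i)"
        unfolding Cauchy_def
      proof (intro allI impI)
        fix e :: real assume "e > 0"
        then have "e / C > 0" using C(1) by simp
        then obtain M where M: "\<And>m n. m \<ge> M \<Longrightarrow> n \<ge> M \<Longrightarrow> dist (s m) (s n) < e / C"
          using LIMSEQ_imp_Cauchy[OF slim] unfolding Cauchy_def by blast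
        have "dist (c m i) (c n i) < e" if "m \<ge> M" "n \<ge> M" for m n
        proof -
          have "cmod (c m i - c n i) \<le> C * norm (\<Sum>i\<in>I. (c m i - c n i) *\<^sub>C w i)"
            using C(2)[OF i, of "\<lambda>i. c m i - c n i"] .
          also have "(\<Sum>i\<in>I. (c m i - c n i) *\<^sub>C w i) = s m - s n"
            by (simp add: s_def complex_vector.scale_left_diff_distrib sum_subtractf)
          also have "C * norm (s m - s n) < e" using M[OF that] C(1) by (simp add: dist_norm field_simps)
          finally show ?thesis by (simp add: dist_norm)
        qed
        then show "\<exists>M. \<forall>m\<ge>M. \<forall>n\<ge>M. dist (c m i) (c n i) < e" by blast
      qed
      then show ?thesis by (rule Cauchy_convergent)
    qed
    then obtain l where l: "\<And>i. i \<in> I \<Longrightarrow> (\<lambda>m. c m i) \<longlonglongrightarrow> l i" unfolding convergent_def by metis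
    have "s \<longlonglongrightarrow> (\<Sum>i\<in>I. l i *\<^sub>C w i)" unfolding s_def by (intro tendsto_sum tendsto_scaleC l tendsto_const)
    then have "(\<Sum>i\<in>I. l i *\<^sub>C w i) = - w k" using slim LIMSEQ_unique by blast
    moreover have "(\<Sum>i\<in>insert k I. (if i = k then 1 else l i) *\<^sub>C w i) = w k + (\<Sum>i\<in>I. l i *\<^sub>C w i)"
      using insert.hyps by (simp add: scaleC_one, intro sum.cong) auto
    ultimately have "(\<Sum>i\<in>insert k I. (if i = k then 1 else l i) *\<^sub>C w i) = 0" by simp
    from insert.prems[OF this] show False by auto
  qed
  then obtain \<delta> where \<delta>: "\<delta> > 0" "\<And>c. \<delta> \<le> norm (w k + (\<Sum>i\<in>I. c i *\<^sub>C w i))" by blast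
  \<comment> \<open>Dividing by \<open>c k\<close> gives |c k| <= norm x / \<delta>. The remaining
    part of x is then bounded by the triangle inequality, and its coefficients by
    \<open>C\<close>.\<close>
  define K where "K = 1 / \<delta> + C * (1 + norm (w k) / \<delta>)"
  have "cmod (c i) \<le> K * norm (\<Sum>i\<in>insert k I. c i *\<^sub>C w i)" if i: "i \<in> insert k I" for c i
  proof -
    define s where "s = (\<Sum>i\<in>I. c i *\<^sub>C w i)"
    have eq: "(\<Sum>i\<in>insert k I. c i *\<^sub>C w i) = c k *\<^sub>C w k + s" using insert.hyps by (simp add: s_def)
    define x where "x = c k *\<^sub>C w k + s"
    have ck: "cmod (c k) \<le> norm x / \<delta>"
    proof (cases "c k = 0")
      case True then show ?thesis using \<delta>(1) by simp
    next
      case False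
      have "x = c k *\<^sub>C (w k + (\<Sum>i\<in>I. (c i / c k) *\<^sub>C w i))"
        using False by (simp add: x_def s_def scaleC_add_right complex_vector.scale_sum_right scaleC_scaleC)
      then have "norm x = cmod (c k) * norm (w k + (\<Sum>i\<in>I. (c i / c k) *\<^sub>C w i))" by (simp add: norm_scaleC)
      moreover have "cmod (c k) * \<delta> \<le> cmod (c k) * norm (w k + (\<Sum>i\<in>I. (c i / c k) *\<^sub>C w i))"
        by (intro mult_left_mono \<delta>(2)) simp
      ultimately show ?thesis using \<delta>(1) by (simp add: field_simps)
    qed
    have sx: "norm s \<le> (1 + norm (w k) / \<delta>) * norm x"
    proof -
      have "norm s = norm (x - c k *\<^sub>C w k)" by (simp add: x_def)
      also have "\<dots> \<le> norm x + cmod (c k) * norm (w k)" using norm_triangle_ineq4[of x "c k *\<^sub>C w k"] by (simp add: norm_scaleC)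
      also have "\<dots> \<le> norm x + norm x / \<delta> * norm (w k)" using ck by (intro add_left_mono mult_right_mono) auto
      finally show ?thesis by (simp add: algebra_simps)
    qed
    have *: "0 \<le> norm x / \<delta>" "0 \<le> C * ((1 + norm (w k) / \<delta>) * norm x)" using C(1) \<delta>(1) by auto
    have Kx: "K * norm x = norm x / \<delta> + C * ((1 + norm (w k) / \<delta>) * norm x)" by (simp add: K_def algebra_simps)
    have "cmod (c i) \<le> K * norm x"
    proof (cases "i = k")
      case True then show ?thesis using ck * unfolding Kx by simp
    next
      case False
      then have "cmod (c i) \<le> C * norm s" using C(2)[of i c] i by (simp add: s_def)
      also have "\<dots> \<le> C * ((1 + norm (w k) / \<delta>) * norm x)" using sx C(1) by (intro mult_left_mono) auto
      finally show ?thesis using * unfolding Kx by linarith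
    qed
    then show ?thesis by (simp add: eq x_def)
  qed
  moreover have "K > 0" unfolding K_def using \<delta>(1) C(1) by (intro add_pos_nonneg) auto
  ultimately show ?case by blast
qed

definition coordinate_system :: "'a::complex_normed_vector set \<Rightarrow> 'a set \<Rightarrow> ('a \<Rightarrow> 'a \<Rightarrow> complex) \<Rightarrow> real \<Rightarrow> bool" where
  "coordinate_system E B r C \<longleftrightarrow> finite B \<and> B \<subseteq> E \<and> (\<forall>x\<in>E. x = (\<Sum>b\<in>B. r b x *\<^sub>C b)) \<and>
    (\<forall>b. \<forall>x\<in>E. \<forall>y\<in>E. r b (x - y) = r b x - r b y) \<and>
    (\<forall>c. (\<Sum>b\<in>B. c b *\<^sub>C b) = 0 \<longrightarrow> (\<forall>b\<in>B. c b = 0)) \<and>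
    0 < C \<and> (\<forall>b\<in>B. \<forall>x\<in>E. cmod (r b x) \<le> C * norm x)"

lemma coordinate_systemD:
  assumes "coordinate_system E B r C"
  shows "finite B" "B \<subseteq> E" "x \<in> E \<Longrightarrow> x = (\<Sum>b\<in>B. r b x *\<^sub>C b)"
    "x \<in> E \<Longrightarrow> y \<in> E \<Longrightarrow> r b (x - y) = r b x - r b y"
    "(\<Sum>b\<in>B. c b *\<^sub>C b) = 0 \<Longrightarrow> \<forall>b\<in>B. c b = 0" "0 < C" "b \<in> B \<Longrightarrow> x \<in> E \<Longrightarrow> cmod (r b x) \<le> C * norm x"
proof -
  note d = assms[unfolded coordinate_system_def]
  show "finite B" by (rule d[THEN conjunct1])
  show "B \<subseteq> E" by (rule d[THEN conjunct2, THEN conjunct1])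
  show "0 < C" by (rule d[THEN conjunct2, THEN conjunct2, THEN conjunct2, THEN conjunct2, THEN conjunct2, THEN conjunct1])
  show "x = (\<Sum>b\<in>B. r b x *\<^sub>C b)" if "x \<in> E" using d[THEN conjunct2, THEN conjunct2, THEN conjunct1] that by (rule bspec)
  show "r b (x - y) = r b x - r b y" if "x \<in> E" "y \<in> E"
    using d[THEN conjunct2, THEN conjunct2, THEN conjunct2, THEN conjunct1] that by metis
  show "\<forall>b\<in>B. c b = 0" if "(\<Sum>b\<in>B. c b *\<^sub>C b) = 0"
    using d[THEN conjunct2, THEN conjunct2, THEN conjunct2, THEN conjunct2, THEN conjunct1] that by metis
  show "cmod (r b x) \<le> C * norm x" if "b \<in> B" "x \<in> E"
    using d[THEN conjunct2, THEN conjunct2, THEN conjunct2, THEN conjunct2, THEN conjunct2, THEN conjunct2] that by metis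
qed

lemma cfd_coordinates:
  fixes E :: "'a::complex_normed_vector set"
  assumes "csubspace E" "cfd E"
  shows "\<exists>B r C. coordinate_system E B r C"
proof -
  obtain B where B: "B \<subseteq> E" "complex_vector.independent B" "E \<subseteq> cspan B" "card B = cdim E"
    by (rule complex_vector.basis_exists)
  obtain B0 where B0: "finite B0" "E \<subseteq> cspan B0" using assms(2) by (auto simp: cfd_def)
  have fin: "finite B" using complex_vector.independent_span_bound[OF B0(1) B(2)] B(1) B0(2) by blast
  define r where "r b x = complex_vector.representation B x b" for b x
  have exp: "x = (\<Sum>b\<in>B. r b x *\<^sub>C b)" if "x \<in> E" for x
    unfolding r_def using complex_vector.sum_representation_eq[OF B(2) _ fin order_refl, of x] B(3) that by auto
  have ind: "\<forall>b\<in>B. c b = 0" if "(\<Sum>b\<in>B. c b *\<^sub>C b) = 0" for c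
    using complex_vector.independentD[OF B(2) fin order_refl that] by blast
  obtain C where C: "C > 0" "\<And>c b. b \<in> B \<Longrightarrow> cmod (c b) \<le> C * norm (\<Sum>b\<in>B. c b *\<^sub>C b)"
    using independent_coefficients_bounded[of B "\<lambda>b. b"] fin ind by metis
  have "\<forall>b. \<forall>x\<in>E. \<forall>y\<in>E. r b (x - y) = r b x - r b y"
  proof (intro allI ballI)
    fix b x y assume xy: "x \<in> E" "y \<in> E"
    show "r b (x - y) = r b x - r b y"
      unfolding r_def using fun_cong[OF complex_vector.representation_diff[OF B(2) subsetD[OF B(3) xy(2)] subsetD[OF B(3) xy(1)]]] .
  qed
  moreover have "\<forall>b\<in>B. \<forall>x\<in>E. cmod (r b x) \<le> C * norm x"
  proof (intro ballI)
    fix b x assume bx: "b \<in> B" "x \<in> E"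
    show "cmod (r b x) \<le> C * norm x"
      using C(2)[OF bx(1), of "\<lambda>b. r b x"] exp[OF bx(2)] by simp
  qed
  moreover have "\<forall>x\<in>E. x = (\<Sum>b\<in>B. r b x *\<^sub>C b)" using exp by (rule ballI)
  moreover have "\<forall>c. (\<Sum>b\<in>B. c b *\<^sub>C b) = 0 \<longrightarrow> (\<forall>b\<in>B. c b = 0)" using ind by (intro allI impI)
  ultimately have "coordinate_system E B r C" unfolding coordinate_system_def using fin B(1) C(1)
    by (intro conjI)
  then show ?thesis by (intro exI)
qed

text \<open>By injectivity the images of a basis are independent, so the coordinates of
  \<open>x\<close> are controlled by the norm of \<open>f x\<close>, and they control
  \<open>x\<close>.\<close>

lemma clinear_bounded_below:
  fixes f :: "'a::complex_normed_vector \<Rightarrow> 'b::complex_normed_vector"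
  assumes E: "csubspace E" "cfd E" and f: "clinear f" and inj: "\<And>x. x \<in> E \<Longrightarrow> f x = 0 \<Longrightarrow> x = 0"
  shows "\<exists>k>0. \<forall>x\<in>E. k * norm x \<le> norm (f x)"
proof -
  obtain B r C where "coordinate_system E B r C" using cfd_coordinates[OF E] by blast
  note co = coordinate_systemD[OF this]
  note B = co(1-3,5)
  have "\<forall>b\<in>B. c b = 0" if "(\<Sum>b\<in>B. c b *\<^sub>C f b) = 0" for c
  proof -
    have "f (\<Sum>b\<in>B. c b *\<^sub>C b) = 0" using that by (simp add: clin_comb[OF f])
    moreover have "(\<Sum>b\<in>B. c b *\<^sub>C b) \<in> E" using B(2) by (intro csubspace_comb E) auto
    ultimately have "(\<Sum>b\<in>B. c b *\<^sub>C b) = 0" using inj by blast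
    then show ?thesis by (rule B(4))
  qed
  from independent_coefficients_bounded[OF B(1) this] obtain D where D: "D > 0"
    "\<And>c b. b \<in> B \<Longrightarrow> cmod (c b) \<le> D * norm (\<Sum>b\<in>B. c b *\<^sub>C f b)" by blast
  define S where "S = (\<Sum>b\<in>B. norm b) + 1"
  have S: "S > 0" unfolding S_def by (intro add_nonneg_pos sum_nonneg) auto
  show ?thesis
  proof (intro exI[of _ "1 / (D * S)"] conjI ballI)
    show "0 < 1 / (D * S)" using D(1) S by simp
    fix x assume x: "x \<in> E"
    have fx: "f x = (\<Sum>b\<in>B. r b x *\<^sub>C f b)" using B(3)[OF x] clin_comb[OF f, of "\<lambda>b. r b x" "\<lambda>b. b" B] by metis
    have "norm x = norm (\<Sum>b\<in>B. r b x *\<^sub>C b)" using B(3)[OF x] by simp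
    also have "\<dots> \<le> (\<Sum>b\<in>B. cmod (r b x) * norm b)"
      by (rule order_trans[OF norm_sum]) (simp add: norm_scaleC)
    also have "\<dots> \<le> (\<Sum>b\<in>B. D * norm (f x) * norm b)"
      unfolding fx using D(2)[of _ "\<lambda>b. r b x"] by (intro sum_mono mult_right_mono) auto
    also have "\<dots> \<le> D * norm (f x) * S"
      using D(1) by (simp add: sum_distrib_left[symmetric] S_def mult_left_mono)
    finally show "1 / (D * S) * norm x \<le> norm (f x)" using D(1) S by (simp add: field_simps)
  qed
qed

lemma coordinate_continuous:
  assumes "\<And>x y. x \<in> E \<Longrightarrow> y \<in> E \<Longrightarrow> r (x - y) = r x - r y" "\<And>x. x \<in> E \<Longrightarrow> cmod (r x) \<le> C * norm x"
    and E: "csubspace E" and z: "continuous_on T z" "\<And>p. p \<in> T \<Longrightarrow> z p \<in> E"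
  shows "continuous_on T (\<lambda>p. r (z p))"
  unfolding continuous_on_def
proof
  fix p assume p: "p \<in> T"
  have "(z \<longlongrightarrow> z p) (at p within T)" using z(1) p by (simp add: continuous_on_def)
  then have "((\<lambda>q. C * norm (z q - z p)) \<longlongrightarrow> C * 0) (at p within T)"
    by (intro tendsto_intros) (simp add: tendsto_norm_zero LIM_zero)
  then have lim: "((\<lambda>q. C * norm (z q - z p)) \<longlongrightarrow> 0) (at p within T)" by simp
  have ev: "\<forall>\<^sub>F q in at p within T. norm (r (z q) - r (z p)) \<le> C * norm (z q - z p)"
  proof -
    have "norm (r (z q) - r (z p)) \<le> C * norm (z q - z p)" if "q \<in> T" for q
      using assms(1)[OF z(2)[OF that] z(2)[OF p]] assms(2)[OF csubspace_diff[OF E z(2)[OF that] z(2)[OF p]]] by simp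
    then show ?thesis by (auto simp: eventually_at_filter)
  qed
  have "((\<lambda>q. norm (r (z q) - r (z p))) \<longlongrightarrow> 0) (at p within T)"
    by (rule tendsto_sandwich[OF _ ev tendsto_const lim]) simp
  then show "((\<lambda>q. r (z q)) \<longlongrightarrow> r (z p)) (at p within T)"
    by (rule LIM_zero_cancel[OF tendsto_norm_zero_cancel])
qed

text \<open>In finite dimension continuity at each fixed vector is enough: expand \<open>z p\<close>
  in a fixed basis with continuous coordinates.\<close>

lemma continuous_on_linear_family:
  fixes M :: "'p::topological_space \<Rightarrow> 'a::complex_normed_vector \<Rightarrow> 'b::complex_normed_vector"
  assumes E: "csubspace E" "cfd E" and M: "\<And>p. p \<in> T \<Longrightarrow> clinear (M p)"
    "\<And>x. x \<in> E \<Longrightarrow> continuous_on T (\<lambda>p. M p x)"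
    and z: "continuous_on T z" "\<And>p. p \<in> T \<Longrightarrow> z p \<in> E"
  shows "continuous_on T (\<lambda>p. M p (z p))"
proof -
  obtain B r C where "coordinate_system E B r C" using cfd_coordinates[OF E] by blast
  note co = coordinate_systemD[OF this]
  note B = co(1-4,7)
  have "continuous_on T (\<lambda>p. \<Sum>b\<in>B. r b (z p) *\<^sub>C M p b)"
  proof (intro continuous_on_sum continuous_on_scaleC M(2))
    fix b assume b: "b \<in> B"
    show "b \<in> E" using b B(2) by blast
    show "continuous_on T (\<lambda>p. r b (z p))"
      by (rule coordinate_continuous[OF B(4) B(5)[OF b] E(1) z])
  qed
  moreover have "(\<Sum>b\<in>B. r b (z p) *\<^sub>C M p b) = M p (z p)" if "p \<in> T" for p
    using B(3)[OF z(2)[OF that]] clin_comb[OF M(1)[OF that], of "\<lambda>b. r b (z p)" "\<lambda>b. b" B] by metis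
  ultimately show ?thesis by (rule continuous_on_eq)
qed

text \<open>Continuity of the solution of a linear equation, without inverting. At \<open>p\<close>
  the map is bounded below by \<open>k\<close>, and for \<open>q\<close> near \<open>p\<close> it
  differs on \<open>E\<close> by at most half of that, so \<open>k / 2\<close> remains a lower
  bound. This controls \<open>z q - z p\<close> by \<open>M q (z q) - M q (z p)\<close>, which tends
  to 0.\<close>

lemma continuous_on_solution:
  fixes M :: "'p::topological_space \<Rightarrow> 'a::complex_normed_vector \<Rightarrow> 'b::complex_normed_vector"
  assumes E: "csubspace E" "cfd E" and M: "\<And>p. p \<in> T \<Longrightarrow> clinear (M p)"
    "\<And>x. x \<in> E \<Longrightarrow> continuous_on T (\<lambda>p. M p x)"
    and inj: "\<And>p x. p \<in> T \<Longrightarrow> x \<in> E \<Longrightarrow> M p x = 0 \<Longrightarrow> x = 0"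
    and z: "\<And>p. p \<in> T \<Longrightarrow> z p \<in> E" and cont: "continuous_on T (\<lambda>p. M p (z p))"
  shows "continuous_on T z"
  unfolding continuous_on_def
proof
  fix p assume p: "p \<in> T"
  obtain B r C where "coordinate_system E B r C" using cfd_coordinates[OF E] by blast
  note co = coordinate_systemD[OF this]
  note B = co(1-3,6,7)
  obtain k where k: "k > 0" "\<And>x. x \<in> E \<Longrightarrow> k * norm x \<le> norm (M p x)"
    using clinear_bounded_below[OF E M(1)[OF p]] inj[OF p] by blast
  \<comment> \<open>Chosen so that changing each basis image by less than \<epsilon> changes the map
    by at most \<open>k / 2\<close> times the norm; the summand 1 covers an empty basis.\<close>
  define \<epsilon> where "\<epsilon> = k / (2 * C * (real (card B) + 1))"
  have \<epsilon>: "\<epsilon> > 0" "real (card B) * C * \<epsilon> \<le> k / 2"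
  proof -
    define D where "D = 2 * C * (real (card B) + 1)"
    have D: "D > 0" "real (card B) * C / D \<le> 1 / 2" using B(4) by (simp_all add: D_def divide_simps)
    have eD: "\<epsilon> = k / D" by (simp add: \<epsilon>_def D_def)
    show "\<epsilon> > 0" using k(1) D(1) by (simp add: eD)
    have "real (card B) * C * \<epsilon> = k * (real (card B) * C / D)" by (simp add: eD)
    also have "\<dots> \<le> k * (1 / 2)" using k(1) D(2) by (intro mult_left_mono) auto
    finally show "real (card B) * C * \<epsilon> \<le> k / 2" by simp
  qed
  have lim: "((\<lambda>q. M q x) \<longlongrightarrow> M p x) (at p within T)" if "x \<in> E" for x
    using M(2)[OF that] p by (simp add: continuous_on_def)
  have "\<forall>\<^sub>F q in at p within T. \<forall>b\<in>B. dist (M q b) (M p b) < \<epsilon>"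
    using B(1,2) tendstoD[OF lim \<epsilon>(1)] by (intro eventually_ball_finite) auto
  moreover have "\<forall>\<^sub>F q in at p within T. q \<in> T" by (simp add: eventually_at_filter)
  ultimately have ev: "\<forall>\<^sub>F q in at p within T. norm (z q - z p) \<le> 2 / k * norm (M q (z q) - M q (z p))"
  proof eventually_elim
    case (elim q)
    define x where "x = z q - z p"
    have x: "x \<in> E" unfolding x_def using z[OF elim(2)] z[OF p] by (rule csubspace_diff[OF E(1)])
    have "norm (M q x - M p x) \<le> k / 2 * norm x"
    proof -
      have "M q x - M p x = (\<Sum>b\<in>B. r b x *\<^sub>C (M q b - M p b))"
        using B(3)[OF x] clin_comb[OF M(1)[OF elim(2)], of "\<lambda>b. r b x" "\<lambda>b. b" B]
          clin_comb[OF M(1)[OF p], of "\<lambda>b. r b x" "\<lambda>b. b" B]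
        by (simp add: complex_vector.scale_right_diff_distrib sum_subtractf)
      then have "norm (M q x - M p x) \<le> (\<Sum>b\<in>B. cmod (r b x) * norm (M q b - M p b))"
        using norm_sum[of "\<lambda>b. r b x *\<^sub>C (M q b - M p b)" B] by (simp add: norm_scaleC)
      also have "\<dots> \<le> (\<Sum>b\<in>B. C * norm x * \<epsilon>)"
        using elim(1) B(5) x \<epsilon>(1) B(4) by (intro sum_mono mult_mono) (auto simp: dist_norm less_imp_le)
      also have "\<dots> = real (card B) * C * \<epsilon> * norm x" by simp
      also have "\<dots> \<le> k / 2 * norm x" using \<epsilon>(2) by (intro mult_right_mono) auto
      finally show ?thesis .
    qed
    moreover have "k * norm x \<le> norm (M p x)" by (rule k(2)[OF x])
    moreover have "norm (M p x) \<le> norm (M q x) + norm (M q x - M p x)"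
      using norm_triangle_ineq4[of "M q x" "M q x - M p x"] by simp
    ultimately have "k / 2 * norm x \<le> norm (M q x)" by (simp add: field_simps)
    then show ?case using k(1) by (simp add: x_def clin_diff[OF M(1)[OF elim(2)]] field_simps)
  qed
  have "((\<lambda>q. M q (z q)) \<longlongrightarrow> M p (z p)) (at p within T)" using cont p by (simp add: continuous_on_def)
  then have "((\<lambda>q. 2 / k * norm (M q (z q) - M q (z p))) \<longlongrightarrow> 2 / k * norm (M p (z p) - M p (z p))) (at p within T)"
    by (intro tendsto_intros lim z p)
  then have l0: "((\<lambda>q. 2 / k * norm (M q (z q) - M q (z p))) \<longlongrightarrow> 0) (at p within T)" by simp
  have "((\<lambda>q. norm (z q - z p)) \<longlongrightarrow> 0) (at p within T)"
    by (rule tendsto_sandwich[OF _ ev tendsto_const l0]) simp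
  then show "(z \<longlongrightarrow> z p) (at p within T)" by (rule LIM_zero_cancel[OF tendsto_norm_zero_cancel])
qed

lemma continuous_on_sesq:
  fixes f :: "'a::complex_normed_vector \<Rightarrow> 'a \<Rightarrow> complex" and T :: "'p::topological_space set"
  assumes fd: "cfd (UNIV :: 'a set)" and f: "sesq f" and u: "continuous_on T u" and v: "continuous_on T v"
  shows "continuous_on T (\<lambda>p. f (u p) (v p))"
proof -
  have UN: "csubspace (UNIV :: 'a set)" by (rule csubspaceI) auto
  obtain B r C where "coordinate_system (UNIV :: 'a set) B r C" using cfd_coordinates[OF UN fd] by blast
  note co = coordinate_systemD[OF this]
  have r: "continuous_on T (\<lambda>p. r b (z p))" if "b \<in> B" "continuous_on T z" for b and z :: "'p \<Rightarrow> 'a"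
    by (rule coordinate_continuous[OF co(4) co(7)[OF that(1)] UN that(2)]) auto
  have "continuous_on T (\<lambda>p. \<Sum>b\<in>B. r b (u p) * (\<Sum>d\<in>B. cnj (r d (v p)) * f b d))"
    by (intro continuous_on_sum continuous_on_mult continuous_on_const continuous_on_cnj r u v)
  moreover have "(\<Sum>b\<in>B. r b (u p) * (\<Sum>d\<in>B. cnj (r d (v p)) * f b d)) = f (u p) (v p)" for p
  proof -
    have "f (u p) (v p) = f (\<Sum>b\<in>B. r b (u p) *\<^sub>C b) (\<Sum>b\<in>B. r b (v p) *\<^sub>C b)"
      using co(3)[OF UNIV_I, of "u p"] co(3)[OF UNIV_I, of "v p"] by metis
    also have "\<dots> = (\<Sum>b\<in>B. r b (u p) * f b (\<Sum>b\<in>B. r b (v p) *\<^sub>C b))" by (rule sesq_comb1[OF f])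
    finally show ?thesis by (simp only: sesq_comb2[OF f])
  qed
  ultimately show ?thesis by (simp only:)
qed

text \<open>A continuous family of subspaces given by a trivialisation: injective linear maps from
  one fixed model space. It stands in for a topology on the set of subspaces.\<close>

definition cont_frame :: "'p::topological_space set \<Rightarrow> ('p \<Rightarrow> 'a::complex_normed_vector set) \<Rightarrow>
    'z::complex_normed_vector set \<Rightarrow> ('p \<Rightarrow> 'z \<Rightarrow> 'a) \<Rightarrow> bool" where
  "cont_frame T S Z G \<longleftrightarrow> csubspace Z \<and> cfd Z \<and> (\<forall>p\<in>T. clinear (G p) \<and> (\<forall>z\<in>Z. G p z = 0 \<longrightarrow> z = 0) \<and> S p = G p ` Z) \<and>
    (\<forall>z\<in>Z. continuous_on T (\<lambda>p. G p z))"

lemma cont_frameD: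
  assumes "cont_frame T S Z G"
  shows "csubspace Z" "cfd Z" "p \<in> T \<Longrightarrow> clinear (G p)" "p \<in> T \<Longrightarrow> z \<in> Z \<Longrightarrow> G p z = 0 \<Longrightarrow> z = 0"
    "p \<in> T \<Longrightarrow> S p = G p ` Z" "z \<in> Z \<Longrightarrow> continuous_on T (\<lambda>p. G p z)"
  using assms by (simp_all add: cont_frame_def)

lemma cont_frame_const:
  fixes S :: "'a::complex_normed_vector set"
  assumes "csubspace S" "cfd S" shows "cont_frame T (\<lambda>_. S) S (\<lambda>_ x. x)"
proof -
  have "clinear (\<lambda>x::'a. x)" by (rule clinearI) simp_all
  then show ?thesis unfolding cont_frame_def using assms by simp
qed

lemma csubspace_Times: "csubspace A \<Longrightarrow> csubspace B \<Longrightarrow> csubspace (A \<times> B)"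
  by (rule csubspaceI) (auto simp: zero_prod_def scaleC_prod_def csubspace_0 csubspace_add csubspace_scale)

lemma clinear_Pair1: "clinear (\<lambda>x. (x, 0))"
  by (rule clinearI) (simp_all add: scaleC_prod_def)

lemma clinear_Pair2: "clinear (\<lambda>x. (0, x))"
  by (rule clinearI) (simp_all add: scaleC_prod_def)

lemma clinear_image_span:
  assumes "clinear f" "x \<in> cspan A" shows "f x \<in> cspan (f ` A)"
proof -
  have "A \<subseteq> {x. f x \<in> cspan (f ` A)}" by (auto intro: complex_vector.span_base)
  moreover have "csubspace {x. f x \<in> cspan (f ` A)}"
    by (rule csubspaceI) (simp_all add: clin_zero[OF assms(1)] clin_add[OF assms(1)] clin_scale[OF assms(1)]
      complex_vector.span_zero complex_vector.span_add complex_vector.span_scale)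
  ultimately have "cspan A \<subseteq> {x. f x \<in> cspan (f ` A)}" by (rule complex_vector.span_minimal)
  then show ?thesis using assms(2) by blast
qed

lemma cfd_Times:
  assumes "cfd A" "cfd B" shows "cfd (A \<times> B)"
proof -
  obtain A' where A': "finite A'" "A \<subseteq> cspan A'" using assms(1) by (auto simp: cfd_def)
  obtain B' where B': "finite B'" "B \<subseteq> cspan B'" using assms(2) by (auto simp: cfd_def)
  let ?S = "(\<lambda>x. (x, 0)) ` A' \<union> (\<lambda>x. (0, x)) ` B'"
  have "A \<times> B \<subseteq> cspan ?S"
  proof
    fix z assume z: "z \<in> A \<times> B"
    have "(fst z, 0) \<in> cspan ((\<lambda>x. (x, 0)) ` A')"
      by (rule clinear_image_span[OF clinear_Pair1]) (use z A' in auto)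
    moreover have "(0, snd z) \<in> cspan ((\<lambda>x. (0, x)) ` B')"
      by (rule clinear_image_span[OF clinear_Pair2]) (use z B' in auto)
    ultimately have "(fst z, 0) \<in> cspan ?S" "(0, snd z) \<in> cspan ?S"
      using complex_vector.span_mono[of "(\<lambda>x. (x, 0)) ` A'" ?S] complex_vector.span_mono[of "(\<lambda>x. (0, x)) ` B'" ?S] by auto
    then have "(fst z, 0) + (0, snd z) \<in> cspan ?S" by (rule complex_vector.span_add)
    then show "z \<in> cspan ?S" by simp
  qed
  then show ?thesis using A'(1) B'(1) unfolding cfd_def by (intro exI[of _ ?S]) simp
qed

text \<open>The value y of the graph map at m is characterised by y in \<open>Fp p\<close> and m + y
  in \<open>L p\<close>. In the model spaces this is the linear equation G z - e y = m, which is
  injective because a Lagrangian meets \<open>Fp p\<close> only in 0;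
  \<open>continuous_on_solution\<close> then applies.\<close>

lemma continuous_on_gmap:
  fixes h :: "'a::complex_normed_vector \<Rightarrow> 'a \<Rightarrow> complex" and T :: "'p::topological_space set"
    and Z :: "'z::complex_normed_vector set" and Y :: "'y::complex_normed_vector set"
  assumes h: "herm h" and fd: "cfd (UNIV :: 'a set)"
    and sp: "\<And>p. p \<in> T \<Longrightarrow> splitting h (Fm p) (Fp p)" and lag: "\<And>p. p \<in> T \<Longrightarrow> lagrangian h (L p)"
    and G: "cont_frame T L Z G" and E: "cont_frame T Fp Y e"
    and m: "continuous_on T m" "\<And>p. p \<in> T \<Longrightarrow> m p \<in> Fm p"
  shows "continuous_on T (\<lambda>p. gmap (Fm p) (Fp p) (L p) (m p))"
proof -
  note G = cont_frameD[OF G] and E = cont_frameD[OF E]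
  let ?g = "\<lambda>p. gmap (Fm p) (Fp p) (L p) (m p)"
  define M where "M p w = G p (fst w) - e p (snd w)" for p and w :: "'z \<times> 'y"
  have "\<exists>w. w \<in> Z \<times> Y \<and> M p w = m p \<and> e p (snd w) = ?g p" if p: "p \<in> T" for p
  proof -
    have "m p + ?g p \<in> G p ` Z"
      using gmap_graph_Fm[OF h sp[OF p] lag[OF p] fd m(2)[OF p]] G(5)[OF p] by simp
    then obtain z where z: "z \<in> Z" "m p + ?g p = G p z" by blast
    have "?g p \<in> e p ` Y" using gmap_in[OF h sp[OF p] lag[OF p] fd] E(5)[OF p] by simp
    then obtain y where y: "y \<in> Y" "?g p = e p y" by blast
    have "M p (z, y) = m p" using z(2) y(2) by (simp add: M_def algebra_simps)
    then show ?thesis using z(1) y by (intro exI[of _ "(z, y)"]) auto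
  qed
  then obtain w where w: "\<And>p. p \<in> T \<Longrightarrow> w p \<in> Z \<times> Y" "\<And>p. p \<in> T \<Longrightarrow> M p (w p) = m p"
    "\<And>p. p \<in> T \<Longrightarrow> e p (snd (w p)) = ?g p" by metis
  have "continuous_on T w"
  proof (rule continuous_on_solution[of "Z \<times> Y" T M])
    show "csubspace (Z \<times> Y)" using G(1) E(1) by (rule csubspace_Times)
    show "cfd (Z \<times> Y)" using G(2) E(2) by (rule cfd_Times)
    show "clinear (M p)" if "p \<in> T" for p
      by (rule clinearI) (simp_all add: M_def scaleC_prod_def clin_add[OF G(3)[OF that]] clin_add[OF E(3)[OF that]]
        clin_scale[OF G(3)[OF that]] clin_scale[OF E(3)[OF that]] complex_vector.scale_right_diff_distrib)
    show "continuous_on T (\<lambda>p. M p x)" if "x \<in> Z \<times> Y" for x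
      unfolding M_def using that by (intro continuous_on_diff G(6) E(6)) auto
    show "x = 0" if "p \<in> T" "x \<in> Z \<times> Y" "M p x = 0" for p x
    proof -
      have eq: "G p (fst x) = e p (snd x)" using that(3) by (simp add: M_def)
      have "G p (fst x) \<in> L p" using G(5)[OF that(1)] that(2) by auto
      moreover have "G p (fst x) \<in> Fp p" unfolding eq using E(5)[OF that(1)] that(2) by auto
      ultimately have "G p (fst x) = 0" using lag_Fp[OF h sp[OF that(1)] lag[OF that(1)] fd] by blast
      then have "fst x = 0" "snd x = 0"
        using eq G(4)[OF that(1), of "fst x"] E(4)[OF that(1), of "snd x"] that(2) by auto
      then show ?thesis by (simp add: prod_eq_iff)
    qed
    show "w p \<in> Z \<times> Y" if "p \<in> T" for p by (rule w(1)[OF that])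
    show "continuous_on T (\<lambda>p. M p (w p))" using m(1) by (rule continuous_on_eq) (simp add: w(2))
  qed
  then have sw: "continuous_on T (\<lambda>p. snd (w p))" by (rule continuous_on_snd)
  have "continuous_on T (\<lambda>p. e p (snd (w p)))"
    by (rule continuous_on_linear_family[OF E(1,2) E(3) E(6) sw]) (use w(1) in \<open>auto simp: mem_Times_iff\<close>)
  then show ?thesis by (rule continuous_on_eq) (simp add: w(3))
qed

definition represents_eigsp :: "'a::complex_normed_vector set \<Rightarrow> 'a set \<Rightarrow> 'a set \<Rightarrow> 'a set \<Rightarrow> nat \<Rightarrow> (nat \<Rightarrow> real) \<Rightarrow> bool" where
  "represents_eigsp Fm Fp L M N a \<longleftrightarrow> (\<forall>z. card {j. j < N \<and> cis (a j) = z} = cdim (eigsp Fm Fp L M z))"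

lemma represents_eigsp_unique:
  assumes "represents_eigsp Fm Fp L M N a" "represents_eigsp Fm Fp L M N' a'"
  shows "N = N'" "same_args N a a'"
proof -
  have eq: "card {j. j < N \<and> cis (a j) = z} = card {j. j < N' \<and> cis (a' j) = z}" for z
    using assms by (simp add: represents_eigsp_def)
  show "N = N'" by (rule equal_fibre_cards_bij(1)[OF eq])
  then show "same_args N a a'" using eq by (simp add: same_args_def)
qed

lemma represents_eigsp_eigen_system:
  fixes h :: "'a::complex_normed_vector \<Rightarrow> 'a \<Rightarrow> complex"
  assumes "herm h" "splitting h Fm Fp" "cfd (UNIV :: 'a set)" "lagrangian h L" "lagrangian h M"
  shows "\<exists>x a. eigen_system h Fm Fp L M (cdim Fm) x a \<and> represents_eigsp Fm Fp L M (cdim Fm) a"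
proof -
  obtain x a where e: "eigen_system h Fm Fp L M (cdim Fm) x a" using eigen_system_exists[OF assms] by blast
  then have "represents_eigsp Fm Fp L M (cdim Fm) a"
    unfolding represents_eigsp_def using eigsp_dim[OF assms] by simp
  then show ?thesis using e by blast
qed

lemma represents_eigsp_same:
  fixes h :: "'a::complex_normed_vector \<Rightarrow> 'a \<Rightarrow> complex"
  assumes "herm h" "splitting h Fm Fp" "cfd (UNIV :: 'a set)" "lagrangian h L" "lagrangian h M"
    "represents_eigsp Fm Fp L M N a"
  shows "\<exists>x a'. eigen_system h Fm Fp L M N x a' \<and> same_args N a' a" "N = cdim Fm"
proof -
  obtain x a' where e: "eigen_system h Fm Fp L M (cdim Fm) x a'" "represents_eigsp Fm Fp L M (cdim Fm) a'"
    using represents_eigsp_eigen_system[OF assms(1-5)] by blast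
  show N: "N = cdim Fm" using represents_eigsp_unique(1)[OF assms(6) e(2)] .
  show "\<exists>x a'. eigen_system h Fm Fp L M N x a' \<and> same_args N a' a"
    using e represents_eigsp_unique(2)[OF e(2) assms(6)] unfolding N by blast
qed

text \<open>Pull everything back to the model space of \<open>Fm\<close>. There the forms h (U y) (V
  z) and - h y z are continuous in the parameter, and the eigen systems diagonalise this pencil, so
  \<open>lsc_args_pencil\<close> applies even though the splitting varies.\<close>

theorem lsc_args_family:
  fixes h :: "'a::complex_normed_vector \<Rightarrow> 'a \<Rightarrow> complex" and T :: "'p::topological_space set"
    and Z :: "'z::complex_normed_vector set" and Z' :: "'w::complex_normed_vector set"
    and Y :: "'y::complex_normed_vector set" and Y' :: "'v::complex_normed_vector set"
  assumes h: "herm h" and fd: "cfd (UNIV :: 'a set)"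
    and sp: "\<And>p. p \<in> T \<Longrightarrow> splitting h (Fm p) (Fp p)"
    and lag: "\<And>p. p \<in> T \<Longrightarrow> lagrangian h (L p)" "\<And>p. p \<in> T \<Longrightarrow> lagrangian h (M p)"
    and G: "cont_frame T L Z G" "cont_frame T M Z' G'" and E: "cont_frame T Fm Y e" "cont_frame T Fp Y' e'"
    and a: "\<And>p. p \<in> T \<Longrightarrow> represents_eigsp (Fm p) (Fp p) (L p) (M p) N (a p)"
  shows "lsc_args T N a"
proof -
  have "\<exists>x a'. eigen_system h (Fm p) (Fp p) (L p) (M p) N x a' \<and> same_args N a' (a p)" if p: "p \<in> T" for p
    by (rule represents_eigsp_same(1)[OF h sp[OF p] fd lag(1)[OF p] lag(2)[OF p] a[OF p]])
  then obtain x a' where xa: "\<And>p. p \<in> T \<Longrightarrow> eigen_system h (Fm p) (Fp p) (L p) (M p) N (x p) (a' p)"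
    "\<And>p. p \<in> T \<Longrightarrow> same_args N (a' p) (a p)" by metis
  note Y = cont_frameD[OF E(1)]
  have sh: "sesq h" by (rule herm_imp_sesq[OF h])
  have es: "j < N \<Longrightarrow> x p j \<in> Fm p" "orthonormal (\<lambda>x y. - h x y) N (x p)"
    "y \<in> Fm p \<Longrightarrow> \<exists>c. y = (\<Sum>j<N. c j *\<^sub>C x p j)"
    "j < N \<Longrightarrow> gmap (Fm p) (Fp p) (L p) (x p j) = cis (a' p j) *\<^sub>C gmap (Fm p) (Fp p) (M p) (x p j)"
    if "p \<in> T" for p j y
    using xa(1)[OF that] unfolding eigen_system_def by blast+
  have "\<exists>u. \<forall>j<N. u j \<in> Y \<and> e p (u j) = x p j" if p: "p \<in> T" for p
  proof -
    have "\<forall>j. \<exists>y. j < N \<longrightarrow> y \<in> Y \<and> e p y = x p j"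
      using es(1)[OF p] unfolding Y(5)[OF p] image_iff by metis
    then show ?thesis by metis
  qed
  then obtain u where u: "\<And>p j. p \<in> T \<Longrightarrow> j < N \<Longrightarrow> u p j \<in> Y" "\<And>p j. p \<in> T \<Longrightarrow> j < N \<Longrightarrow> e p (u p j) = x p j"
    by metis
  define A where "A p y z = h (gmap (Fm p) (Fp p) (L p) (e p y)) (gmap (Fm p) (Fp p) (M p) (e p z))" for p y z
  define B where "B p y z = - h (e p y) (e p z)" for p y z
  have "lsc_args T N a'"
  proof (rule lsc_args_pencil[where A = A and B = B and x = u and Y = Y])
    fix p assume p: "p \<in> T"
    show "sesq (A p)" unfolding A_def
      by (rule sesq_compose[OF sh clinear_compose[OF clinear_gmap[OF h sp[OF p] lag(1)[OF p] fd] Y(3)[OF p]]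
        clinear_compose[OF clinear_gmap[OF h sp[OF p] lag(2)[OF p] fd] Y(3)[OF p]]])
    show "sesq (B p)" unfolding B_def
      by (rule sesq_compose[OF herm_imp_sesq[OF herm_neg[OF h]] Y(3)[OF p] Y(3)[OF p]])
    show "orthonormal (B p) N (u p)" using es(2)[OF p] by (simp add: orthonormal_def B_def u(2)[OF p])
    show "cis_diagonal (A p) N (u p) (a' p)"
      unfolding cis_diagonal_def
    proof (intro allI impI)
      fix i j assume ij: "i < N" "j < N"
      have "A p (u p i) (u p j) = cis (a' p i) * - h (x p i) (x p j)"
        using ij by (simp add: A_def u(2)[OF p] es(4)[OF p] sesq_scale1[OF sh]
          gmap_isometry[OF h sp[OF p] lag(2)[OF p] fd es(1)[OF p] es(1)[OF p]])
      also have "- h (x p i) (x p j) = (if i = j then 1 else 0)"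
        using es(2)[OF p] ij unfolding orthonormal_def by blast
      finally show "A p (u p i) (u p j) = (if i = j then cis (a' p i) else 0)" by simp
    qed
    show "u p i \<in> Y" if "i < N" for i by (rule u(1)[OF p that])
    show "\<exists>c. y = (\<Sum>j<N. c j *\<^sub>C u p j)" if y: "y \<in> Y" for y
    proof -
      have "e p y \<in> Fm p" using Y(5)[OF p] y by simp
      then obtain c where c: "e p y = (\<Sum>j<N. c j *\<^sub>C x p j)" using es(3)[OF p] by blast
      have "e p (\<Sum>j<N. c j *\<^sub>C u p j) = e p y"
        unfolding c clin_comb[OF Y(3)[OF p]] by (intro sum.cong) (simp_all add: u(2)[OF p])
      then have "e p (y - (\<Sum>j<N. c j *\<^sub>C u p j)) = 0" by (simp add: clin_diff[OF Y(3)[OF p]])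
      moreover have "y - (\<Sum>j<N. c j *\<^sub>C u p j) \<in> Y"
        using y u(1)[OF p] by (intro csubspace_diff csubspace_comb Y(1)) auto
      ultimately have "y - (\<Sum>j<N. c j *\<^sub>C u p j) = 0" using Y(4)[OF p] by blast
      then show ?thesis by (intro exI[of _ c]) simp
    qed
  next
    fix y z assume yz: "y \<in> Y" "z \<in> Y"
    have inF: "e p y \<in> Fm p" if "p \<in> T" "y \<in> Y" for p y using Y(5)[OF that(1)] that(2) by simp
    show "continuous_on T (\<lambda>p. B p y z)" unfolding B_def
      by (intro continuous_on_minus continuous_on_sesq[OF fd sh] Y(6) yz)
    show "continuous_on T (\<lambda>p. A p y z)" unfolding A_def
      by (intro continuous_on_sesq[OF fd sh] continuous_on_gmap[OF h fd sp lag(1) G(1) E(2)]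
        continuous_on_gmap[OF h fd sp lag(2) G(2) E(2)] Y(6) yz inF)
  qed
  then show ?thesis
    unfolding lsc_args_def using same_args_arg_count[OF xa(2)]
    by (auto simp: eventually_at_filter elim!: eventually_mono)
qed

lemma clinear_inj_imp_surj:
  fixes f :: "'a::complex_normed_vector \<Rightarrow> 'a"
  assumes fd: "cfd (UNIV :: 'a set)" and f: "clinear f" and inj: "\<And>x. f x = 0 \<Longrightarrow> x = 0"
  shows "surj f"
proof -
  obtain B :: "'a set" where "finite_dimensional_vector_space scaleC B" by (rule cfd_finite_dimensional[OF fd])
  then interpret fd: finite_dimensional_vector_space scaleC B .
  have "inj f"
  proof (rule injI)
    fix x y assume "f x = f y"
    then have "f (x - y) = 0" by (simp add: clin_diff[OF f])
    then show "x = y" using inj[of "x - y"] by simp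
  qed
  then show ?thesis using fd.linear_inj_imp_surj f by blast
qed

lemma cdim_image_eq:
  fixes f :: "'a::complex_normed_vector \<Rightarrow> 'b::complex_normed_vector"
  assumes fd: "cfd (UNIV :: 'a set)" and f: "clinear f" and S: "csubspace S" and inj: "\<And>x. x \<in> S \<Longrightarrow> f x = 0 \<Longrightarrow> x = 0"
  shows "cdim (f ` S) = cdim S"
proof -
  obtain B :: "'a set" where "finite_dimensional_vector_space scaleC B" by (rule cfd_finite_dimensional[OF fd])
  then interpret fd: finite_dimensional_vector_space scaleC B .
  interpret p: finite_dimensional_vector_space_pair_1 scaleC B "scaleC :: complex \<Rightarrow> 'b \<Rightarrow> 'b"
    by unfold_locales
  have "inj_on f S"
  proof (rule inj_onI)
    fix x y assume xy: "x \<in> S" "y \<in> S" "f x = f y"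
    then have "f (x - y) = 0" by (simp add: clin_diff[OF f])
    then show "x = y" using inj[OF csubspace_diff[OF S xy(1,2)]] by simp
  qed
  moreover have "cspan S = S" using S by (simp add: complex_vector.span_eq_iff)
  ultimately show ?thesis using p.dim_image_eq[OF f, of S] by (simp add: cdim_def cspan_def)
qed

lemma lsc_args_compose:
  assumes lsc: "lsc_args T N a" and c: "continuous_on U c" "c ` U \<subseteq> T"
  shows "lsc_args U N (\<lambda>u. a (c u))"
  unfolding lsc_args_def
proof (intro ballI allI)
  fix u \<psi> \<kappa> assume u: "u \<in> U"
  then have cu: "c u \<in> T" using c(2) by blast
  obtain S where S: "open S" "c u \<in> S" "\<forall>q\<in>T \<inter> S. arg_count N (a (c u)) \<psi> \<kappa> \<le> arg_count N (a q) \<psi> \<kappa>"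
    using lsc_argsD_open[OF lsc cu] by blast
  have "\<forall>\<^sub>F v in at u within U. c v \<in> S"
    using c(1) u S(1,2) unfolding continuous_on_def tendsto_def by blast
  moreover have "\<forall>\<^sub>F v in at u within U. v \<in> U" by (simp add: eventually_at_filter)
  ultimately show "\<forall>\<^sub>F v in at u within U. arg_count N (a (c u)) \<psi> \<kappa> \<le> arg_count N (a (c v)) \<psi> \<kappa>"
  proof eventually_elim
    case (elim v)
    then have "c v \<in> T \<inter> S" using c(2) by blast
    then show ?case using S(3) by blast
  qed
qed

lemma cont_frame_compose:
  assumes "cont_frame T S Z G" "continuous_on U c" "c ` U \<subseteq> T"
  shows "cont_frame U (\<lambda>u. S (c u)) Z (\<lambda>u. G (c u))"
proof -
  note d = cont_frameD[OF assms(1)]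
  have "continuous_on U (\<lambda>u. G (c u) z)" if "z \<in> Z" for z
    by (rule continuous_on_compose2[OF d(6)[OF that] assms(2,3)])
  moreover have cU: "c u \<in> T" if "u \<in> U" for u using assms(3) that by blast
  moreover have "\<forall>u\<in>U. \<forall>z\<in>Z. G (c u) z = 0 \<longrightarrow> z = 0"
  proof (intro ballI impI)
    show "z = 0" if "u \<in> U" "z \<in> Z" "G (c u) z = 0" for u z by (rule d(4)[OF cU[OF that(1)] that(2,3)])
  qed
  ultimately show ?thesis unfolding cont_frame_def using d(1-3,5) by simp
qed

section \<open>Independence of the splitting\<close>

definition lifts_eigsp :: "'a::complex_normed_vector set \<Rightarrow> 'a set \<Rightarrow> real \<Rightarrow> real \<Rightarrow> (real \<Rightarrow> 'a set) \<Rightarrow> 'a set \<Rightarrow>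
    nat \<Rightarrow> (nat \<Rightarrow> real \<Rightarrow> real) \<Rightarrow> bool" where
  "lifts_eigsp Fm Fp a b \<Lambda> M N \<theta> \<longleftrightarrow> (\<forall>j<N. continuous_on {a..b} (\<theta> j)) \<and>
    (\<forall>s\<in>{a..b}. represents_eigsp Fm Fp (\<Lambda> s) M N (\<lambda>j. \<theta> j s))"

definition lift_index :: "nat \<Rightarrow> real \<Rightarrow> real \<Rightarrow> (nat \<Rightarrow> real \<Rightarrow> real) \<Rightarrow> int" where
  "lift_index N a b \<theta> = ceil_sum N (\<lambda>j. \<theta> j b) - ceil_sum N (\<lambda>j. \<theta> j a)"

lemma represents_eigsp_cong:
  "same_args N a a' \<Longrightarrow> represents_eigsp Fm Fp L M N a \<Longrightarrow> represents_eigsp Fm Fp L M N a'"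
  by (simp add: represents_eigsp_def same_args_def)

text \<open>For eigenvalue 1 both graph conditions concern the same vector x + y, and the projection
  to \<open>Fp\<close> is injective on \<open>L\<close>. The right side does not mention the
  splitting, which makes this the invariant quantity when the splitting is deformed.\<close>

lemma eigsp_one_dim:
  fixes h :: "'a::complex_normed_vector \<Rightarrow> 'a \<Rightarrow> complex"
  assumes h: "herm h" and sp: "splitting h Fm Fp" and fd: "cfd (UNIV :: 'a set)"
    and L: "lagrangian h L" and M: "lagrangian h M"
  shows "cdim (eigsp Fm Fp L M 1) = cdim (L \<inter> M)"
proof -
  let ?q = "\<lambda>x. x - proj Fm Fp x"
  have q: "clinear ?q"
    by (rule clinearI) (simp_all add: clin_add[OF clinear_proj[OF h sp]] clin_scale[OF clinear_proj[OF h sp]]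
      complex_vector.scale_right_diff_distrib)
  have "eigsp Fm Fp L M 1 = ?q ` (L \<inter> M)"
  proof (intro subset_antisym subsetI)
    fix y assume "y \<in> eigsp Fm Fp L M 1"
    then obtain x where x: "y \<in> Fp" "x \<in> Fm" "x + y \<in> M" "x + y \<in> L" by (auto simp: eigsp_def scaleC_one)
    have "proj Fm Fp (x + y) = x" by (rule proj_eq[OF h sp]) (use x in auto)
    then show "y \<in> ?q ` (L \<inter> M)" using x by (intro image_eqI[of _ _ "x + y"]) auto
  next
    fix y assume "y \<in> ?q ` (L \<inter> M)"
    then obtain z where z: "z \<in> L" "z \<in> M" "y = ?q z" by auto
    then show "y \<in> eigsp Fm Fp L M 1"
      using proj_in[OF h sp, of z] proj_compl[OF h sp, of z]
      by (auto simp: eigsp_def scaleC_one intro!: bexI[of _ "proj Fm Fp z"])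
  qed
  moreover have "cdim (?q ` (L \<inter> M)) = cdim (L \<inter> M)"
  proof (rule cdim_image_eq[OF fd q])
    show "csubspace (L \<inter> M)" using L M by (simp add: lagrangian_def complex_vector.subspace_inter)
    fix x assume x: "x \<in> L \<inter> M" "?q x = 0"
    then have "x \<in> Fm" using proj_in[OF h sp, of x] by simp
    then show "x = 0" using lag_Fm[OF h sp L fd] x by blast
  qed
  ultimately show ?thesis by simp
qed

text \<open>Inclusion already forces equality, by uniqueness of the decomposition. It identifies the
  end of the deformation of splittings.\<close>

lemma splitting_subset_eq:
  assumes h: "herm h" and sp: "splitting h Fm Fp" "splitting h Fm' Fp'" and sub: "Fm \<subseteq> Fm'" "Fp \<subseteq> Fp'"
  shows "Fm = Fm'" "Fp = Fp'"
proof -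
  have "x \<in> Fm" if x: "x \<in> Fm'" for x
  proof -
    have "proj Fm' Fp' x = proj Fm Fp x"
      using proj_in[OF h sp(1), of x] proj_compl[OF h sp(1), of x] sub by (intro proj_eq[OF h sp(2)]) auto
    then show ?thesis using proj_Fm[OF h sp(2) x] proj_in[OF h sp(1), of x] by simp
  qed
  then show "Fm = Fm'" using sub by blast
  have "x \<in> Fp" if x: "x \<in> Fp'" for x
  proof -
    have "proj Fm Fp x \<in> Fm'" using proj_in[OF h sp(1), of x] sub by auto
    moreover have "proj Fm Fp x = x - (x - proj Fm Fp x)" by simp
    then have "proj Fm Fp x \<in> Fp'"
      using csubspace_diff[OF splitting_subspaces(2)[OF h sp(2)] x, of "x - proj Fm Fp x"] proj_compl[OF h sp(1), of x] sub by auto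
    ultimately have "proj Fm Fp x = 0" by (rule splitting_Int[OF h sp(2)])
    then show ?thesis using proj_compl[OF h sp(1), of x] by simp
  qed
  then show "Fp = Fp'" using sub by blast
qed

text \<open>
  With factors \<open>(1, r)\<close> on the negative and \<open>(r, 1)\<close> on the positive subspace of another splitting,
  \<open>r\<close> going from \<open>1\<close> to \<open>0\<close>, this deforms that splitting into \<open>(Fm, Fp)\<close>.
\<close>

definition squeeze :: "'a::complex_normed_vector set \<Rightarrow> 'a set \<Rightarrow> real \<Rightarrow> real \<Rightarrow> 'a \<Rightarrow> 'a" where
  "squeeze Fm Fp r s x = complex_of_real r *\<^sub>C proj Fm Fp x + complex_of_real s *\<^sub>C (x - proj Fm Fp x)"

lemma clinear_squeeze:
  assumes "herm h" "splitting h Fm Fp" shows "clinear (squeeze Fm Fp r s)"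
  by (rule clinearI) (simp_all add: squeeze_def clin_add[OF clinear_proj[OF assms]] clin_scale[OF clinear_proj[OF assms]]
    scaleC_add_right complex_vector.scale_right_diff_distrib scaleC_scaleC mult.commute)

lemma squeeze_form:
  assumes h: "herm h" and sp: "splitting h Fm Fp"
  shows "h (squeeze Fm Fp r s x) (squeeze Fm Fp r' s' y) =
    of_real (r * r') * h (proj Fm Fp x) (proj Fm Fp y) + of_real (s * s') * h (x - proj Fm Fp x) (y - proj Fm Fp y)"
  unfolding squeeze_def using herm_imp_sesq[OF h]
  by (subst splitting_form[OF h sp])
    (simp_all add: csubspace_scale splitting_subspaces[OF h sp] proj_in[OF h sp] proj_compl[OF h sp] sesq_scale1 sesq_scale2)

text \<open>On \<open>Ym\<close> only the positive component is shrunk, so h stays negative there;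
  on \<open>Yp\<close> only the negative one, so h stays positive. The crossed placement of the
  factors gives both components the weight r, whence images of \<open>Ym\<close> and
  \<open>Yp\<close> pair to r times 0.\<close>

lemma splitting_homotopy:
  fixes h :: "'a::complex_normed_vector \<Rightarrow> 'a \<Rightarrow> complex"
  assumes h: "herm h" and fd: "cfd (UNIV :: 'a set)" and X: "splitting h Xm Xp" and Y: "splitting h Ym Yp" and r: "0 \<le> r" "r \<le> 1"
  shows "splitting h (squeeze Xm Xp 1 r ` Ym) (squeeze Xm Xp r 1 ` Yp)"
    "\<And>y. y \<in> Ym \<Longrightarrow> squeeze Xm Xp 1 r y = 0 \<Longrightarrow> y = 0" "\<And>y. y \<in> Yp \<Longrightarrow> squeeze Xm Xp r 1 y = 0 \<Longrightarrow> y = 0"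
proof -
  let ?D = "squeeze Xm Xp 1 r" and ?D' = "squeeze Xm Xp r 1"
  let ?\<pi> = "proj Xm Xp"
  have sh: "sesq h" by (rule herm_imp_sesq[OF h])
  note D = clinear_squeeze[OF h X]
  have split: "h x y = h (?\<pi> x) (?\<pi> y) + h (x - ?\<pi> x) (y - ?\<pi> y)" for x y
    using splitting_form[OF h X proj_in[OF h X] proj_compl[OF h X] proj_in[OF h X] proj_compl[OF h X], of x x y y] by simp
  have sm: "Re (h (?\<pi> x) (?\<pi> x)) \<le> 0" for x
    using splitting_neg[OF h X proj_in[OF h X, of x]] sesq_zero1[OF sh, of 0] by (cases "?\<pi> x = 0") auto
  have sP: "0 \<le> Re (h (x - ?\<pi> x) (x - ?\<pi> x))" for x
    using splitting_pos[OF h X proj_compl[OF h X, of x]] sesq_zero1[OF sh, of 0] by (cases "x - ?\<pi> x = 0") auto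
  have r2: "r * r \<le> 1" "0 \<le> r * r" using r by (auto intro: mult_le_one)
  have neg: "Re (h (?D y) (?D y)) < 0" if "y \<in> Ym" "y \<noteq> 0" for y
  proof -
    have "Re (h (?D y) (?D y)) = Re (h (?\<pi> y) (?\<pi> y)) + r * r * Re (h (y - ?\<pi> y) (y - ?\<pi> y))"
      by (simp add: squeeze_form[OF h X])
    also have "\<dots> \<le> Re (h (?\<pi> y) (?\<pi> y)) + Re (h (y - ?\<pi> y) (y - ?\<pi> y))"
      using mult_right_mono[OF r2(1) sP[of y]] by simp
    also have "\<dots> = Re (h y y)" using split[of y y] by simp
    also have "\<dots> < 0" by (rule splitting_neg[OF h Y that])
    finally show ?thesis .
  qed
  have pos: "0 < Re (h (?D' y) (?D' y))" if "y \<in> Yp" "y \<noteq> 0" for y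
  proof -
    have "0 < Re (h y y)" by (rule splitting_pos[OF h Y that])
    also have "\<dots> = Re (h (?\<pi> y) (?\<pi> y)) + Re (h (y - ?\<pi> y) (y - ?\<pi> y))" using split[of y y] by simp
    also have "\<dots> \<le> r * r * Re (h (?\<pi> y) (?\<pi> y)) + Re (h (y - ?\<pi> y) (y - ?\<pi> y))"
      using mult_right_mono_neg[OF r2(1) sm[of y]] by simp
    also have "\<dots> = Re (h (?D' y) (?D' y))" by (simp add: squeeze_form[OF h X])
    finally show ?thesis .
  qed
  have h00: "h 0 0 = 0" by (rule sesq_zero1[OF sh])
  show i1: "y = 0" if "y \<in> Ym" "?D y = 0" for y using neg[OF that(1)] that(2) h00 by (cases "y = 0") auto
  show i2: "y = 0" if "y \<in> Yp" "?D' y = 0" for y using pos[OF that(1)] that(2) h00 by (cases "y = 0") auto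
  have orth: "h (?D y) (?D' z) = 0" if "y \<in> Ym" "z \<in> Yp" for y z
  proof -
    have "h (?D y) (?D' z) = of_real r * h y z"
      unfolding squeeze_form[OF h X] split[of y z] by (simp add: algebra_simps)
    then show ?thesis using splitting_orth(1)[OF h Y that] by simp
  qed
  let ?\<rho> = "proj Ym Yp"
  \<comment> \<open>Maps the old decomposition to the new one. It is injective by definiteness and
    orthogonality, hence surjective in finite dimension, and so the two images span.\<close>
  define S where "S x = ?D (?\<rho> x) + ?D' (x - ?\<rho> x)" for x
  have S: "clinear S"
    by (rule clinearI) (simp_all add: S_def clin_add[OF clinear_proj[OF h Y]] clin_scale[OF clinear_proj[OF h Y]]
      clin_add[OF D] clin_scale[OF D] clin_diff[OF D] scaleC_add_right complex_vector.scale_right_diff_distrib)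
  have "surj S"
  proof (rule clinear_inj_imp_surj[OF fd S])
    fix x assume "S x = 0"
    then have eq: "?D (?\<rho> x) = - ?D' (x - ?\<rho> x)" by (simp add: S_def eq_neg_iff_add_eq_0)
    have "h (?D (?\<rho> x)) (?D (?\<rho> x)) = - h (?D (?\<rho> x)) (?D' (x - ?\<rho> x))"
      by (subst (2) eq) (simp add: sesq_minus2[OF sh])
    also have "\<dots> = 0" using orth[OF proj_in[OF h Y] proj_compl[OF h Y]] by simp
    finally have z: "?\<rho> x = 0" using neg[OF proj_in[OF h Y, of x]] by fastforce
    then have "?D' (x - ?\<rho> x) = 0" using eq clin_zero[OF D] by simp
    then show "x = 0" using i2[OF proj_compl[OF h Y]] z by fastforce
  qed
  have "x \<in> (\<lambda>(u, v). u + v) ` ((?D ` Ym) \<times> (?D' ` Yp))" for x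
  proof -
    obtain w where "x = S w" using \<open>surj S\<close> by (rule surjE)
    then show ?thesis unfolding S_def using proj_in[OF h Y, of w] proj_compl[OF h Y, of w]
      by (intro image_eqI[of _ _ "(?D (?\<rho> w), ?D' (w - ?\<rho> w))"]) auto
  qed
  then have span: "(\<lambda>(u, v). u + v) ` ((?D ` Ym) \<times> (?D' ` Yp)) = UNIV" by blast
  show "splitting h (?D ` Ym) (?D' ` Yp)"
    unfolding splitting_def
  proof (intro conjI span csubspace_image D splitting_subspaces[OF h Y] ballI impI)
    show "Re (h x x) < 0" if "x \<in> ?D ` Ym" "x \<noteq> 0" for x using that neg clin_zero[OF D, of 1 r] by auto
    show "0 < Re (h x x)" if "x \<in> ?D' ` Yp" "x \<noteq> 0" for x using that pos clin_zero[OF D, of r 1] by auto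
    show "h x y = 0" if "x \<in> ?D ` Ym" "y \<in> ?D' ` Yp" for x y using that orth by auto
  qed
qed

lemma lifts_eigsp_exists:
  fixes h :: "'a::complex_normed_vector \<Rightarrow> 'a \<Rightarrow> complex" and Z :: "'z::complex_normed_vector set"
  assumes h: "herm h" and fd: "cfd (UNIV :: 'a set)" and sp: "splitting h Fm Fp" and ab: "a \<le> b"
    and \<Lambda>: "\<And>s. s \<in> {a..b} \<Longrightarrow> lagrangian h (\<Lambda> s)" "cont_frame {a..b} \<Lambda> Z G" and M: "lagrangian h M"
  shows "\<exists>\<theta>. lifts_eigsp Fm Fp a b \<Lambda> M (cdim Fm) \<theta>"
proof -
  have sub: "csubspace M" using M by (simp add: lagrangian_def)
  have cf: "cfd S" for S :: "'a set" by (rule cfd_mono[OF fd subset_UNIV])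
  have "\<exists>c. represents_eigsp Fm Fp (\<Lambda> s) M (cdim Fm) c" if "s \<in> {a..b}" for s
    using represents_eigsp_eigen_system[OF h sp fd \<Lambda>(1)[OF that] M] by blast
  then obtain c where c: "\<And>s. s \<in> {a..b} \<Longrightarrow> represents_eigsp Fm Fp (\<Lambda> s) M (cdim Fm) (c s)" by metis
  have "lsc_args {a..b} (cdim Fm) c"
    by (rule lsc_args_family[OF h fd sp \<Lambda>(1) M \<Lambda>(2) cont_frame_const[OF sub cf]
      cont_frame_const[OF splitting_subspaces(1)[OF h sp] cf] cont_frame_const[OF splitting_subspaces(2)[OF h sp] cf] c])
  from global_lift[OF this ab] obtain \<theta> where \<theta>: "\<forall>j<cdim Fm. continuous_on {a..b} (\<theta> j)"
    "\<forall>s\<in>{a..b}. same_args (cdim Fm) (\<lambda>j. \<theta> j s) (c s)" by blast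
  then have "lifts_eigsp Fm Fp a b \<Lambda> M (cdim Fm) \<theta>"
    unfolding lifts_eigsp_def using represents_eigsp_cong[OF same_args_sym c] by blast
  then show ?thesis by blast
qed

lemma lift_index_potential:
  fixes T :: "'p::real_normed_vector set" and \<mu> :: "'p \<Rightarrow> real" and u v :: real
  assumes pot: "index_potential T N a \<mu>"
    and uv: "u \<le> v" and c: "continuous_on {u..v} c" "c ` {u..v} \<subseteq> T"
    and l: "lifts_eigsp Fm Fp u v \<Lambda> M N' \<theta>"
    and r: "\<And>s. s \<in> {u..v} \<Longrightarrow> represents_eigsp Fm Fp (\<Lambda> s) M N (a (c s))"
  shows "N' = N" "of_int (lift_index N u v \<theta>) = \<mu> (c v) - \<mu> (c u)"
proof -
  have rep: "represents_eigsp Fm Fp (\<Lambda> s) M N' (\<lambda>j. \<theta> j s)" if "s \<in> {u..v}" for s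
    using l that by (simp add: lifts_eigsp_def)
  have "u \<in> {u..v}" using uv by simp
  from represents_eigsp_unique(1)[OF rep[OF this] r[OF this]] show N: "N' = N" .
  have "\<forall>s\<in>{u..v}. same_args N (\<lambda>j. \<theta> j s) (a (c s))"
    using represents_eigsp_unique(2)[OF rep r] N by blast
  moreover have "\<forall>j<N. continuous_on {u..v} (\<theta> j)" using l N by (simp add: lifts_eigsp_def)
  ultimately show "of_int (lift_index N u v \<theta>) = \<mu> (c v) - \<mu> (c u)"
    unfolding lift_index_def by (intro index_potentialD[OF pot uv c])
qed

text \<open>An edge along which the multiplicity of eigenvalue 1 is constant does not
  contribute.\<close>

lemma potential_const_kernel:
  fixes T :: "'p::real_normed_vector set" and \<mu> :: "'p \<Rightarrow> real" and u v :: real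
  assumes pot: "index_potential T N a \<mu>"
    and lsc: "lsc_args T N a" and uv: "u \<le> v" and c: "continuous_on {u..v} c" "c ` {u..v} \<subseteq> T"
    and ker: "\<And>s. s \<in> {u..v} \<Longrightarrow> card {j. j < N \<and> cis (a (c s) j) = 1} = m"
  shows "\<mu> (c v) = \<mu> (c u)"
proof -
  obtain \<theta> where \<theta>: "\<forall>j<N. continuous_on {u..v} (\<theta> j)" "\<forall>s\<in>{u..v}. same_args N (\<lambda>j. \<theta> j s) (a (c s))"
    using global_lift[OF lsc_args_compose[OF lsc c] uv] by blast
  have k: "card {j. j < N \<and> cis (\<theta> j s) = 1} = m" if "s \<in> {u..v}" for s
    using same_args_card[of N "\<lambda>j. \<theta> j s" "a (c s)" "\<lambda>z. z = 1"] \<theta>(2) ker[OF that] that by simp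
  have "ceil_sum N (\<lambda>j. \<theta> j v) = ceil_sum N (\<lambda>j. \<theta> j u)"
    by (rule ceil_sum_const_kernel[OF uv _ k]) (use \<theta>(1) in blast)
  moreover have "of_int (ceil_sum N (\<lambda>j. \<theta> j v) - ceil_sum N (\<lambda>j. \<theta> j u)) = \<mu> (c v) - \<mu> (c u)"
    by (rule index_potentialD[OF pot uv c \<theta>])
  ultimately show ?thesis by simp
qed

text \<open>Use the rectangle whose first coordinate deforms the splitting, from X at 0 to Y at 1,
  and whose second is time. The two time edges give the two indices. On the other two edges the
  multiplicity of 1 is the dimension of the fixed space \<open>\<Lambda> s \<inter> M\<close>, so
  the potential agrees at their end points.\<close>

theorem lift_index_splitting_independent:
  fixes h :: "'a::complex_normed_vector \<Rightarrow> 'a \<Rightarrow> complex" and Z :: "'z::complex_normed_vector set"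
  assumes h: "herm h" and fd: "cfd (UNIV :: 'a set)" and X: "splitting h Xm Xp" and Y: "splitting h Ym Yp" and ab: "a \<le> b"
    and \<Lambda>: "\<And>s. s \<in> {a..b} \<Longrightarrow> lagrangian h (\<Lambda> s)" "cont_frame {a..b} \<Lambda> Z G" and M: "lagrangian h M"
    and l: "lifts_eigsp Xm Xp a b \<Lambda> M N \<theta>" "lifts_eigsp Ym Yp a b \<Lambda> M N' \<theta>'"
  shows "lift_index N a b \<theta> = lift_index N' a b \<theta>'"
proof -
  define T where "T = {0..1::real} \<times> {a..b}"
  define D where "D r = squeeze Xm Xp 1 r" for r
  define D' where "D' r = squeeze Xm Xp r 1" for r
  have cl: "clinear (D r)" "clinear (D' r)" for r unfolding D_def D'_def by (rule clinear_squeeze[OF h X])+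
  have sp: "splitting h (D r ` Ym) (D' r ` Yp)" if "r \<in> {0..1}" for r
    unfolding D_def D'_def by (rule splitting_homotopy(1)[OF h fd X Y]) (use that in auto)
  have inj: "y \<in> Ym \<Longrightarrow> D r y = 0 \<Longrightarrow> y = 0" "y \<in> Yp \<Longrightarrow> D' r y = 0 \<Longrightarrow> y = 0" if "r \<in> {0..1}" for r y
    unfolding D_def D'_def using splitting_homotopy(2,3)[OF h fd X Y, of r y] that by auto
  have sub: "csubspace M" using M by (simp add: lagrangian_def)
  have cf: "cfd S" for S :: "'a set" by (rule cfd_mono[OF fd subset_UNIV])
  have sY: "csubspace Ym" "csubspace Yp" by (rule splitting_subspaces[OF h Y])+
  have fst: "continuous_on U fst" and snd: "continuous_on U snd" for U :: "(real \<times> real) set"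
    by (intro continuous_intros)+
  have frD: "cont_frame T (\<lambda>p. D (fst p) ` Ym) Ym (\<lambda>p. D (fst p))" "cont_frame T (\<lambda>p. D' (fst p) ` Yp) Yp (\<lambda>p. D' (fst p))"
    unfolding cont_frame_def using sY cf cl inj
    by (auto simp: T_def D_def D'_def squeeze_def intro!: continuous_intros)
  have frL: "cont_frame T (\<lambda>p. \<Lambda> (snd p)) Z (\<lambda>p. G (snd p))"
    by (rule cont_frame_compose[OF \<Lambda>(2) snd]) (auto simp: T_def)
  have dimD: "cdim (D r ` Ym) = cdim Ym" if "r \<in> {0..1}" for r
    by (rule cdim_image_eq[OF fd cl(1) sY(1) inj(1)[OF that]])
  have "\<exists>c. represents_eigsp (D (fst p) ` Ym) (D' (fst p) ` Yp) (\<Lambda> (snd p)) M (cdim Ym) c" if p: "p \<in> T" for p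
  proof -
    have r: "fst p \<in> {0..1}" "snd p \<in> {a..b}" using p by (auto simp: T_def)
    show ?thesis
      using represents_eigsp_eigen_system[OF h sp[OF r(1)] fd \<Lambda>(1)[OF r(2)] M] unfolding dimD[OF r(1)] by blast
  qed
  then obtain c where c: "\<And>p. p \<in> T \<Longrightarrow>
    represents_eigsp (D (fst p) ` Ym) (D' (fst p) ` Yp) (\<Lambda> (snd p)) M (cdim Ym) (c p)" by metis
  have spT: "splitting h (D (fst p) ` Ym) (D' (fst p) ` Yp)" and lagT: "lagrangian h (\<Lambda> (snd p))" if "p \<in> T" for p
    using sp[of "fst p"] \<Lambda>(1)[of "snd p"] that by (auto simp: T_def)
  have lsc: "lsc_args T (cdim Ym) c"
    by (rule lsc_args_family[OF h fd spT lagT M frL cont_frame_const[OF sub cf] frD c])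
  have "convex T" unfolding T_def by (intro convex_Times) auto
  from index_potential_exists[OF lsc this] obtain \<mu> where pot: "index_potential T (cdim Ym) c \<mu>" by (elim exE)
  have D0: "D 0 x = proj Xm Xp x" "D' 0 x = x - proj Xm Xp x" "D 1 x = x" "D' 1 x = x" for x
    by (simp_all add: D_def D'_def squeeze_def scaleC_one)
  \<comment> \<open>At 0 the deforming maps are the two projections of the X splitting, so inclusion
    is clear and \<open>splitting_subset_eq\<close> does the rest.\<close>
  have "D 0 ` Ym \<subseteq> Xm" "D' 0 ` Yp \<subseteq> Xp" using proj_in[OF h X] proj_compl[OF h X] by (auto simp: D0)
  then have e0: "D 0 ` Ym = Xm" "D' 0 ` Yp = Xp" using splitting_subset_eq[OF h sp[of 0] X] by auto
  have e1: "D 1 ` Ym = Ym" "D' 1 ` Yp = Yp" by (auto simp: D0)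
  have edge: "continuous_on {a..b} (\<lambda>s. (r, s))" "(\<lambda>s. (r, s)) ` {a..b} \<subseteq> T" if "r \<in> {0..1}" for r
    using that by (auto simp: T_def intro!: continuous_intros)
  have edge': "continuous_on {0..1} (\<lambda>r. (r, s))" "(\<lambda>r. (r, s)) ` {0..1} \<subseteq> T" if "s \<in> {a..b}" for s
    using that by (auto simp: T_def intro!: continuous_intros)
  have r0: "represents_eigsp Xm Xp (\<Lambda> s) M (cdim Ym) (c (0, s))" and r1: "represents_eigsp Ym Yp (\<Lambda> s) M (cdim Ym) (c (1, s))"
    if "s \<in> {a..b}" for s
    using c[of "(0, s)"] c[of "(1, s)"] that by (simp_all add: T_def e0 e1)
  have k0: "N = cdim Ym" "of_int (lift_index (cdim Ym) a b \<theta>) = \<mu> (0, b) - \<mu> (0, a)"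
    using lift_index_potential[OF pot ab edge[of 0] l(1) r0] by auto
  have k1: "N' = cdim Ym" "of_int (lift_index (cdim Ym) a b \<theta>') = \<mu> (1, b) - \<mu> (1, a)"
    using lift_index_potential[OF pot ab edge[of 1] l(2) r1] by auto
  have vert: "\<mu> (1, s) = \<mu> (0, s)" if s: "s \<in> {a..b}" for s
  proof -
    have "card {j. j < cdim Ym \<and> cis (c (r, s) j) = 1} = cdim (\<Lambda> s \<inter> M)" if r: "r \<in> {0..1}" for r
    proof -
      have "represents_eigsp (D r ` Ym) (D' r ` Yp) (\<Lambda> s) M (cdim Ym) (c (r, s))" using c[of "(r, s)"] r s by (simp add: T_def)
      then show ?thesis unfolding represents_eigsp_def using eigsp_one_dim[OF h sp[OF r] fd \<Lambda>(1)[OF s] M] by simp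
    qed
    from potential_const_kernel[OF pot lsc zero_le_one edge'[OF s] this] show ?thesis by simp
  qed
  have "real_of_int (lift_index N a b \<theta>) = real_of_int (lift_index N' a b \<theta>')"
    using k0 k1 vert[of a] vert[of b] ab by simp
  then show ?thesis by simp
qed

section \<open>The Maslov index\<close>

text \<open>Multiplication by - \<i> turns the skew-Hermitian form into a Hermitian one. The sign is
  such that eigenvectors of \<i> J with positive eigenvalue, which span \<open>Xminus J\<close>, are
  negative vectors.\<close>

definition krein :: "('a::complex_normed_vector \<Rightarrow> 'a \<Rightarrow> complex) \<Rightarrow> 'a \<Rightarrow> 'a \<Rightarrow> complex" where
  "krein \<Omega> x y = - \<i> * \<Omega> x y"

lemma symplectic_formD:
  assumes "symplectic_form \<Omega>"
  shows "\<Omega> (x + x') y = \<Omega> x y + \<Omega> x' y" "\<Omega> (c *\<^sub>C x) y = c * \<Omega> x y" "\<Omega> y x = - cnj (\<Omega> x y)"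
    "(\<And>y. \<Omega> x y = 0) \<Longrightarrow> x = 0"
proof -
  note d = assms[unfolded symplectic_form_def]
  show "\<Omega> (x + x') y = \<Omega> x y + \<Omega> x' y" by (rule d[THEN conjunct1, THEN spec, THEN spec, THEN spec])
  show "\<Omega> (c *\<^sub>C x) y = c * \<Omega> x y" by (rule d[THEN conjunct2, THEN conjunct1, THEN spec, THEN spec, THEN spec])
  show "\<Omega> y x = - cnj (\<Omega> x y)" by (rule d[THEN conjunct2, THEN conjunct2, THEN conjunct1, THEN spec, THEN spec])
  show "(\<And>y. \<Omega> x y = 0) \<Longrightarrow> x = 0" using d[THEN conjunct2, THEN conjunct2, THEN conjunct2] by blast
qed

lemma herm_krein:
  assumes "symplectic_form \<Omega>" shows "herm (krein \<Omega>)"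
proof (rule hermI)
  show "krein \<Omega> (x + x') y = krein \<Omega> x y + krein \<Omega> x' y" for x x' y
    by (simp add: krein_def symplectic_formD(1)[OF assms] algebra_simps)
  show "krein \<Omega> (c *\<^sub>C x) y = c * krein \<Omega> x y" for c x y
    by (simp add: krein_def symplectic_formD(2)[OF assms])
  show "krein \<Omega> y x = cnj (krein \<Omega> x y)" for x y
    using symplectic_formD(3)[OF assms, of y x] by (simp add: krein_def)
qed

lemma lagrangian_krein: "lagrangian (krein \<Omega>) L \<longleftrightarrow> lagrangian \<Omega> L"
  by (simp add: lagrangian_def krein_def)

text \<open>Eigenvectors for different real eigenvalues are orthogonal, so the span of one sign
  consists of the vectors without coordinates along basis vectors of the other sign. The factor
  \<sigma> = 1 or -1 covers \<open>Xminus\<close> and \<open>Xplus\<close> together.\<close>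

lemma eigen_span_coordinates:
  fixes ip :: "'a::complex_normed_vector \<Rightarrow> 'a \<Rightarrow> complex" and \<sigma> :: real
  assumes ip: "sesq ip" and on: "orthonormal ip n x" and exp: "\<And>y. y = (\<Sum>j<n. ip y (x j) *\<^sub>C x j)"
    and P: "\<And>j. j < n \<Longrightarrow> P (x j) = complex_of_real (d j) *\<^sub>C x j" and d0: "\<And>j. j < n \<Longrightarrow> d j \<noteq> 0"
    and adj: "\<And>y z. ip (P y) z = ip y (P z)"
    and \<sigma>: "\<sigma> \<noteq> 0"
  shows "cspan {y. \<exists>c::real. 0 < \<sigma> * c \<and> P y = complex_of_real c *\<^sub>C y} = {y. \<forall>j<n. \<sigma> * d j < 0 \<longrightarrow> ip y (x j) = 0}"
    (is "cspan ?E = ?S")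
proof (rule subset_antisym)
  have "csubspace ?S" by (rule csubspaceI) (simp_all add: sesq_zero1[OF ip] sesq_add1[OF ip] sesq_scale1[OF ip])
  moreover have "?E \<subseteq> ?S"
  proof
    fix y assume "y \<in> ?E"
    then obtain c where c: "0 < \<sigma> * c" "P y = complex_of_real c *\<^sub>C y" by blast
    have "ip y (x j) = 0" if j: "j < n" "\<sigma> * d j < 0" for j
    proof -
      have "complex_of_real c * ip y (x j) = ip (P y) (x j)" unfolding c(2) by (simp add: sesq_scale1[OF ip])
      also have "\<dots> = complex_of_real (d j) * ip y (x j)" unfolding adj P[OF j(1)] by (simp add: sesq_scale2[OF ip])
      finally have "complex_of_real c * ip y (x j) = complex_of_real (d j) * ip y (x j)" .
      moreover have "c \<noteq> d j" using c(1) j(2) by auto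
      ultimately show ?thesis by simp
    qed
    then show "y \<in> ?S" by blast
  qed
  ultimately show "cspan ?E \<subseteq> ?S" by (rule complex_vector.span_minimal[rotated])
  show "?S \<subseteq> cspan ?E"
  proof
    fix y assume y: "y \<in> ?S"
    have "ip y (x j) *\<^sub>C x j \<in> cspan ?E" if j: "j < n" for j
    proof (cases "\<sigma> * d j < 0")
      case True
      then have "ip y (x j) = 0" using y j by blast
      then show ?thesis by (simp add: complex_vector.span_zero)
    next
      case False
      then have "0 < \<sigma> * d j" using d0[OF j] \<sigma> by (metis linorder_neqE_linordered_idom mult_eq_0_iff)
      then have "x j \<in> ?E" using P[OF j] by blast
      then show ?thesis by (intro complex_vector.span_scale complex_vector.span_base)
    qed
    then have "(\<Sum>j<n. ip y (x j) *\<^sub>C x j) \<in> cspan ?E" by (intro complex_vector.span_sum) auto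
    then show "y \<in> cspan ?E" using exp[of y] by metis
  qed
qed

text \<open>The operator \<i> J is self-adjoint for the inner product. In coordinates of an
  orthonormal eigenbasis the form becomes - (sum of d j times |y j|^2), with real and nonzero d j,
  and everything can be read off from their signs.\<close>

lemma splitting_of_J:
  fixes \<Omega> ip :: "'a::complex_normed_vector \<Rightarrow> 'a \<Rightarrow> complex"
  assumes \<Omega>: "symplectic_form \<Omega>" and fd: "cfd (UNIV :: 'a set)" and ip: "inner_product ip"
    and J: "clinear J" "bij J" and OJ: "\<And>x y. \<Omega> x y = ip (J x) y"
  shows "splitting (krein \<Omega>) (Xminus J) (Xplus J)"
proof -
  have hip: "herm ip" using ip unfolding inner_product_def herm_def by (intro conjI) blast+
  have sip: "sesq ip" by (rule herm_imp_sesq[OF hip])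
  have pos: "0 < Re (ip y y)" if "y \<noteq> 0" for y using ip that unfolding inner_product_def by blast
  have hk: "herm (krein \<Omega>)" by (rule herm_krein[OF \<Omega>])
  have sk: "sesq (krein \<Omega>)" by (rule herm_imp_sesq[OF hk])
  define P where "P x = \<i> *\<^sub>C J x" for x
  have P: "clinear P" unfolding P_def
    by (rule clinearI) (simp_all add: clin_add[OF J(1)] clin_scale[OF J(1)] scaleC_add_right scaleC_scaleC mult.commute)
  have kP: "krein \<Omega> x y = - ip (P x) y" for x y by (simp add: krein_def P_def OJ sesq_scale1[OF sip])
  have adj: "ip (P y) z = ip y (P z)" for y z
    using herm_sym[OF hk, of y z] herm_sym[OF hip, of y "P z"] kP[of y z] kP[of z y] by simp
  have UN: "csubspace (UNIV :: 'a set)" by (rule csubspaceI) auto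
  let ?n = "cdim (UNIV :: 'a set)"
  have "\<exists>x c. (\<forall>j<?n. x j \<in> UNIV \<and> P (x j) = c j *\<^sub>C x j) \<and> orthonormal ip ?n x \<and>
    (\<forall>y\<in>UNIV. y = (\<Sum>j<?n. ip y (x j) *\<^sub>C x j))"
  proof (rule spectral_theorem[OF UN fd hip])
    show "0 < Re (ip y y)" if "y \<noteq> 0" for y by (rule pos[OF that])
    show "clinear P" by (rule P)
    show "P y \<in> UNIV" for y by simp
    show "ip (P y) x = 0" if "P x = c *\<^sub>C x" "ip y x = 0" for x y c
      unfolding adj that(1) sesq_scale2[OF sip] that(2) by simp
  qed
  then obtain x c where x: "\<And>j. j < ?n \<Longrightarrow> P (x j) = c j *\<^sub>C x j" and on: "orthonormal ip ?n x"
    and exp: "\<And>y. y = (\<Sum>j<?n. ip y (x j) *\<^sub>C x j)" by blast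
  define d where "d j = Re (c j)" for j
  have on1: "ip (x j) (x j) = 1" if "j < ?n" for j using on that unfolding orthonormal_def by simp
  \<comment> \<open>The eigenvalue is real because it equals minus the value of a Hermitian form on
    the diagonal.\<close>
  have cd: "c j = complex_of_real (d j)" if "j < ?n" for j
  proof -
    have "c j = ip (P (x j)) (x j)" unfolding x[OF that] sesq_scale1[OF sip] on1[OF that] by simp
    also have "\<dots> = - krein \<Omega> (x j) (x j)" by (simp add: kP)
    finally have "c j = - krein \<Omega> (x j) (x j)" .
    moreover have "Im (krein \<Omega> (x j) (x j)) = 0" by (subst herm_real[OF hk]) (rule Im_complex_of_real)
    ultimately have "Im (c j) = 0" by simp
    then show ?thesis by (simp add: d_def complex_eq_iff)
  qed
  have Px: "P (x j) = complex_of_real (d j) *\<^sub>C x j" if "j < ?n" for j using x[OF that] cd[OF that] by simp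
  have d0: "d j \<noteq> 0" if "j < ?n" for j
  proof
    assume "d j = 0"
    then have "\<i> *\<^sub>C J (x j) = 0" using Px[OF that] by (simp add: P_def)
    then have "J (x j) = 0" by (simp add: complex_vector.scale_eq_0_iff)
    then have "x j = 0" using J clin_zero[OF J(1)] by (metis bij_pointE)
    then show False using on1[OF that] sesq_zero1[OF sip, of 0] by simp
  qed
  note span = eigen_span_coordinates[OF sip on exp Px d0 adj]
  have Xm: "Xminus J = {y. \<forall>j<?n. d j < 0 \<longrightarrow> ip y (x j) = 0}"
    using span[of 1] by (simp add: Xminus_def P_def)
  have Xp: "Xplus J = {y. \<forall>j<?n. 0 < d j \<longrightarrow> ip y (x j) = 0}"
    using span[of "-1"] by (simp add: Xplus_def P_def)
  have form: "krein \<Omega> y z = - (\<Sum>j<?n. complex_of_real (d j) * ip y (x j) * cnj (ip z (x j)))" for y z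
  proof -
    have "P y = (\<Sum>j<?n. (ip y (x j) * complex_of_real (d j)) *\<^sub>C x j)"
    proof -
      have "P y = P (\<Sum>j<?n. ip y (x j) *\<^sub>C x j)" using exp[of y] by metis
      also have "\<dots> = (\<Sum>j<?n. ip y (x j) *\<^sub>C P (x j))" by (rule clin_comb[OF P])
      also have "\<dots> = (\<Sum>j<?n. (ip y (x j) * complex_of_real (d j)) *\<^sub>C x j)"
        by (intro sum.cong) (simp_all add: Px scaleC_scaleC)
      finally show ?thesis .
    qed
    then have "ip (P y) z = ip (\<Sum>j<?n. (ip y (x j) * complex_of_real (d j)) *\<^sub>C x j) (\<Sum>j<?n. ip z (x j) *\<^sub>C x j)"
      using exp[of z] by metis
    also have "\<dots> = (\<Sum>j<?n. (ip y (x j) * complex_of_real (d j)) * cnj (ip z (x j)))"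
      by (rule orthonormal_form[OF sip on order_refl])
    finally show ?thesis by (simp add: kP mult_ac)
  qed
  have form1: "Re (krein \<Omega> y y) = - (\<Sum>j<?n. d j * (cmod (ip y (x j)))\<^sup>2)" for y
    unfolding form by (simp only: mult.assoc complex_norm_square[symmetric] Re_sum uminus_complex.sel of_real_mult[symmetric] Re_complex_of_real)
  have nz: "\<exists>j<?n. ip y (x j) \<noteq> 0" if "y \<noteq> 0" for y
  proof (rule ccontr)
    assume "\<not> (\<exists>j<?n. ip y (x j) \<noteq> 0)"
    then have "(\<Sum>j<?n. ip y (x j) *\<^sub>C x j) = 0" by simp
    then show False using exp[of y] that by metis
  qed
  show ?thesis unfolding splitting_def
  proof (intro conjI ballI impI)
    show "csubspace (Xminus J)" "csubspace (Xplus J)" by (simp_all add: Xminus_def Xplus_def complex_vector.subspace_span)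
    fix y assume y: "y \<in> Xminus J"
    show "Re (krein \<Omega> y y) < 0" if y0: "y \<noteq> 0"
    proof -
      obtain j where j: "j < ?n" "ip y (x j) \<noteq> 0" using nz[OF y0] by blast
      have ge: "0 \<le> d i * (cmod (ip y (x i)))\<^sup>2" if "i < ?n" for i
        using y that unfolding Xm by (cases "d i < 0") auto
      have "\<not> d j < 0" using y j unfolding Xm by auto
      then have "0 < d j" using d0[OF j(1)] by simp
      then have "0 < (\<Sum>j<?n. d j * (cmod (ip y (x j)))\<^sup>2)" using j ge by (intro sum_pos2[of _ j]) auto
      then show ?thesis unfolding form1 by simp
    qed
    fix z assume z: "z \<in> Xplus J"
    show "krein \<Omega> y z = 0" unfolding form
    proof (simp, intro sum.neutral ballI)
      fix j assume j: "j \<in> {..<?n}"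
      show "complex_of_real (d j) * ip y (x j) * cnj (ip z (x j)) = 0"
        using y z j unfolding Xm Xp by (cases "d j" "0::real" rule: linorder_cases) auto
    qed
  next
    fix y assume y: "y \<in> Xplus J" and y0: "y \<noteq> 0"
    obtain j where j: "j < ?n" "ip y (x j) \<noteq> 0" using nz[OF y0] by blast
    have ge: "0 \<le> - d i * (cmod (ip y (x i)))\<^sup>2" if "i < ?n" for i
      using y that unfolding Xp by (cases "0 < d i") (auto simp: mult_nonpos_nonneg)
    have "\<not> 0 < d j" using y j unfolding Xp by auto
    then have "d j < 0" using d0[OF j(1)] by simp
    then have "0 < (\<Sum>j<?n. - d j * (cmod (ip y (x j)))\<^sup>2)" using j ge by (intro sum_pos2[of _ j]) (auto simp: mult_neg_pos)
    then show "0 < Re (krein \<Omega> y y)" unfolding form1 by (simp add: sum_negf)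
  next
    have "y \<in> (\<lambda>(u, v). u + v) ` (Xminus J \<times> Xplus J)" for y
    proof -
      define A where "A = {j. j < ?n \<and> 0 < d j}"
      define u where "u = (\<Sum>j\<in>A. ip y (x j) *\<^sub>C x j)"
      define v where "v = (\<Sum>j\<in>{..<?n} - A. ip y (x j) *\<^sub>C x j)"
      have A: "A \<subseteq> {..<?n}" by (auto simp: A_def)
      have "u \<in> Xminus J" unfolding Xm u_def
        using orthonormal_coeff[OF sip on A] by (auto simp: A_def)
      moreover have "v \<in> Xplus J" unfolding Xp v_def
        using orthonormal_coeff[OF sip on, of "{..<?n} - A"] by (auto simp: A_def)
      moreover have "y = u + v"
      proof -
        have "u + v = (\<Sum>j<?n. ip y (x j) *\<^sub>C x j)"
          unfolding u_def v_def using sum.subset_diff[OF A finite_lessThan, of "\<lambda>j. ip y (x j) *\<^sub>C x j"] by (simp add: add.commute)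
        then show ?thesis using exp[of y] by metis
      qed
      ultimately show ?thesis by (intro image_eqI[of _ _ "(u, v)"]) auto
    qed
    then show "(\<lambda>(u, v). u + v) ` (Xminus J \<times> Xplus J) = UNIV" by blast
  qed
qed

text \<open>Take the inner product for which a basis is orthonormal and let the coordinates of J x
  be the numbers \<Omega> x b. Non-degeneracy makes \<open>J\<close> injective, hence
  bijective.\<close>

lemma inner_product_exists:
  fixes \<Omega> :: "'a::complex_normed_vector \<Rightarrow> 'a \<Rightarrow> complex"
  assumes \<Omega>: "symplectic_form \<Omega>" and fd: "cfd (UNIV :: 'a set)"
  shows "\<exists>ip J. inner_product ip \<and> clinear J \<and> bij J \<and> (\<forall>x y. \<Omega> x y = ip (J x) y)"
proof -
  have UN: "csubspace (UNIV :: 'a set)" by (rule csubspaceI) auto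
  obtain B :: "'a set" and r C where "coordinate_system UNIV B r C" using cfd_coordinates[OF UN fd] by blast
  note co = coordinate_systemD[OF this]
  have expand: "x = (\<Sum>b\<in>B. r b x *\<^sub>C b)" for x by (rule co(3)) simp
  have uniq: "r b (\<Sum>b\<in>B. c b *\<^sub>C b) = c b" if "b \<in> B" for b c
  proof -
    let ?x = "\<Sum>b\<in>B. c b *\<^sub>C b"
    have "(\<Sum>b\<in>B. (r b ?x - c b) *\<^sub>C b) = (\<Sum>b\<in>B. r b ?x *\<^sub>C b) - ?x"
      by (simp add: complex_vector.scale_left_diff_distrib sum_subtractf)
    also have "\<dots> = 0" using expand[of ?x] by simp
    finally have "\<forall>b\<in>B. r b ?x - c b = 0" by (rule co(5))
    then show ?thesis using that by simp
  qed
  have radd: "r b (x + y) = r b x + r b y" if "b \<in> B" for b x y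
  proof -
    have "x + y = (\<Sum>b\<in>B. (r b x + r b y) *\<^sub>C b)"
      using expand[of x] expand[of y] by (simp add: scaleC_add_left sum.distrib)
    then show ?thesis using uniq[OF that, of "\<lambda>b. r b x + r b y"] by simp
  qed
  have rscale: "r b (c *\<^sub>C x) = c * r b x" if "b \<in> B" for b x c
  proof -
    have "c *\<^sub>C x = c *\<^sub>C (\<Sum>b\<in>B. r b x *\<^sub>C b)" using expand[of x] by simp
    also have "\<dots> = (\<Sum>b\<in>B. (c * r b x) *\<^sub>C b)" by (simp add: complex_vector.scale_sum_right scaleC_scaleC)
    finally show ?thesis using uniq[OF that, of "\<lambda>b. c * r b x"] by simp
  qed
  define ip where "ip x y = (\<Sum>b\<in>B. r b x * cnj (r b y))" for x y
  have "inner_product ip" unfolding inner_product_def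
  proof (intro conjI allI impI)
    show "ip (x + x') y = ip x y + ip x' y" for x x' y by (simp add: ip_def radd sum.distrib algebra_simps)
    show "ip (c *\<^sub>C x) y = c * ip x y" for c x y by (simp add: ip_def rscale sum_distrib_left mult.assoc)
    show "ip y x = cnj (ip x y)" for x y by (simp add: ip_def mult.commute)
    show "0 < Re (ip x x)" if "x \<noteq> 0" for x
    proof -
      have "\<exists>b\<in>B. r b x \<noteq> 0"
      proof (rule ccontr)
        assume "\<not> (\<exists>b\<in>B. r b x \<noteq> 0)"
        then have "(\<Sum>b\<in>B. r b x *\<^sub>C b) = 0" by simp
        then show False using expand[of x] that by metis
      qed
      then obtain b where b: "b \<in> B" "r b x \<noteq> 0" by blast
      have "Re (ip x x) = (\<Sum>b\<in>B. (cmod (r b x))\<^sup>2)"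
        by (simp only: ip_def complex_norm_square[symmetric] Re_sum Re_complex_of_real)
      also have "\<dots> > 0" using co(1) b by (intro sum_pos2[of _ b]) auto
      finally show ?thesis .
    qed
  qed
  moreover define J where "J x = (\<Sum>b\<in>B. \<Omega> x b *\<^sub>C b)" for x
  note \<Omega>1 = symplectic_formD[OF \<Omega>]
  have J: "clinear J"
    by (rule clinearI) (simp_all add: J_def \<Omega>1(1,2) scaleC_add_left sum.distrib complex_vector.scale_sum_right scaleC_scaleC)
  have sk: "sesq (krein \<Omega>)" by (rule herm_imp_sesq[OF herm_krein[OF \<Omega>]])
  have OJ: "\<Omega> x y = ip (J x) y" for x y
  proof -
    have "krein \<Omega> x y = krein \<Omega> x (\<Sum>b\<in>B. r b y *\<^sub>C b)" using expand[of y] by metis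
    also have "\<dots> = (\<Sum>b\<in>B. cnj (r b y) * krein \<Omega> x b)" by (rule sesq_comb2[OF sk])
    finally have "\<i> * krein \<Omega> x y = (\<Sum>b\<in>B. \<Omega> x b * cnj (r b y))"
      by (simp add: krein_def sum_distrib_left mult_ac)
    moreover have "ip (J x) y = (\<Sum>b\<in>B. \<Omega> x b * cnj (r b y))"
      unfolding ip_def J_def using uniq[of _ "\<lambda>b. \<Omega> x b"] by (intro sum.cong) auto
    ultimately show ?thesis by (simp add: krein_def)
  qed
  have inj0: "x = 0" if "J x = 0" for x
  proof -
    have "\<Omega> x y = 0" for y unfolding OJ that ip_def using rscale[of _ 0 0] by simp
    then show ?thesis by (rule \<Omega>1(4))
  qed
  have "bij J"
  proof (rule bijI)
    show "surj J" by (rule clinear_inj_imp_surj[OF fd J inj0])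
    show "inj J"
    proof (rule injI)
      fix x y assume "J x = J y"
      then have "J (x - y) = 0" by (simp add: clin_diff[OF J])
      then show "x = y" using inj0[of "x - y"] by simp
    qed
  qed
  with J OJ \<open>inner_product ip\<close> show ?thesis by blast
qed

text \<open>The graph map of \<open>M\<close> is injective on \<open>Xminus J\<close>, its left
  inverse being the graph map for the swapped splitting, so \<open>inv_into\<close> really inverts
  it.\<close>

lemma relative_op_eigenspace:
  fixes h :: "'a::complex_normed_vector \<Rightarrow> 'a \<Rightarrow> complex"
  assumes h: "herm h" and sp: "splitting h (Xminus J) (Xplus J)" and fd: "cfd (UNIV :: 'a set)"
    and L: "lagrangian h L" and M: "lagrangian h M"
  shows "{y \<in> Xplus J. relative_op J L M y = z *\<^sub>C y} = eigsp (Xminus J) (Xplus J) L M z"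
proof -
  let ?Fm = "Xminus J" and ?Fp = "Xplus J"
  note n = herm_neg[OF h] and sw = splitting_swap[OF h sp]
  have Mn: "lagrangian (\<lambda>x y. - h x y) M" using M by (simp add: lagrangian_neg)
  have g: "graph_op J L x = gmap ?Fm ?Fp L x" if "x \<in> ?Fm" for L x
    by (simp add: graph_op_def gmap_def proj_Fm[OF h sp that])
  have inv: "inv_into ?Fm (graph_op J M) y = x" if y: "y \<in> ?Fp" and x: "x \<in> ?Fm" "x + y \<in> M" for x y
  proof (rule inv_into_f_eq)
    show "inj_on (graph_op J M) ?Fm"
    proof (rule inj_onI)
      fix u v assume uv: "u \<in> ?Fm" "v \<in> ?Fm" "graph_op J M u = graph_op J M v"
      have "gmap ?Fp ?Fm M (gmap ?Fm ?Fp M u) = u" if "u \<in> ?Fm" for u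
        by (rule gmap_eqI[OF n sw Mn fd gmap_in[OF h sp M fd] that])
          (use gmap_graph_Fm[OF h sp M fd that] in \<open>simp add: add.commute\<close>)
      then show "u = v" using uv by (simp add: g) metis
    qed
    show "x \<in> ?Fm" by (rule x)
    show "graph_op J M x = y" unfolding g[OF x(1)] by (rule gmap_eqI[OF h sp M fd x(1) y x(2)])
  qed
  have rel: "relative_op J L M y = z *\<^sub>C y \<longleftrightarrow> x + z *\<^sub>C y \<in> L" if y: "y \<in> ?Fp" and x: "x \<in> ?Fm" "x + y \<in> M" for x y
  proof -
    have "relative_op J L M y = gmap ?Fm ?Fp L x" by (simp add: relative_op_def inv[OF y x] g[OF x(1)])
    moreover have "gmap ?Fm ?Fp L x = z *\<^sub>C y \<longleftrightarrow> x + z *\<^sub>C y \<in> L"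
      using gmap_eqI[OF h sp L fd x(1), of "z *\<^sub>C y"] gmap_graph_Fm[OF h sp L fd x(1)]
        csubspace_scale[OF splitting_subspaces(2)[OF h sp] y, of z] by metis
    ultimately show ?thesis by simp
  qed
  have ex: "\<exists>x\<in>?Fm. x + y \<in> M" if "y \<in> ?Fp" for y
    using graph_exists[OF n sw Mn fd that] by (metis add.commute)
  show ?thesis unfolding eigsp_def using rel ex by blast
qed

text \<open>A Lagrangian provides an isomorphism between the two summands, which therefore have
  equal dimension.\<close>

lemma splitting_cdim:
  fixes h :: "'a::complex_normed_vector \<Rightarrow> 'a \<Rightarrow> complex"
  assumes h: "herm h" and sp: "splitting h Fm Fp" and fd: "cfd (UNIV :: 'a set)" and M: "lagrangian h M"
  shows "cdim (UNIV :: 'a set) = 2 * cdim Fm"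
proof -
  obtain B :: "'a set" where "finite_dimensional_vector_space scaleC B" by (rule cfd_finite_dimensional[OF fd])
  then interpret fd: finite_dimensional_vector_space scaleC B .
  note sub = splitting_subspaces[OF h sp]
  have "{x + y |x y. x \<in> Fm \<and> y \<in> Fp} = UNIV" using splitting_decomp[OF h sp] by blast
  moreover have "Fm \<inter> Fp = {0}"
    using splitting_Int[OF h sp] csubspace_0[OF sub(1)] csubspace_0[OF sub(2)] by blast
  moreover have "cdim {x + y |x y. x \<in> Fm \<and> y \<in> Fp} + cdim (Fm \<inter> Fp) = cdim Fm + cdim Fp"
    using fd.dim_sums_Int[of Fm Fp] sub by (simp add: cdim_def csubspace_def)
  moreover have "cdim {0::'a} = 0" using complex_vector.dim_eq_card_independent[OF complex_vector.independent_empty]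
      complex_vector.dim_span[of "{} :: 'a set"] by simp
  moreover have "cdim Fp = cdim Fm"
  proof -
    have "gmap Fm Fp M ` Fm = Fp"
    proof
      show "gmap Fm Fp M ` Fm \<subseteq> Fp" using gmap_in[OF h sp M fd] by blast
      show "Fp \<subseteq> gmap Fm Fp M ` Fm"
      proof
        fix y assume y: "y \<in> Fp"
        have "lagrangian (\<lambda>x y. - h x y) M" using M by (simp add: lagrangian_neg)
        from graph_exists[OF herm_neg[OF h] splitting_swap[OF h sp] this fd y]
        obtain x where x: "x \<in> Fm" "x + y \<in> M" by (metis add.commute)
        show "y \<in> gmap Fm Fp M ` Fm" using gmap_eqI[OF h sp M fd x(1) y x(2)] x(1) by (metis imageI)
      qed
    qed
    moreover have "cdim (gmap Fm Fp M ` Fm) = cdim Fm"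
    proof (rule cdim_image_eq[OF fd clinear_gmap[OF h sp M fd] sub(1)])
      fix x assume x: "x \<in> Fm" "gmap Fm Fp M x = 0"
      then have "x \<in> M" using gmap_graph_Fm[OF h sp M fd x(1)] by simp
      then show "x = 0" using lag_Fm[OF h sp M fd] x(1) by blast
    qed
    ultimately show ?thesis by simp
  qed
  ultimately show ?thesis by simp
qed

lemma eigen_arguments_lifts:
  fixes h :: "'a::complex_normed_vector \<Rightarrow> 'a \<Rightarrow> complex"
  assumes h: "herm h" and sp: "splitting h (Xminus J) (Xplus J)" and fd: "cfd (UNIV :: 'a set)"
    and \<Lambda>: "\<And>s. s \<in> {a..b} \<Longrightarrow> lagrangian h (\<Lambda> s)" and M: "lagrangian h M"
  shows "eigen_arguments J a b \<Lambda> (\<lambda>_. M) N \<theta> \<longleftrightarrow> lifts_eigsp (Xminus J) (Xplus J) a b \<Lambda> M N \<theta>"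
  unfolding eigen_arguments_def lifts_eigsp_def represents_eigsp_def
  using relative_op_eigenspace[OF h sp fd \<Lambda> M] by (simp add: cis_conv_exp)

text \<open>Independence of the splitting gives both halves of the definite description: one choice
  of inner product attains the value, and every choice yields the same one. From here on any
  splitting may be used for computing the index.\<close>

theorem maslov_index_eqI:
  fixes \<Omega> :: "'a::complex_normed_vector \<Rightarrow> 'a \<Rightarrow> complex" and Z :: "'z::complex_normed_vector set"
  assumes \<Omega>: "symplectic_form \<Omega>" and fd: "cfd (UNIV :: 'a set)" and sp: "splitting (krein \<Omega>) Fm Fp" and ab: "a \<le> b"
    and \<Lambda>: "\<And>s. s \<in> {a..b} \<Longrightarrow> lagrangian \<Omega> (\<Lambda> s)" "cont_frame {a..b} \<Lambda> Z G" and M: "lagrangian \<Omega> M"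
    and l: "lifts_eigsp Fm Fp a b \<Lambda> M N \<theta>"
  shows "maslov_index \<Omega> a b \<Lambda> (\<lambda>_. M) = lift_index N a b \<theta>"
  unfolding maslov_index_def
proof (rule the_equality)
  note h = herm_krein[OF \<Omega>]
  have \<Lambda>h: "lagrangian (krein \<Omega>) (\<Lambda> s)" if "s \<in> {a..b}" for s using \<Lambda>(1)[OF that] by (simp add: lagrangian_krein)
  have Mh: "lagrangian (krein \<Omega>) M" using M by (simp add: lagrangian_krein)
  have index: "lift_index N' a b \<theta>' = (\<Sum>j<N'. \<lceil>\<theta>' j b / (2 * pi)\<rceil> - \<lceil>\<theta>' j a / (2 * pi)\<rceil>)" for N' \<theta>'
    by (simp add: lift_index_def ceil_sum_def sum_subtractf)
  obtain ip J where J: "inner_product ip" "clinear J" "bij J" "\<And>x y. \<Omega> x y = ip (J x) y"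
    using inner_product_exists[OF \<Omega> fd] by blast
  have spJ: "splitting (krein \<Omega>) (Xminus J) (Xplus J)" by (rule splitting_of_J[OF \<Omega> fd J])
  obtain \<eta> where \<eta>: "lifts_eigsp (Xminus J) (Xplus J) a b \<Lambda> M (cdim (Xminus J)) \<eta>"
    using lifts_eigsp_exists[OF h fd spJ ab \<Lambda>h \<Lambda>(2) Mh] by blast
  show "\<exists>ip J N' \<eta>. inner_product ip \<and> clinear J \<and> bij J \<and> (\<forall>x y. \<Omega> x y = ip (J x) y) \<and>
     cdim (UNIV :: 'a set) = 2 * N' \<and> eigen_arguments J a b \<Lambda> (\<lambda>_. M) N' \<eta> \<and>
     lift_index N a b \<theta> = (\<Sum>j<N'. \<lceil>\<eta> j b / (2 * pi)\<rceil> - \<lceil>\<eta> j a / (2 * pi)\<rceil>)"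
  proof (intro exI conjI)
    show "inner_product ip" "clinear J" "bij J" "\<forall>x y. \<Omega> x y = ip (J x) y" using J by auto
    show "cdim (UNIV :: 'a set) = 2 * cdim (Xminus J)" by (rule splitting_cdim[OF h spJ fd Mh])
    show "eigen_arguments J a b \<Lambda> (\<lambda>_. M) (cdim (Xminus J)) \<eta>"
      using \<eta> by (subst eigen_arguments_lifts[OF h spJ fd \<Lambda>h Mh])
    show "lift_index N a b \<theta> = (\<Sum>j<cdim (Xminus J). \<lceil>\<eta> j b / (2 * pi)\<rceil> - \<lceil>\<eta> j a / (2 * pi)\<rceil>)"
      unfolding index[symmetric] by (rule lift_index_splitting_independent[OF h fd sp spJ ab \<Lambda>h \<Lambda>(2) Mh l \<eta>])
  qed
  fix k
  assume "\<exists>ip J N' \<eta>. inner_product ip \<and> clinear J \<and> bij J \<and> (\<forall>x y. \<Omega> x y = ip (J x) y) \<and>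
     cdim (UNIV :: 'a set) = 2 * N' \<and> eigen_arguments J a b \<Lambda> (\<lambda>_. M) N' \<eta> \<and>
     k = (\<Sum>j<N'. \<lceil>\<eta> j b / (2 * pi)\<rceil> - \<lceil>\<eta> j a / (2 * pi)\<rceil>)"
  then obtain ip J N' \<eta> where K: "inner_product ip" "clinear J" "bij J" "\<forall>x y. \<Omega> x y = ip (J x) y"
    "eigen_arguments J a b \<Lambda> (\<lambda>_. M) N' \<eta>" "k = lift_index N' a b \<eta>"
    unfolding index by blast
  have spJ: "splitting (krein \<Omega>) (Xminus J) (Xplus J)" by (rule splitting_of_J[OF \<Omega> fd K(1-3)]) (use K(4) in blast)
  have lJ: "lifts_eigsp (Xminus J) (Xplus J) a b \<Lambda> M N' \<eta>"
    using K(5) by (subst (asm) eigen_arguments_lifts[OF h spJ fd \<Lambda>h Mh])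
  show "k = lift_index N a b \<theta>" unfolding K(6)
    by (rule lift_index_splitting_independent[OF h fd spJ sp ab \<Lambda>h \<Lambda>(2) Mh lJ l])
qed

section \<open>Rotating one Lagrangian into another\<close>

lemma lagrangian_eq_graph:
  fixes h :: "'a::complex_normed_vector \<Rightarrow> 'a \<Rightarrow> complex"
  assumes h: "herm h" and sp: "splitting h Fm Fp" and fd: "cfd (UNIV :: 'a set)" and L: "lagrangian h L"
  shows "L = (\<lambda>x. x + gmap Fm Fp L x) ` Fm"
proof
  show "(\<lambda>x. x + gmap Fm Fp L x) ` Fm \<subseteq> L" using gmap_graph_Fm[OF h sp L fd] by blast
  show "L \<subseteq> (\<lambda>x. x + gmap Fm Fp L x) ` Fm"
  proof
    fix l assume l: "l \<in> L"
    have "gmap Fm Fp L l = l - proj Fm Fp l"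
      by (rule gmap_eq[OF h sp L fd proj_compl[OF h sp]]) (simp add: l)
    moreover have "gmap Fm Fp L (proj Fm Fp l) = l - proj Fm Fp l"
      by (rule gmap_eqI[OF h sp L fd proj_in[OF h sp] proj_compl[OF h sp]]) (simp add: l)
    ultimately show "l \<in> (\<lambda>x. x + gmap Fm Fp L x) ` Fm" using proj_in[OF h sp, of l]
      by (intro image_eqI[of _ _ "proj Fm Fp l"]) auto
  qed
qed

text \<open>For maximality write a vector orthogonal to the graph as u + V w with u and w in
  \<open>Fm\<close>. Orthogonality gives h (u - w) y = 0 for all y in \<open>Fm\<close>, so u = w by
  definiteness.\<close>

lemma graph_lagrangian:
  fixes h :: "'a::complex_normed_vector \<Rightarrow> 'a \<Rightarrow> complex"
  assumes h: "herm h" and sp: "splitting h Fm Fp" and V: "clinear V" "V ` Fm = Fp"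
    and iso: "\<And>x y. x \<in> Fm \<Longrightarrow> y \<in> Fm \<Longrightarrow> h (V x) (V y) = - h x y"
  shows "lagrangian h ((\<lambda>x. x + V x) ` Fm)"
proof -
  have sh: "sesq h" by (rule herm_imp_sesq[OF h])
  have VF: "V x \<in> Fp" if "x \<in> Fm" for x using V(2) that by blast
  have cl: "clinear (\<lambda>x. x + V x)"
    by (rule clinearI) (simp_all add: clin_add[OF V(1)] clin_scale[OF V(1)] scaleC_add_right)
  have iso0: "h (x + V x) (y + V y) = 0" if "x \<in> Fm" "y \<in> Fm" for x y
    using splitting_form[OF h sp that(1) VF[OF that(1)] that(2) VF[OF that(2)]] iso[OF that] by simp
  have "z \<in> (\<lambda>x. x + V x) ` Fm" if z: "\<And>y. y \<in> Fm \<Longrightarrow> h z (y + V y) = 0" for z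
  proof -
    let ?u = "proj Fm Fp z"
    have "z - ?u \<in> V ` Fm" using proj_compl[OF h sp] V(2) by simp
    then obtain w where w: "w \<in> Fm" "z - ?u = V w" by blast
    have zz: "z = ?u + V w" using w(2) by (simp add: algebra_simps)
    have uw: "?u - w \<in> Fm" by (rule csubspace_diff[OF splitting_subspaces(1)[OF h sp] proj_in[OF h sp] w(1)])
    have "h (?u - w) y = 0" if y: "y \<in> Fm" for y
    proof -
      have "0 = h (?u + V w) (y + V y)" using z[OF y] zz by simp
      also have "\<dots> = h ?u y - h w y"
        using splitting_form[OF h sp proj_in[OF h sp] VF[OF w(1)] y VF[OF y], of z] iso[OF w(1) y] by simp
      finally show ?thesis by (simp add: sesq_diff1[OF sh])
    qed
    then have "?u - w = 0" using splitting_neg[OF h sp uw] uw by fastforce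
    then show ?thesis using zz w(1) by (intro image_eqI[of _ _ w]) auto
  qed
  then show ?thesis unfolding lagrangian_def
    using csubspace_image[OF cl splitting_subspaces(1)[OF h sp]] iso0 by auto
qed

text \<open>The coordinates of v in the basis x are - h v (x j), as x is orthonormal for - h. The
  phase is negative because \<open>u j\<close> is \<open>cis (\<beta> j)\<close> times the image of
  \<open>x j\<close> under the graph map of \<open>W\<close>; so r = 0 gives \<open>D\<close> and r
  = 1 gives \<open>W\<close>.\<close>

definition rotation :: "('a::complex_normed_vector \<Rightarrow> 'a \<Rightarrow> complex) \<Rightarrow> nat \<Rightarrow> (nat \<Rightarrow> 'a) \<Rightarrow> (nat \<Rightarrow> 'a) \<Rightarrow>
    (nat \<Rightarrow> real) \<Rightarrow> real \<Rightarrow> 'a \<Rightarrow> 'a" where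
  "rotation h N x u \<beta> r v = (\<Sum>j<N. (cis (- r * \<beta> j) * - h v (x j)) *\<^sub>C u j)"

text \<open>The arguments \<beta> are a parameter: shifting them by multiples of
  \<open>2 * pi\<close> keeps both end points and changes the winding of the rotation between
  them.\<close>

locale lagrangian_rotation =
  fixes h :: "'a::complex_normed_vector \<Rightarrow> 'a \<Rightarrow> complex" and Fm Fp D W :: "'a set" and N :: nat
    and x :: "nat \<Rightarrow> 'a" and \<beta> :: "nat \<Rightarrow> real"
  assumes h: "herm h" and sp: "splitting h Fm Fp" and fd: "cfd (UNIV :: 'a set)"
    and D: "lagrangian h D" and W: "lagrangian h W" and es: "eigen_system h Fm Fp D W N x \<beta>"
begin

abbreviation "u j \<equiv> gmap Fm Fp D (x j)"
abbreviation "V \<equiv> rotation h N x u \<beta>"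
abbreviation "Wr r \<equiv> (\<lambda>v. v + V r v) ` Fm"

lemma sesq_h: "sesq h" by (rule herm_imp_sesq[OF h])

lemma eigenbasis: "j < N \<Longrightarrow> x j \<in> Fm" "orthonormal (\<lambda>x y. - h x y) N x"
  "y \<in> Fm \<Longrightarrow> \<exists>c. y = (\<Sum>j<N. c j *\<^sub>C x j)" "j < N \<Longrightarrow> u j = cis (\<beta> j) *\<^sub>C gmap Fm Fp W (x j)"
proof -
  note d = es[unfolded eigen_system_def]
  show "j < N \<Longrightarrow> x j \<in> Fm" using d[THEN conjunct1] by blast
  show "orthonormal (\<lambda>x y. - h x y) N x" by (rule d[THEN conjunct2, THEN conjunct1])
  show "y \<in> Fm \<Longrightarrow> \<exists>c. y = (\<Sum>j<N. c j *\<^sub>C x j)"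
    by (rule d[THEN conjunct2, THEN conjunct2, THEN conjunct1, THEN bspec])
  show "j < N \<Longrightarrow> u j = cis (\<beta> j) *\<^sub>C gmap Fm Fp W (x j)"
    using d[THEN conjunct2, THEN conjunct2, THEN conjunct2] by blast
qed

lemma image_basis: "orthonormal h N u" "u j \<in> Fp"
proof -
  show "orthonormal h N u" using eigenbasis(1,2) gmap_isometry[OF h sp D fd] by (simp add: orthonormal_def)
  show "u j \<in> Fp" by (rule gmap_in[OF h sp D fd])
qed

lemma eigenbasis_expansion: assumes "v \<in> Fm" shows "v = (\<Sum>j<N. - h v (x j) *\<^sub>C x j)"
proof -
  obtain c where c: "v = (\<Sum>j<N. c j *\<^sub>C x j)" using eigenbasis(3)[OF assms] by blast
  have "- h v (x i) = c i" if "i < N" for i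
    using orthonormal_coeff[OF herm_imp_sesq[OF herm_neg[OF h]] eigenbasis(2) order_refl that, of c] that unfolding c by simp
  then have "(\<Sum>j<N. - h v (x j) *\<^sub>C x j) = (\<Sum>j<N. c j *\<^sub>C x j)" by (intro sum.cong refl) (simp only: lessThan_iff)
  then show ?thesis using c by simp
qed

lemma clinear_V: "clinear (V r)"
proof (rule clinearI)
  show "V r (v + w) = V r v + V r w" for v w
    unfolding rotation_def
    by (simp only: sesq_add1[OF sesq_h] minus_add_distrib distrib_left scaleC_add_left sum.distrib)
  show "V r (c *\<^sub>C v) = c *\<^sub>C V r v" for c v
    unfolding rotation_def complex_vector.scale_sum_right scaleC_scaleC
    by (intro sum.cong refl arg_cong2[where f = scaleC]) (simp add: sesq_scale1[OF sesq_h])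
qed

lemma V_x: assumes "i < N" shows "V r (x i) = cis (- r * \<beta> i) *\<^sub>C u i"
proof -
  have "V r (x i) = (\<Sum>j<N. if j = i then cis (- r * \<beta> i) *\<^sub>C u i else 0)"
    unfolding rotation_def
  proof (rule sum.cong[OF refl])
    fix j assume "j \<in> {..<N}"
    then have "- h (x i) (x j) = (if i = j then 1 else 0)" using eigenbasis(2) assms unfolding orthonormal_def by simp
    then show "(cis (- r * \<beta> j) * - h (x i) (x j)) *\<^sub>C u j = (if j = i then cis (- r * \<beta> i) *\<^sub>C u i else 0)" by auto
  qed
  then show ?thesis using assms by simp
qed

lemma V_in: "V r v \<in> Fp"
  unfolding rotation_def
proof (rule csubspace_comb[OF splitting_subspaces(2)[OF h sp]])
  show "u j \<in> Fp" if "j \<in> {..<N}" for j using image_basis(2)[of j] that by simp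
qed

text \<open>Two stages of the rotation differ only by the phases \<open>(s - r) * \<beta> j\<close>,
  in one common basis for all stages.\<close>

lemma V_form: "h (V r v) (V s w) = (\<Sum>j<N. cis ((s - r) * \<beta> j) * (h v (x j) * cnj (h w (x j))))"
proof -
  have "h (V r v) (V s w) = (\<Sum>j<N. (cis (- r * \<beta> j) * - h v (x j)) * cnj (cis (- s * \<beta> j) * - h w (x j)))"
    unfolding rotation_def by (rule orthonormal_form[OF sesq_h image_basis(1) order_refl])
  also have "\<dots> = (\<Sum>j<N. cis ((s - r) * \<beta> j) * (h v (x j) * cnj (h w (x j))))"
  proof (rule sum.cong[OF refl])
    fix j
    have "cis ((s - r) * \<beta> j) = cis (- r * \<beta> j) * cnj (cis (- s * \<beta> j))"
      by (simp add: cis_cnj cis_mult algebra_simps)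
    then show "(cis (- r * \<beta> j) * - h v (x j)) * cnj (cis (- s * \<beta> j) * - h w (x j)) =
      cis ((s - r) * \<beta> j) * (h v (x j) * cnj (h w (x j)))" by simp
  qed
  finally show ?thesis .
qed

lemma form_expansion: assumes "v \<in> Fm" shows "h v w = - (\<Sum>j<N. h v (x j) * cnj (h w (x j)))"
proof -
  have "h v w = (\<Sum>j<N. - h v (x j) * h (x j) w)"
    using eigenbasis_expansion[OF assms] sesq_comb1[OF sesq_h, of "\<lambda>j. - h v (x j)" x "{..<N}" w] by metis
  also have "\<dots> = (\<Sum>j<N. - (h v (x j) * cnj (h w (x j))))"
  proof (rule sum.cong[OF refl])
    show "- h v (x j) * h (x j) w = - (h v (x j) * cnj (h w (x j)))" for j
      unfolding herm_sym[OF h, of "x j" w] by (rule mult_minus_left)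
  qed
  also have "\<dots> = - (\<Sum>j<N. h v (x j) * cnj (h w (x j)))" by (rule sum_negf)
  finally show ?thesis .
qed

lemma V_isometry: assumes "v \<in> Fm" "w \<in> Fm" shows "h (V r v) (V r w) = - h v w"
  unfolding V_form form_expansion[OF assms(1), of w] by (simp only: diff_self mult_zero_left cis_zero mult_1_left minus_minus)

lemma V_surj: "V r ` Fm = Fp"
proof
  show "V r ` Fm \<subseteq> Fp" using V_in by blast
  show "Fp \<subseteq> V r ` Fm"
  proof
    fix y assume y: "y \<in> Fp"
    have "lagrangian (\<lambda>x y. - h x y) D" using D by (simp add: lagrangian_neg)
    from graph_exists[OF herm_neg[OF h] splitting_swap[OF h sp] this fd y]
    obtain v where v: "v \<in> Fm" "v + y \<in> D" by (metis add.commute)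
    have "gmap Fm Fp D v = y" by (rule gmap_eqI[OF h sp D fd v(1) y v(2)])
    moreover obtain c where c: "v = (\<Sum>j<N. c j *\<^sub>C x j)" using eigenbasis(3)[OF v(1)] by blast
    ultimately have "y = (\<Sum>j<N. c j *\<^sub>C u j)" using clin_comb[OF clinear_gmap[OF h sp D fd], of c x "{..<N}"] by simp
    also have "\<dots> = (\<Sum>j<N. (c j * cis (r * \<beta> j)) *\<^sub>C V r (x j))"
      by (intro sum.cong) (simp_all add: V_x scaleC_scaleC mult.assoc cis_mult scaleC_one)
    also have "\<dots> = V r (\<Sum>j<N. (c j * cis (r * \<beta> j)) *\<^sub>C x j)" by (rule clin_comb[OF clinear_V, symmetric])
    finally show "y \<in> V r ` Fm"
      by (rule image_eqI) (intro csubspace_comb splitting_subspaces(1)[OF h sp], use eigenbasis(1) in simp)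
  qed
qed

lemma Wr_lagrangian: "lagrangian h (Wr r)"
proof (rule graph_lagrangian[OF h sp clinear_V V_surj])
  show "h (V r v) (V r w) = - h v w" if "v \<in> Fm" "w \<in> Fm" for v w by (rule V_isometry[OF that])
qed

lemma gmap_Wr: assumes "v \<in> Fm" shows "gmap Fm Fp (Wr r) v = V r v"
proof (rule gmap_eqI[OF h sp Wr_lagrangian fd assms V_in])
  show "v + V r v \<in> Wr r" using assms by (rule imageI)
qed

lemma V_eq_on_basis:
  assumes "clinear g" "\<And>j. j < N \<Longrightarrow> V r (x j) = g (x j)" "v \<in> Fm" shows "V r v = g v"
proof -
  obtain c where c: "v = (\<Sum>j<N. c j *\<^sub>C x j)" using eigenbasis(3)[OF assms(3)] by blast
  show ?thesis unfolding c clin_comb[OF clinear_V] clin_comb[OF assms(1)] using assms(2) by simp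
qed

lemma Wr_0: "Wr 0 = D"
proof -
  have "V 0 v = gmap Fm Fp D v" if "v \<in> Fm" for v
    by (rule V_eq_on_basis[OF clinear_gmap[OF h sp D fd] _ that]) (simp add: V_x scaleC_one)
  then have "Wr 0 = (\<lambda>v. v + gmap Fm Fp D v) ` Fm" by (intro image_cong) auto
  then show ?thesis using lagrangian_eq_graph[OF h sp fd D] by simp
qed

lemma Wr_1: "Wr 1 = W"
proof -
  have "V 1 v = gmap Fm Fp W v" if "v \<in> Fm" for v
    by (rule V_eq_on_basis[OF clinear_gmap[OF h sp W fd] _ that]) (simp add: V_x eigenbasis(4) scaleC_scaleC cis_mult scaleC_one)
  then have "Wr 1 = (\<lambda>v. v + gmap Fm Fp W v) ` Fm" by (intro image_cong) auto
  then show ?thesis using lagrangian_eq_graph[OF h sp fd W] by simp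
qed

lemma Wr_frame: "cont_frame (UNIV :: real set) Wr Fm (\<lambda>r v. v + V r v)"
proof -
  have "clinear (\<lambda>v. v + V r v)" for r
    by (rule clinearI) (simp_all add: clin_add[OF clinear_V] clin_scale[OF clinear_V] scaleC_add_right)
  moreover have "v = 0" if "v \<in> Fm" "v + V r v = 0" for r v
  proof -
    have "v = - V r v" using that(2) by (simp add: eq_neg_iff_add_eq_0)
    then have "v \<in> Fp" using complex_vector.subspace_neg[OF splitting_subspaces(2)[OF h sp] V_in[of r v]] by simp
    then show ?thesis using splitting_Int[OF h sp that(1)] by blast
  qed
  moreover have "continuous_on UNIV (\<lambda>r. v + V r v)" for v
    unfolding rotation_def by (intro continuous_intros)
  ultimately show ?thesis unfolding cont_frame_def
    by (intro conjI ballI impI splitting_subspaces(1)[OF h sp] cfd_mono[OF fd subset_UNIV] refl) blast+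
qed

text \<open>Seen from its starting point \<open>D\<close> the rotation has an explicit continuous
  lift; this evaluates the edge of the rectangle on which the path is at \<open>D\<close>.\<close>

lemma represents_D_Wr: "represents_eigsp Fm Fp D (Wr r) N (\<lambda>j. r * \<beta> j)"
proof -
  have "eigen_system h Fm Fp D (Wr r) N x (\<lambda>j. r * \<beta> j)"
    unfolding eigen_system_def
  proof (intro conjI ballI allI impI)
    show "x j \<in> Fm" if "j < N" for j by (rule eigenbasis(1)[OF that])
    show "orthonormal (\<lambda>x y. - h x y) N x" by (rule eigenbasis(2))
    show "\<exists>c. y = (\<Sum>j<N. c j *\<^sub>C x j)" if "y \<in> Fm" for y by (rule eigenbasis(3)[OF that])
    show "u j = cis (r * \<beta> j) *\<^sub>C gmap Fm Fp (Wr r) (x j)" if "j < N" for j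
      by (simp add: gmap_Wr[OF eigenbasis(1)[OF that]] V_x[OF that] scaleC_scaleC cis_mult scaleC_one)
  qed
  then show ?thesis unfolding represents_eigsp_def
    using eigsp_dim[OF h sp fd D Wr_lagrangian] by simp
qed

text \<open>Eigenvectors for eigenvalue 1 at \<open>r0\<close> are vectors on which the graph maps
  of \<open>L\<close> and \<open>Wr r0\<close> agree. On their span the pencil at \<open>r\<close>
  is therefore that of the rotation between \<open>r0\<close> and \<open>r\<close>, a positive
  combination of the phases \<open>cis ((r - r0) * \<beta> j)\<close>. If all these phases lie on an
  arc, the counting lemmas place at least as many eigenvalues at \<open>r\<close> on this arc: the
  open one from 0 to \<open>2 * \<psi>\<close> forwards, the closed one from
  \<open>- 2 * \<psi>\<close> to 0 backwards.\<close>

lemma crossing_count: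
  assumes L: "lagrangian h L" and a: "represents_eigsp Fm Fp L (Wr r0) N a" and a': "represents_eigsp Fm Fp L (Wr r) N a'"
  shows "(\<And>j. j < N \<Longrightarrow> 0 < (r - r0) * \<beta> j \<and> (r - r0) * \<beta> j < 2 * \<psi>) \<Longrightarrow> \<psi> < pi \<Longrightarrow>
      card {j. j < N \<and> cis (a j) = 1} \<le> card {j. j < N \<and> cos \<psi> < cos (a' j - \<psi>)}"
    and "(\<And>j. j < N \<Longrightarrow> - 2 * \<psi> \<le> (r - r0) * \<beta> j \<and> (r - r0) * \<beta> j \<le> 0) \<Longrightarrow> \<psi> < pi \<Longrightarrow> 0 < \<psi> \<Longrightarrow>
      card {j. j < N \<and> cis (a j) = 1} \<le> card {j. j < N \<and> cos \<psi> \<le> cos (a' j + \<psi>)}"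
proof -
  obtain y b where y: "eigen_system h Fm Fp L (Wr r0) N y b" "same_args N b a"
    using represents_eigsp_same(1)[OF h sp fd L Wr_lagrangian a] by blast
  obtain y' b' where y': "eigen_system h Fm Fp L (Wr r) N y' b'" "same_args N b' a'"
    using represents_eigsp_same(1)[OF h sp fd L Wr_lagrangian a'] by blast
  let ?U = "gmap Fm Fp L"
  define I where "I = {j. j < N \<and> cis (b j) = 1}"
  have I: "finite I" "\<And>i. i \<in> I \<Longrightarrow> i < N" by (auto simp: I_def)
  have cI: "card {j. j < N \<and> cis (a j) = 1} = card I"
    using same_args_card[OF y(2), of "\<lambda>z. z = 1"] by (simp add: I_def)
  have yF: "j < N \<Longrightarrow> y j \<in> Fm" and yo: "orthonormal (\<lambda>x y. - h x y) N y"
    and yU: "j < N \<Longrightarrow> ?U (y j) = cis (b j) *\<^sub>C V r0 (y j)" for j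
  proof -
    note d = y(1)[unfolded eigen_system_def]
    show yj: "y j \<in> Fm" if "j < N" for j using d[THEN conjunct1] that by blast
    show "orthonormal (\<lambda>x y. - h x y) N y" by (rule d[THEN conjunct2, THEN conjunct1])
    show "?U (y j) = cis (b j) *\<^sub>C V r0 (y j)" if "j < N"
      using d[THEN conjunct2, THEN conjunct2, THEN conjunct2] gmap_Wr[OF yj[OF that]] that by metis
  qed
  have y'F: "j < N \<Longrightarrow> y' j \<in> Fm" and y'o: "orthonormal (\<lambda>x y. - h x y) N y'"
    and y's: "v \<in> Fm \<Longrightarrow> \<exists>c. v = (\<Sum>j<N. c j *\<^sub>C y' j)"
    and y'U: "j < N \<Longrightarrow> ?U (y' j) = cis (b' j) *\<^sub>C V r (y' j)" for j v
  proof -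
    note d = y'(1)[unfolded eigen_system_def]
    show yj: "y' j \<in> Fm" if "j < N" for j using d[THEN conjunct1] that by blast
    show "orthonormal (\<lambda>x y. - h x y) N y'" by (rule d[THEN conjunct2, THEN conjunct1])
    show "\<exists>c. v = (\<Sum>j<N. c j *\<^sub>C y' j)" if "v \<in> Fm"
      using d[THEN conjunct2, THEN conjunct2, THEN conjunct1] that by (rule bspec)
    show "?U (y' j) = cis (b' j) *\<^sub>C V r (y' j)" if "j < N"
      using d[THEN conjunct2, THEN conjunct2, THEN conjunct2] gmap_Wr[OF yj[OF that]] that by metis
  qed
  define A where "A v w = h (?U v) (V r w)" for v w
  define B where "B v w = - h v w" for v w
  have A: "sesq A" unfolding A_def by (rule sesq_compose[OF sesq_h clinear_gmap[OF h sp L fd] clinear_V])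
  have B: "sesq B" unfolding B_def by (rule herm_imp_sesq[OF herm_neg[OF h]])
  have on: "orthonormal B N y'" using y'o unfolding orthonormal_def B_def .
  have diag: "cis_diagonal A N y' b'"
    unfolding cis_diagonal_def
  proof (intro allI impI)
    fix i j assume ij: "i < N" "j < N"
    have "A (y' i) (y' j) = cis (b' i) * - h (y' i) (y' j)"
      using ij by (simp add: A_def y'U sesq_scale1[OF sesq_h] V_isometry y'F)
    also have "- h (y' i) (y' j) = (if i = j then 1 else 0)" using y'o ij unfolding orthonormal_def by blast
    finally show "A (y' i) (y' j) = (if i = j then cis (b' i) else 0)" by simp
  qed
  have W: "\<exists>W. y i = (\<Sum>j<N. W j *\<^sub>C y' j)" if "i \<in> I" for i using y's[OF yF[OF I(2)[OF that]]] .
  let ?w = "\<lambda>c. \<Sum>i\<in>I. c i *\<^sub>C y i"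
  have wF: "?w c \<in> Fm" for c using I(2) yF by (intro csubspace_comb splitting_subspaces(1)[OF h sp]) auto
  have Bw: "Re (B (?w c) (?w c)) = (\<Sum>j<N. (cmod (h (?w c) (x j)))\<^sup>2)" for c
    unfolding B_def form_expansion[OF wF, of c "?w c"] by (simp only: minus_minus complex_norm_square[symmetric] Re_sum Re_complex_of_real)
  \<comment> \<open>On the span of the eigenvectors for 1 the map \<open>?U\<close> may be replaced
    by \<open>V r0\<close>, and \<open>V_form\<close> applies.\<close>
  have Aw: "Re (cis (- \<phi>) * A (?w c) (?w c)) = (\<Sum>j<N. cos ((r - r0) * \<beta> j - \<phi>) * (cmod (h (?w c) (x j)))\<^sup>2)" for c \<phi>
  proof -
    have "?U (?w c) = V r0 (?w c)"
    proof -
      have "?U (y i) = V r0 (y i)" if "i \<in> I" for i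
      proof -
        have "cis (b i) = 1" using that unfolding I_def by blast
        then show ?thesis using yU[OF I(2)[OF that]] by (simp only: scaleC_one)
      qed
      then have "(\<Sum>i\<in>I. c i *\<^sub>C ?U (y i)) = (\<Sum>i\<in>I. c i *\<^sub>C V r0 (y i))"
        by (intro sum.cong refl) (simp only:)
      then show ?thesis by (simp only: clin_comb[OF clinear_gmap[OF h sp L fd]] clin_comb[OF clinear_V])
    qed
    then have "A (?w c) (?w c) = (\<Sum>j<N. cis ((r - r0) * \<beta> j) * complex_of_real ((cmod (h (?w c) (x j)))\<^sup>2))"
      unfolding A_def by (simp only: V_form complex_norm_square)
    then have "cis (- \<phi>) * A (?w c) (?w c) = (\<Sum>j<N. cis (- \<phi>) * cis ((r - r0) * \<beta> j) * complex_of_real ((cmod (h (?w c) (x j)))\<^sup>2))"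
      by (simp only: sum_distrib_left mult.assoc)
    moreover have "Re (cis (- \<phi>) * cis t * complex_of_real s) = cos (t - \<phi>) * s" for t s
      by (simp add: cis_mult)
    ultimately show ?thesis by (simp only: Re_sum)
  qed
  have Bpos: "0 < Re (B (?w c) (?w c))" if c: "\<exists>i\<in>I. c i \<noteq> 0" for c
  proof -
    have "?w c \<noteq> 0"
    proof
      assume w0: "?w c = 0"
      from c obtain i where i: "i \<in> I" "c i \<noteq> 0" by (elim bexE)
      have "B (?w c) (y i) = (if i \<in> I then c i else 0)"
        by (rule orthonormal_coeff[OF B _ _ I(2)[OF i(1)]]) (use yo I in \<open>auto simp: B_def orthonormal_def\<close>)
      then show False using i w0 sesq_zero1[OF B] by simp
    qed
    then show ?thesis using splitting_neg[OF h sp wF] by (simp add: B_def)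
  qed
  show "card {j. j < N \<and> cis (a j) = 1} \<le> card {j. j < N \<and> cos \<psi> < cos (a' j - \<psi>)}"
    if t: "\<And>j. j < N \<Longrightarrow> 0 < (r - r0) * \<beta> j \<and> (r - r0) * \<beta> j < 2 * \<psi>" and \<psi>: "\<psi> < pi"
  proof -
    have "card I \<le> arg_count N b' \<psi> (cos \<psi>)"
    proof (rule arg_count_ge[OF A B on diag I(1) W])
      fix c assume c: "\<exists>i\<in>I. c i \<noteq> (0::complex)"
      have lt: "cos \<psi> < cos ((r - r0) * \<beta> j - \<psi>)" if "j < N" for j
      proof -
        have "\<bar>(r - r0) * \<beta> j - \<psi>\<bar> < \<psi>" using t[OF that] by linarith
        then have "cos \<psi> < cos \<bar>(r - r0) * \<beta> j - \<psi>\<bar>" using \<psi> by (intro cos_monotone_0_pi) auto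
        then show ?thesis by simp
      qed
      have "\<exists>j<N. h (?w c) (x j) \<noteq> 0"
      proof (rule ccontr)
        assume "\<not> (\<exists>j<N. h (?w c) (x j) \<noteq> 0)"
        then have "(\<Sum>j<N. (cmod (h (?w c) (x j)))\<^sup>2) = 0" by simp
        then show False using Bpos[OF c] unfolding Bw by simp
      qed
      then obtain j where j: "j < N" "h (?w c) (x j) \<noteq> 0" by blast
      have "(\<Sum>j<N. cos \<psi> * (cmod (h (?w c) (x j)))\<^sup>2) < (\<Sum>j<N. cos ((r - r0) * \<beta> j - \<psi>) * (cmod (h (?w c) (x j)))\<^sup>2)"
      proof (rule sum_strict_mono_ex1)
        show "\<forall>j\<in>{..<N}. cos \<psi> * (cmod (h (?w c) (x j)))\<^sup>2 \<le> cos ((r - r0) * \<beta> j - \<psi>) * (cmod (h (?w c) (x j)))\<^sup>2"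
          using lt by (intro ballI mult_right_mono) (auto simp: less_imp_le)
        show "\<exists>j\<in>{..<N}. cos \<psi> * (cmod (h (?w c) (x j)))\<^sup>2 < cos ((r - r0) * \<beta> j - \<psi>) * (cmod (h (?w c) (x j)))\<^sup>2"
          using j lt by (intro bexI[of _ j] mult_strict_right_mono) auto
      qed simp
      then show "cos \<psi> * Re (B (?w c) (?w c)) < Re (cis (- \<psi>) * A (?w c) (?w c))"
        unfolding Aw Bw by (simp add: sum_distrib_left)
    qed
    then show ?thesis unfolding cI using same_args_arg_count[OF y'(2)] by (simp add: arg_count_def)
  qed
  show "card {j. j < N \<and> cis (a j) = 1} \<le> card {j. j < N \<and> cos \<psi> \<le> cos (a' j + \<psi>)}"
    if t: "\<And>j. j < N \<Longrightarrow> - 2 * \<psi> \<le> (r - r0) * \<beta> j \<and> (r - r0) * \<beta> j \<le> 0" and \<psi>: "\<psi> < pi" "0 < \<psi>"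
  proof -
    \<comment> \<open>The closed arc from \<open>- 2 * \<psi>\<close> to 0 has centre
      \<open>- \<psi>\<close>.\<close>
    have "card I \<le> card {j. j < N \<and> cos \<psi> \<le> cos (b' j - (- \<psi>))}"
    proof (rule arg_count_ge_weak[OF A B on diag I(1) W])
      fix c assume c: "\<exists>i\<in>I. c i \<noteq> (0::complex)"
      have le: "cos \<psi> \<le> cos ((r - r0) * \<beta> j - (- \<psi>))" if "j < N" for j
      proof -
        have "\<bar>(r - r0) * \<beta> j - (- \<psi>)\<bar> \<le> \<psi>" using t[OF that] by linarith
        then have "cos \<psi> \<le> cos \<bar>(r - r0) * \<beta> j - (- \<psi>)\<bar>" using \<psi> by (intro cos_monotone_0_pi_le) auto
        then show ?thesis by simp
      qed
      have "cos \<psi> * Re (B (?w c) (?w c)) \<le> Re (cis (- (- \<psi>)) * A (?w c) (?w c))"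
        unfolding Aw Bw sum_distrib_left using le by (intro sum_mono mult_right_mono) auto
      with Bpos[OF c] show "0 < Re (B (?w c) (?w c)) \<and> cos \<psi> * Re (B (?w c) (?w c)) \<le> Re (cis (- (- \<psi>)) * A (?w c) (?w c))" ..
    qed
    moreover have "card {j. j < N \<and> cos \<psi> \<le> cos (b' j + \<psi>)} = card {j. j < N \<and> cos \<psi> \<le> cos (a' j + \<psi>)}"
    proof -
      have *: "cos (t + \<psi>) = Re (cis t * cis \<psi>)" for t by (simp add: cis_mult)
      show ?thesis unfolding * by (rule same_args_card[OF y'(2)])
    qed
    ultimately show ?thesis unfolding cI by simp
  qed
qed

end

context lagrangian_rotation
begin

text \<open>In the rectangle of pairs (\<open>\<Lambda> s\<close>, \<open>Wr r\<close>) the edges r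
  = 1 and r = 0 give the indices relative to \<open>W\<close> and \<open>D\<close>. Their difference
  is the jump along the edge s = b minus that along s = 0, where \<open>\<Lambda> 0 = D\<close> and
  the arguments are \<open>r * \<beta> j\<close>.\<close>

lemma index_difference:
  fixes Z :: "'z::complex_normed_vector set" and b :: real
  assumes b: "0 \<le> b" and \<Lambda>: "\<And>s. s \<in> {0..b} \<Longrightarrow> lagrangian h (\<Lambda> s)" "cont_frame {0..b} \<Lambda> Z G" and D0: "\<Lambda> 0 = D"
    and lW: "lifts_eigsp Fm Fp 0 b \<Lambda> W NW \<theta>W" and lD: "lifts_eigsp Fm Fp 0 b \<Lambda> D ND \<theta>D"
  shows "\<exists>\<eta>. (\<forall>j<N. continuous_on {0..1} (\<eta> j)) \<and> (\<forall>r\<in>{0..1}. represents_eigsp Fm Fp (\<Lambda> b) (Wr r) N (\<lambda>j. \<eta> j r)) \<and>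
    lift_index NW 0 b \<theta>W - lift_index ND 0 b \<theta>D =
    ceil_sum N (\<lambda>j. \<eta> j 1) - ceil_sum N (\<lambda>j. \<eta> j 0) - ceil_sum N \<beta>"
proof -
  define T where "T = {0..1::real} \<times> {0..b}"
  have cf: "cfd S" for S :: "'a set" by (rule cfd_mono[OF fd subset_UNIV])
  have N: "N = cdim Fm" using represents_eigsp_same(2)[OF h sp fd D Wr_lagrangian represents_D_Wr] .
  have fst: "continuous_on U fst" and snd: "continuous_on U snd" for U :: "(real \<times> real) set"
    by (intro continuous_intros)+
  have frL: "cont_frame T (\<lambda>p. \<Lambda> (snd p)) Z (\<lambda>p. G (snd p))"
    by (rule cont_frame_compose[OF \<Lambda>(2) snd]) (auto simp: T_def)
  have frW: "cont_frame T (\<lambda>p. Wr (fst p)) Fm (\<lambda>p v. v + V (fst p) v)"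
    by (rule cont_frame_compose[OF Wr_frame fst subset_UNIV])
  have lagT: "lagrangian h (\<Lambda> (snd p))" if "p \<in> T" for p
    using \<Lambda>(1)[of "snd p"] that by (auto simp: T_def)
  have "\<exists>c. represents_eigsp Fm Fp (\<Lambda> (snd p)) (Wr (fst p)) N c" if p: "p \<in> T" for p
    using represents_eigsp_eigen_system[OF h sp fd lagT[OF p] Wr_lagrangian[of "fst p"]] unfolding N by (elim exE conjE) (rule exI)
  then obtain c where c: "\<And>p. p \<in> T \<Longrightarrow> represents_eigsp Fm Fp (\<Lambda> (snd p)) (Wr (fst p)) N (c p)" by metis
  have lsc: "lsc_args T N c"
    by (rule lsc_args_family[OF h fd sp lagT Wr_lagrangian frL frW
      cont_frame_const[OF splitting_subspaces(1)[OF h sp] cf] cont_frame_const[OF splitting_subspaces(2)[OF h sp] cf] c])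
  have "convex T" unfolding T_def by (intro convex_Times) auto
  from index_potential_exists[OF lsc this] obtain \<mu> where pot: "index_potential T N c \<mu>" by (elim exE)
  have edge: "continuous_on {0..b} (\<lambda>s. (r, s))" "(\<lambda>s. (r, s)) ` {0..b} \<subseteq> T" if "r \<in> {0..1}" for r
    using that by (auto simp: T_def intro!: continuous_intros)
  have edge': "continuous_on {0..1} (\<lambda>r. (r, s))" "(\<lambda>r. (r, s)) ` {0..1} \<subseteq> T" if "s \<in> {0..b}" for s
    using that by (auto simp: T_def intro!: continuous_intros)
  have cT: "represents_eigsp Fm Fp (\<Lambda> s) (Wr r) N (c (r, s))" if "r \<in> {0..1}" "s \<in> {0..b}" for r s
    using c[of "(r, s)"] that by (simp add: T_def)
  have c0: "represents_eigsp Fm Fp (\<Lambda> s) D N (c (0, s))" and c1: "represents_eigsp Fm Fp (\<Lambda> s) W N (c (1, s))"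
    if "s \<in> {0..b}" for s
    using cT[of 0 s] cT[of 1 s] that unfolding Wr_0 Wr_1 by simp_all
  have kW: "NW = N" "of_int (lift_index N 0 b \<theta>W) = \<mu> (1, b) - \<mu> (1, 0)"
    using lift_index_potential[OF pot b edge[of 1] lW c1] by auto
  have kD: "ND = N" "of_int (lift_index N 0 b \<theta>D) = \<mu> (0, b) - \<mu> (0, 0)"
    using lift_index_potential[OF pot b edge[of 0] lD c0] by auto
  have b': "b \<in> {0..b}" "0 \<in> {0..b}" using b by auto
  obtain \<eta> where \<eta>: "\<forall>j<N. continuous_on {0..1} (\<eta> j)" "\<forall>r\<in>{0..1}. same_args N (\<lambda>j. \<eta> j r) (c (r, b))"
    using global_lift[OF lsc_args_compose[OF lsc edge'[OF b'(1)]] zero_le_one] by blast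
  have \<mu>b: "of_int (ceil_sum N (\<lambda>j. \<eta> j 1) - ceil_sum N (\<lambda>j. \<eta> j 0)) = \<mu> (1, b) - \<mu> (0, b)"
    by (rule index_potentialD[OF pot zero_le_one edge'[OF b'(1)] \<eta>])
  have "\<forall>r\<in>{0..1}. same_args N (\<lambda>j. r * \<beta> j) (c (r, 0))"
    using represents_eigsp_unique(2)[OF represents_D_Wr cT[OF _ b'(2), unfolded D0]] by blast
  moreover have "\<forall>j<N. continuous_on {0..1} (\<lambda>r. r * \<beta> j)" by (intro allI impI continuous_intros)
  \<comment> \<open>At r = 0 all arguments vanish, so this edge contributes
    \<open>ceil_sum N \<beta>\<close>.\<close>
  ultimately have \<mu>0: "of_int (ceil_sum N (\<lambda>j. 1 * \<beta> j) - ceil_sum N (\<lambda>j. 0 * \<beta> j)) = \<mu> (1, 0) - \<mu> (0, 0)"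
    by (intro index_potentialD[OF pot zero_le_one edge'[OF b'(2)], where \<theta> = "\<lambda>j r. r * \<beta> j"])
  have "real_of_int (lift_index NW 0 b \<theta>W - lift_index ND 0 b \<theta>D) =
    real_of_int (ceil_sum N (\<lambda>j. \<eta> j 1) - ceil_sum N (\<lambda>j. \<eta> j 0) - ceil_sum N \<beta>)"
    using kW kD \<mu>b \<mu>0 by (simp add: ceil_sum_def)
  then have "lift_index NW 0 b \<theta>W - lift_index ND 0 b \<theta>D =
    ceil_sum N (\<lambda>j. \<eta> j 1) - ceil_sum N (\<lambda>j. \<eta> j 0) - ceil_sum N \<beta>" by (simp only: of_int_eq_iff)
  moreover have "represents_eigsp Fm Fp (\<Lambda> b) (Wr r) N (\<lambda>j. \<eta> j r)" if r: "r \<in> {0..1}" for r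
    by (rule represents_eigsp_cong[OF same_args_sym[OF \<eta>(2)[rule_format, OF r]] cT[OF r b'(1)]])
  ultimately show ?thesis using \<eta>(1) by blast
qed

text \<open>Positive \<beta> make the rotation cross \<open>L\<close> in one direction only, and the
  strict bound at r = 0 sends all eigenvalues at 1, as many as the dimension of
  \<open>L \<inter> D\<close>, upwards at once.\<close>

lemma rotation_index_lower:
  assumes L: "lagrangian h L" and \<beta>: "\<And>j. j < N \<Longrightarrow> 0 < \<beta> j \<and> \<beta> j \<le> 2 * pi"
    and \<eta>: "\<And>j. j < N \<Longrightarrow> continuous_on {0..1} (\<eta> j)" "\<And>r. r \<in> {0..1} \<Longrightarrow> represents_eigsp Fm Fp L (Wr r) N (\<lambda>j. \<eta> j r)"
  shows "ceil_sum N (\<lambda>j. \<eta> j 0) + int (cdim (L \<inter> D)) \<le> ceil_sum N (\<lambda>j. \<eta> j 1)"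
proof -
  have "card {j. j < N \<and> cis (\<eta> j 0) = 1} = cdim (eigsp Fm Fp L (Wr 0) 1)"
    using \<eta>(2)[of 0] unfolding represents_eigsp_def by simp
  also have "\<dots> = cdim (L \<inter> D)" unfolding Wr_0 by (rule eigsp_one_dim[OF h sp fd L D])
  finally have "card {j. j < N \<and> cis (\<eta> j 0) = 1} = cdim (L \<inter> D)" .
  moreover have "ceil_sum N (\<lambda>j. \<eta> j 0) + int (card {j. j < N \<and> cis (\<eta> j 0) = 1}) \<le> ceil_sum N (\<lambda>j. \<eta> j 1)"
  proof (rule ceil_sum_strict_mono[OF zero_less_one \<eta>(1)])
    fix p \<psi> :: real assume p: "0 < p" "p \<le> 1" and \<psi>: "0 < \<psi>" "\<psi> < pi / 4"
    show "\<exists>d>0. \<forall>r\<in>{0..<p}. p - r < d \<longrightarrow> card {j. j < N \<and> cis (\<eta> j p) = 1} \<le> card {j. j < N \<and> cos \<psi> \<le> cos (\<eta> j r + \<psi>)}"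
    \<comment> \<open>As \<open>\<beta> j\<close> is at most \<open>2 * pi\<close>, a parameter step
      below \<open>\<psi> / pi\<close> turns each phase by at most
      \<open>2 * \<psi>\<close>.\<close>
    proof (intro exI[of _ "\<psi> / pi"] conjI ballI impI)
      fix r assume r: "r \<in> {0..<p}" "p - r < \<psi> / pi"
      have "- 2 * \<psi> \<le> (r - p) * \<beta> j \<and> (r - p) * \<beta> j \<le> 0" if "j < N" for j
      proof -
        have "(p - r) * \<beta> j \<le> (\<psi> / pi) * (2 * pi)" using \<beta>[OF that] r by (intro mult_mono) auto
        moreover have "0 \<le> (p - r) * \<beta> j" using \<beta>[OF that] r by (intro mult_nonneg_nonneg) auto
        ultimately show ?thesis by (simp add: algebra_simps)
      qed
      moreover have "p \<in> {0..1}" "r \<in> {0..1}" using p r by auto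
      ultimately show "card {j. j < N \<and> cis (\<eta> j p) = 1} \<le> card {j. j < N \<and> cos \<psi> \<le> cos (\<eta> j r + \<psi>)}"
        by (intro crossing_count(2)[OF L \<eta>(2) \<eta>(2)]) (use \<psi> pi_gt_zero in auto)
    qed (use \<psi> in simp)
  next
    fix \<psi> :: real assume \<psi>: "0 < \<psi>" "\<psi> < pi / 4"
    show "\<exists>d>0. \<forall>r\<in>{0<..1}. r - 0 < d \<longrightarrow> card {j. j < N \<and> cis (\<eta> j 0) = 1} \<le> card {j. j < N \<and> cos \<psi> < cos (\<eta> j r - \<psi>)}"
    proof (intro exI[of _ "\<psi> / pi"] conjI ballI impI)
      fix r :: real assume r: "r \<in> {0<..1}" "r - 0 < \<psi> / pi"
      have "0 < (r - 0) * \<beta> j \<and> (r - 0) * \<beta> j < 2 * \<psi>" if "j < N" for j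
      proof
        have "(r - 0) * \<beta> j \<le> r * (2 * pi)" using \<beta>[OF that] r by (intro mult_mono) auto
        also have "\<dots> < (\<psi> / pi) * (2 * pi)" using r by (intro mult_strict_right_mono) auto
        finally show "(r - 0) * \<beta> j < 2 * \<psi>" by simp
        show "0 < (r - 0) * \<beta> j" using \<beta>[OF that] r by simp
      qed
      moreover have "0 \<in> {0..1::real}" "r \<in> {0..1}" using r by auto
      ultimately show "card {j. j < N \<and> cis (\<eta> j 0) = 1} \<le> card {j. j < N \<and> cos \<psi> < cos (\<eta> j r - \<psi>)}"
        by (intro crossing_count(1)[OF L \<eta>(2) \<eta>(2)]) (use \<psi> pi_gt_zero in auto)
    qed (use \<psi> in simp)
  qed
  ultimately show ?thesis by simp
qed

text \<open>Run the rotation backwards: then the phases, which are never positive forwards, make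
  only positive crossings and \<open>ceil_sum_mono\<close> applies. Arguments equal to 0 are
  allowed, so only a weak inequality results.\<close>

lemma rotation_index_upper:
  assumes L: "lagrangian h L" and \<beta>: "\<And>j. j < N \<Longrightarrow> - 2 * pi \<le> \<beta> j \<and> \<beta> j \<le> 0"
    and \<eta>: "\<And>j. j < N \<Longrightarrow> continuous_on {0..1} (\<eta> j)" "\<And>r. r \<in> {0..1} \<Longrightarrow> represents_eigsp Fm Fp L (Wr r) N (\<lambda>j. \<eta> j r)"
  shows "ceil_sum N (\<lambda>j. \<eta> j 1) \<le> ceil_sum N (\<lambda>j. \<eta> j 0)"
proof -
  have "ceil_sum N (\<lambda>j. \<eta> j (1 - 0)) \<le> ceil_sum N (\<lambda>j. \<eta> j (1 - 1))"
  proof (rule ceil_sum_mono[where \<theta> = "\<lambda>j r. \<eta> j (1 - r)", OF zero_le_one])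
    show "continuous_on {0..1} (\<lambda>r. \<eta> j (1 - r))" if "j < N" for j
      by (rule continuous_on_compose2[OF \<eta>(1)[OF that]]) (auto intro!: continuous_intros)
    fix p \<psi> :: real assume p: "0 < p" "p \<le> 1" and \<psi>: "0 < \<psi>" "\<psi> < pi / 4"
    show "\<exists>d>0. \<forall>r\<in>{0..<p}. p - r < d \<longrightarrow>
      card {j. j < N \<and> cis (\<eta> j (1 - p)) = 1} \<le> card {j. j < N \<and> cos \<psi> \<le> cos (\<eta> j (1 - r) + \<psi>)}"
    proof (intro exI[of _ "\<psi> / pi"] conjI ballI impI)
      fix r assume r: "r \<in> {0..<p}" "p - r < \<psi> / pi"
      have "- 2 * \<psi> \<le> ((1 - r) - (1 - p)) * \<beta> j \<and> ((1 - r) - (1 - p)) * \<beta> j \<le> 0" if "j < N" for j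
      proof -
        have "(p - r) * - \<beta> j \<le> (\<psi> / pi) * (2 * pi)" using \<beta>[OF that] r by (intro mult_mono) auto
        moreover have "0 \<le> (p - r) * - \<beta> j" using \<beta>[OF that] r by (intro mult_nonneg_nonneg) auto
        ultimately show ?thesis by (simp add: algebra_simps)
      qed
      moreover have "1 - p \<in> {0..1}" "1 - r \<in> {0..1}" using p r by auto
      ultimately show "card {j. j < N \<and> cis (\<eta> j (1 - p)) = 1} \<le> card {j. j < N \<and> cos \<psi> \<le> cos (\<eta> j (1 - r) + \<psi>)}"
        by (intro crossing_count(2)[OF L \<eta>(2) \<eta>(2)]) (use \<psi> pi_gt_zero in auto)
    qed (use \<psi> in simp)
  qed
  then show ?thesis by simp
qed

end

lemma eigen_system_shift:
  fixes k :: "nat \<Rightarrow> int"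
  assumes "eigen_system h Fm Fp L M N x a" shows "eigen_system h Fm Fp L M N x (\<lambda>j. a j - 2 * pi * of_int (k j))"
proof -
  have "cis (a j - 2 * pi * of_int (k j)) = cis (a j)" for j unfolding cis_eq_iff by (rule exI[of _ "- k j"]) simp
  then show ?thesis using assms unfolding eigen_system_def by simp
qed

text \<open>Two rotations from \<open>D\<close> to \<open>W\<close> are compared with the same path.
  The one with arguments in (0, 2 pi] costs the full number of eigenvalues but gains the
  intersection dimension; the one with arguments in (-2 pi, 0] costs nothing and its jump has the
  opposite sign.\<close>

theorem lift_index_comparison:
  fixes h :: "'a::complex_normed_vector \<Rightarrow> 'a \<Rightarrow> complex" and Z :: "'z::complex_normed_vector set" and b :: real
  assumes h: "herm h" and fd: "cfd (UNIV :: 'a set)" and sp: "splitting h Fm Fp" and b: "0 \<le> b"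
    and \<Lambda>: "\<And>s. s \<in> {0..b} \<Longrightarrow> lagrangian h (\<Lambda> s)" "cont_frame {0..b} \<Lambda> Z G"
    and lagD: "lagrangian h D" and \<Lambda>0: "\<Lambda> 0 = D" and lagW: "lagrangian h W"
    and lW: "lifts_eigsp Fm Fp 0 b \<Lambda> W NW \<theta>W" and lD: "lifts_eigsp Fm Fp 0 b \<Lambda> D ND \<theta>D"
  shows "int (cdim (\<Lambda> b \<inter> D)) - int (cdim Fm) \<le> lift_index NW 0 b \<theta>W - lift_index ND 0 b \<theta>D"
    and "lift_index NW 0 b \<theta>W \<le> lift_index ND 0 b \<theta>D"
proof -
  let ?N = "cdim Fm"
  obtain x a where es: "eigen_system h Fm Fp D W ?N x a"
    using eigen_system_exists[OF h sp fd lagD lagW] by blast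
  have Lb: "lagrangian h (\<Lambda> b)" using \<Lambda>(1) b by simp
  define k where "k j = \<lceil>a j / (2 * pi)\<rceil>" for j
  have k: "a j / (2 * pi) \<le> of_int (k j) \<and> of_int (k j) - 1 < a j / (2 * pi)" for j unfolding k_def by linarith
  \<comment> \<open>Subtracting 2 pi times the ceiling moves the argument into (-2 pi, 0], and
    \<open>c\<close> adds further turns; only c = 1 and c = 0 are used below.\<close>
  define \<beta> where "\<beta> c j = a j - 2 * pi * of_int (k j - c)" for c j
  have es': "eigen_system h Fm Fp D W ?N x (\<beta> c)" for c unfolding \<beta>_def by (rule eigen_system_shift[OF es])
  have scale: "\<beta> c j = 2 * pi * (a j / (2 * pi) - of_int (k j) + of_int c)" for c j
    by (simp add: \<beta>_def field_simps)
  have ceil: "ceil_sum ?N (\<beta> c) = int ?N * c" for c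
  proof -
    have "\<lceil>\<beta> c j / (2 * pi)\<rceil> = c" for j
    proof -
      have "\<beta> c j / (2 * pi) = a j / (2 * pi) - of_int (k j) + of_int c" by (simp add: scale)
      then show ?thesis using k[of j] by linarith
    qed
    then show ?thesis by (simp add: ceil_sum_def)
  qed
  have range: "2 * pi * (of_int c - 1) < \<beta> c j" "\<beta> c j \<le> 2 * pi * of_int c" for c j
    unfolding scale using k[of j] by (intro mult_strict_left_mono mult_left_mono; simp)+
  have rot: "lagrangian_rotation h Fm Fp D W ?N x (\<beta> c)" for c
    by (rule lagrangian_rotation.intro[OF h sp fd lagD lagW es'])
  show "int (cdim (\<Lambda> b \<inter> D)) - int ?N \<le> lift_index NW 0 b \<theta>W - lift_index ND 0 b \<theta>D"
  proof -
    interpret lagrangian_rotation h Fm Fp D W ?N x "\<beta> 1" by (rule rot)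
    obtain \<eta> where \<eta>: "\<And>j. j < ?N \<Longrightarrow> continuous_on {0..1} (\<eta> j)" "\<And>r. r \<in> {0..1} \<Longrightarrow> represents_eigsp Fm Fp (\<Lambda> b) (Wr r) ?N (\<lambda>j. \<eta> j r)"
      and d: "lift_index NW 0 b \<theta>W - lift_index ND 0 b \<theta>D =
        ceil_sum ?N (\<lambda>j. \<eta> j 1) - ceil_sum ?N (\<lambda>j. \<eta> j 0) - ceil_sum ?N (\<beta> 1)"
      using index_difference[OF b \<Lambda> \<Lambda>0 lW lD] by blast
    have "ceil_sum ?N (\<lambda>j. \<eta> j 0) + int (cdim (\<Lambda> b \<inter> D)) \<le> ceil_sum ?N (\<lambda>j. \<eta> j 1)"
      by (rule rotation_index_lower[OF Lb _ \<eta>]) (use range[of 1] in auto)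
    then show ?thesis using d ceil[of 1] by simp
  qed
  show "lift_index NW 0 b \<theta>W \<le> lift_index ND 0 b \<theta>D"
  proof -
    interpret lagrangian_rotation h Fm Fp D W ?N x "\<beta> 0" by (rule rot)
    obtain \<eta> where \<eta>: "\<And>j. j < ?N \<Longrightarrow> continuous_on {0..1} (\<eta> j)" "\<And>r. r \<in> {0..1} \<Longrightarrow> represents_eigsp Fm Fp (\<Lambda> b) (Wr r) ?N (\<lambda>j. \<eta> j r)"
      and d: "lift_index NW 0 b \<theta>W - lift_index ND 0 b \<theta>D =
        ceil_sum ?N (\<lambda>j. \<eta> j 1) - ceil_sum ?N (\<lambda>j. \<eta> j 0) - ceil_sum ?N (\<beta> 0)"
      using index_difference[OF b \<Lambda> \<Lambda>0 lW lD] by blast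
    have "ceil_sum ?N (\<lambda>j. \<eta> j 1) \<le> ceil_sum ?N (\<lambda>j. \<eta> j 0)"
      by (rule rotation_index_upper[OF Lb _ \<eta>]) (use range[of 0] in \<open>auto simp: less_imp_le\<close>)
    then show ?thesis using d ceil[of 0] by simp
  qed
qed

section \<open>Iteration of symplectic paths\<close>

lemma splitting_transport:
  assumes T: "clinear T" "bij T" and iso: "\<And>x y. h (T x) (T y) = h x y" and h: "herm h" and sp: "splitting h Fm Fp"
  shows "splitting h (T ` Fm) (T ` Fp)"
  unfolding splitting_def
proof (intro conjI csubspace_image T splitting_subspaces[OF h sp] ballI impI)
  show "Re (h y y) < 0" if y: "y \<in> T ` Fm" "y \<noteq> 0" for y
  proof -
    obtain x where x: "x \<in> Fm" "y = T x" using y(1) by blast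
    then have "x \<noteq> 0" using y(2) clin_zero[OF T(1)] by metis
    then show ?thesis using splitting_neg[OF h sp x(1)] by (simp add: x(2) iso)
  qed
  show "0 < Re (h y y)" if y: "y \<in> T ` Fp" "y \<noteq> 0" for y
  proof -
    obtain x where x: "x \<in> Fp" "y = T x" using y(1) by blast
    then have "x \<noteq> 0" using y(2) clin_zero[OF T(1)] by metis
    then show ?thesis using splitting_pos[OF h sp x(1)] by (simp add: x(2) iso)
  qed
  show "h y z = 0" if "y \<in> T ` Fm" "z \<in> T ` Fp" for y z
    using that splitting_orth[OF h sp] by (auto simp: iso)
  have "y \<in> (\<lambda>(u, v). u + v) ` (T ` Fm \<times> T ` Fp)" for y
  proof -
    obtain x where x: "y = T x" using bij_is_surj[OF T(2)] by (rule surjE)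
    have "x \<in> (\<lambda>(u, v). u + v) ` (Fm \<times> Fp)" using sp unfolding splitting_def by simp
    then obtain u v where "u \<in> Fm" "v \<in> Fp" "x = u + v" by auto
    then show ?thesis unfolding x by (intro image_eqI[of _ _ "(T u, T v)"]) (simp_all add: clin_add[OF T(1)])
  qed
  then show "(\<lambda>(u, v). u + v) ` (T ` Fm \<times> T ` Fp) = UNIV" by blast
qed

text \<open>Eigenspaces are described by sums and memberships alone, which a linear bijection
  respects; the relative operator itself is not conjugated explicitly.\<close>

lemma eigsp_transport:
  assumes T: "clinear T" "bij T" shows "eigsp (T ` Fm) (T ` Fp) (T ` L) (T ` M) z = T ` eigsp Fm Fp L M z"
proof -
  have mem: "T x + T y \<in> T ` S \<longleftrightarrow> x + y \<in> S" for x y S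
    using inj_image_mem_iff[OF bij_is_inj[OF T(2)]] by (simp only: clin_add[OF T(1), symmetric])
  have mem': "T x + z *\<^sub>C T y \<in> T ` S \<longleftrightarrow> x + z *\<^sub>C y \<in> S" for x y S
    using mem[of x "z *\<^sub>C y"] by (simp only: clin_scale[OF T(1)])
  show ?thesis
  proof (intro subset_antisym subsetI)
    fix w assume "w \<in> eigsp (T ` Fm) (T ` Fp) (T ` L) (T ` M) z"
    then obtain x y where "w = T y" "y \<in> Fp" "x \<in> Fm" "T x + T y \<in> T ` M" "T x + z *\<^sub>C T y \<in> T ` L"
      unfolding eigsp_def by blast
    then show "w \<in> T ` eigsp Fm Fp L M z" unfolding mem mem' eigsp_def by blast
  next
    fix w assume "w \<in> T ` eigsp Fm Fp L M z"
    then obtain x y where w: "w = T y" "y \<in> Fp" "x \<in> Fm" and "x + y \<in> M" "x + z *\<^sub>C y \<in> L"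
      unfolding eigsp_def by blast
    then have "T x + T y \<in> T ` M" "T x + z *\<^sub>C T y \<in> T ` L" by (simp_all only: mem mem')
    with w show "w \<in> eigsp (T ` Fm) (T ` Fp) (T ` L) (T ` M) z"
      unfolding eigsp_def by blast
  qed
qed

lemma eigsp_subspace:
  assumes "csubspace Fm" "csubspace Fp" "csubspace L" "csubspace M" shows "csubspace (eigsp Fm Fp L M z)"
proof (rule csubspaceI)
  show "0 \<in> eigsp Fm Fp L M z" unfolding eigsp_def using assms by (auto intro!: bexI[of _ 0] csubspace_0)
  show "v + w \<in> eigsp Fm Fp L M z" if v: "v \<in> eigsp Fm Fp L M z" and w: "w \<in> eigsp Fm Fp L M z" for v w
  proof -
    obtain x where x: "v \<in> Fp" "x \<in> Fm" "x + v \<in> M" "x + z *\<^sub>C v \<in> L" using v unfolding eigsp_def by blast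
    obtain y where y: "w \<in> Fp" "y \<in> Fm" "y + w \<in> M" "y + z *\<^sub>C w \<in> L" using w unfolding eigsp_def by blast
    have "(x + y) + (v + w) \<in> M" using csubspace_add[OF assms(4) x(3) y(3)] by (simp add: algebra_simps)
    moreover have "(x + y) + z *\<^sub>C (v + w) \<in> L" using csubspace_add[OF assms(3) x(4) y(4)] by (simp add: algebra_simps scaleC_add_right)
    ultimately show ?thesis unfolding eigsp_def
      using csubspace_add[OF assms(1) x(2) y(2)] csubspace_add[OF assms(2) x(1) y(1)] by blast
  qed
  show "c *\<^sub>C v \<in> eigsp Fm Fp L M z" if v: "v \<in> eigsp Fm Fp L M z" for c v
  proof -
    obtain x where x: "v \<in> Fp" "x \<in> Fm" "x + v \<in> M" "x + z *\<^sub>C v \<in> L" using v unfolding eigsp_def by blast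
    have "c *\<^sub>C x + c *\<^sub>C v \<in> M" using csubspace_scale[OF assms(4) x(3), of c] by (simp add: scaleC_add_right)
    moreover have "c *\<^sub>C x + z *\<^sub>C c *\<^sub>C v \<in> L"
      using csubspace_scale[OF assms(3) x(4), of c] by (simp add: scaleC_add_right scaleC_scaleC mult.commute)
    ultimately show ?thesis unfolding eigsp_def
      using csubspace_scale[OF assms(1) x(2)] csubspace_scale[OF assms(2) x(1)] by blast
  qed
qed

lemma represents_eigsp_transport:
  fixes T :: "'a::complex_normed_vector \<Rightarrow> 'a"
  assumes T: "clinear T" "bij T" and fd: "cfd (UNIV :: 'a set)"
    and sub: "csubspace Fm" "csubspace Fp" "csubspace L" "csubspace M" and r: "represents_eigsp Fm Fp L M N a"
  shows "represents_eigsp (T ` Fm) (T ` Fp) (T ` L) (T ` M) N a"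
proof -
  have "cdim (T ` eigsp Fm Fp L M z) = cdim (eigsp Fm Fp L M z)" for z
  proof (rule cdim_image_eq[OF fd T(1) eigsp_subspace[OF sub]])
    show "x = 0" if "T x = 0" for x using that clin_zero[OF T(1)] bij_is_inj[OF T(2)] by (metis injD)
  qed
  then show ?thesis using r unfolding represents_eigsp_def eigsp_transport[OF T] by simp
qed

text \<open>The graph of a linear map over \<open>Fm\<close> has the dimension of
  \<open>Fm\<close>.\<close>

lemma lagrangian_cdim:
  fixes h :: "'a::complex_normed_vector \<Rightarrow> 'a \<Rightarrow> complex"
  assumes h: "herm h" and sp: "splitting h Fm Fp" and fd: "cfd (UNIV :: 'a set)" and L: "lagrangian h L"
  shows "cdim L = cdim Fm"
proof -
  note g = clinear_gmap[OF h sp L fd]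
  have "cdim ((\<lambda>x. x + gmap Fm Fp L x) ` Fm) = cdim Fm"
  proof (rule cdim_image_eq[OF fd _ splitting_subspaces(1)[OF h sp]])
    show "clinear (\<lambda>x. x + gmap Fm Fp L x)"
      by (rule clinearI) (simp_all add: clin_add[OF g] clin_scale[OF g] scaleC_add_right)
    show "x = 0" if "x \<in> Fm" "x + gmap Fm Fp L x = 0" for x
    proof -
      have "x = - gmap Fm Fp L x" using that(2) by (simp add: eq_neg_iff_add_eq_0)
      then have "x \<in> Fp"
        using complex_vector.subspace_neg[OF splitting_subspaces(2)[OF h sp] gmap_in[OF h sp L fd, of x]] by simp
      then show ?thesis using splitting_Int[OF h sp that(1)] by blast
    qed
  qed
  then show ?thesis using lagrangian_eq_graph[OF h sp fd L] by simp
qed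

lemma symplectic_product_form:
  assumes \<omega>: "symplectic_form \<omega>" shows "symplectic_form (product_form \<omega>)"
  unfolding symplectic_form_def
proof (intro conjI allI impI)
  note d = symplectic_formD[OF \<omega>]
  have 0: "\<omega> 0 y = 0" "\<omega> y 0 = 0" for y using d(2)[of 0 0 y] d(3)[of 0 y] by simp_all
  show "product_form \<omega> (x + x') y = product_form \<omega> x y + product_form \<omega> x' y" for x x' y
    by (simp add: product_form_def d(1))
  show "product_form \<omega> (c *\<^sub>C x) y = c * product_form \<omega> x y" for c x y
    by (simp add: product_form_def scaleC_prod_def d(2) algebra_simps)
  show "product_form \<omega> y x = - cnj (product_form \<omega> x y)" for x y
    unfolding product_form_def d(3)[where x = "fst x" and y = "fst y"] d(3)[where x = "snd x" and y = "snd y"] by simp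
  fix z assume z: "\<forall>y. product_form \<omega> z y = 0"
  have "\<omega> (fst z) y = 0" "\<omega> (snd z) y = 0" for y
    using z[rule_format, of "(y, 0)"] z[rule_format, of "(0, y)"] by (simp_all add: product_form_def 0)
  then have "fst z = 0" "snd z = 0" by (auto intro: d(4))
  then show "z = 0" by (simp add: prod_eq_iff)
qed

lemma SpD:
  assumes "A \<in> Sp \<omega>"
  shows "clinear (blinfun_apply A)" "bij (blinfun_apply A)" "\<omega> (blinfun_apply A x) (blinfun_apply A y) = \<omega> x y"
  using assms unfolding Sp_def by auto

lemma Sp_compose:
  assumes A: "A \<in> Sp \<omega>" and B: "B \<in> Sp \<omega>" shows "A o\<^sub>L B \<in> Sp \<omega>"
proof -
  have "clinear (\<lambda>x. A (B x))" by (rule clinear_compose[OF SpD(1)[OF A] SpD(1)[OF B]])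
  moreover have "bij (\<lambda>x. A (B x))" using bij_comp[OF SpD(2)[OF B] SpD(2)[OF A]] by (simp add: comp_def)
  moreover have "\<omega> (A (B x)) (A (B y)) = \<omega> x y" for x y by (simp only: SpD(3)[OF A] SpD(3)[OF B])
  moreover have "blinfun_apply (A o\<^sub>L B) = (\<lambda>x. A (B x))" by auto
  ultimately show ?thesis unfolding Sp_def by simp
qed

lemma lagrangian_Gr:
  assumes \<omega>: "symplectic_form \<omega>" and A: "A \<in> Sp \<omega>" shows "lagrangian (product_form \<omega>) (Gr A)"
  unfolding lagrangian_def
proof (intro conjI subset_antisym subsetI)
  note d = symplectic_formD[OF \<omega>] and a = SpD[OF A]
  show "csubspace (Gr A)"
    by (rule csubspaceI) (auto simp: Gr_def zero_prod_def scaleC_prod_def clin_zero[OF a(1)] clin_add[OF a(1)] clin_scale[OF a(1)])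
  show "z \<in> {z. \<forall>y\<in>Gr A. product_form \<omega> z y = 0}" if "z \<in> Gr A" for z
    using that by (auto simp: Gr_def product_form_def a(3))
  fix z assume "z \<in> {z. \<forall>y\<in>Gr A. product_form \<omega> z y = 0}"
  then have z: "- \<omega> (fst z) x + \<omega> (snd z) (A x) = 0" for x
    by (auto simp: Gr_def product_form_def)
  \<comment> \<open>Tests the difference against all vectors \<open>A x\<close>, which exhaust the
    space; non-degeneracy does the rest.\<close>
  have "snd z + (- 1) *\<^sub>C A (fst z) = 0"
  proof (rule d(4))
    fix y
    obtain x where x: "y = A x" using bij_is_surj[OF a(2)] by (rule surjE)
    show "\<omega> (snd z + (- 1) *\<^sub>C A (fst z)) y = 0" unfolding x d(1) d(2) a(3) using z[of x] by simp
  qed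
  then have "snd z = A (fst z)" using scaleR_scaleC[of "-1" "A (fst z)"] by simp
  then show "z \<in> Gr A" unfolding Gr_def by (metis (mono_tags, lifting) mem_Collect_eq prod.collapse)
qed

lemma lagrangian_Times:
  assumes \<omega>: "symplectic_form \<omega>" and L: "lagrangian \<omega> L" and M: "lagrangian \<omega> M"
  shows "lagrangian (product_form \<omega>) (L \<times> M)"
  unfolding lagrangian_def
proof (intro conjI subset_antisym subsetI)
  have sub: "csubspace L" "csubspace M" using L M by (simp_all add: lagrangian_def)
  have mem: "x \<in> L \<longleftrightarrow> (\<forall>y\<in>L. \<omega> x y = 0)" "x \<in> M \<longleftrightarrow> (\<forall>y\<in>M. \<omega> x y = 0)" for x
    using L M unfolding lagrangian_def by blast+
  note d = symplectic_formD[OF \<omega>]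
  have 0: "\<omega> y 0 = 0" for y using d(2)[of 0 0 y] d(3)[of 0 y] by simp
  show "csubspace (L \<times> M)" by (rule csubspace_Times[OF sub])
  show "z \<in> {z. \<forall>y\<in>L \<times> M. product_form \<omega> z y = 0}" if z: "z \<in> L \<times> M" for z
  proof -
    have "\<omega> (fst z) x = 0" "\<omega> (snd z) y = 0" if "x \<in> L" "y \<in> M" for x y
      using z that mem(1)[of "fst z"] mem(2)[of "snd z"] by auto
    then show ?thesis by (auto simp: product_form_def)
  qed
  fix z assume "z \<in> {z. \<forall>y\<in>L \<times> M. product_form \<omega> z y = 0}"
  then have z: "- \<omega> (fst z) x + \<omega> (snd z) y = 0" if "x \<in> L" "y \<in> M" for x y
    using that by (auto simp: product_form_def)
  have "fst z \<in> L" unfolding mem(1) using z[OF _ csubspace_0[OF sub(2)]] by (simp add: 0)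
  moreover have "snd z \<in> M" unfolding mem(2) using z[OF csubspace_0[OF sub(1)]] by (simp add: 0)
  ultimately show "z \<in> L \<times> M" by (simp add: mem_Times_iff)
qed

lemma lagrangian_Sp_image:
  assumes A: "A \<in> Sp \<omega>" and L: "lagrangian \<omega> L" shows "lagrangian \<omega> (blinfun_apply A ` L)"
  unfolding lagrangian_def
proof (intro conjI subset_antisym subsetI)
  note a = SpD[OF A]
  have mem: "x \<in> L \<longleftrightarrow> (\<forall>y\<in>L. \<omega> x y = 0)" for x using L unfolding lagrangian_def by blast
  show "csubspace (blinfun_apply A ` L)" using csubspace_image[OF a(1)] L unfolding lagrangian_def by blast
  show "z \<in> {z. \<forall>y\<in>blinfun_apply A ` L. \<omega> z y = 0}" if z: "z \<in> blinfun_apply A ` L" for z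
  proof -
    obtain x where x: "z = A x" "x \<in> L" using z by blast
    then have "\<forall>y\<in>L. \<omega> x y = 0" using mem by blast
    then show ?thesis unfolding x(1) by (simp add: a(3))
  qed
  fix z assume z: "z \<in> {z. \<forall>y\<in>blinfun_apply A ` L. \<omega> z y = 0}"
  obtain x where x: "z = A x" using bij_is_surj[OF a(2)] by (rule surjE)
  have "\<forall>y\<in>L. \<omega> x y = 0" using z by (auto simp: x a(3))
  then have "x \<in> L" using mem by blast
  then show "z \<in> blinfun_apply A ` L" unfolding x by (rule imageI)
qed

lemma cont_frame_Gr:
  fixes \<gamma> :: "real \<Rightarrow> 'v::complex_normed_vector \<Rightarrow>\<^sub>L 'v"
  assumes fd: "cfd (UNIV :: 'v set)" and \<gamma>: "continuous_on S \<gamma>" "\<gamma> ` S \<subseteq> Sp \<omega>"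
  shows "cont_frame S (\<lambda>t. Gr (\<gamma> t)) UNIV (\<lambda>t x. (x, \<gamma> t x))"
  unfolding cont_frame_def
proof (intro conjI ballI impI fd)
  show "csubspace (UNIV :: 'v set)" by (rule csubspaceI) auto
  show "continuous_on S (\<lambda>t. (x, \<gamma> t x))" for x using \<gamma>(1) by (intro continuous_intros)
  show "clinear (\<lambda>x. (x, \<gamma> t x))" if "t \<in> S" for t
  proof -
    have "\<gamma> t \<in> Sp \<omega>" using \<gamma>(2) that by blast
    note a = SpD(1)[OF this]
    show ?thesis by (rule clinearI) (simp_all add: scaleC_prod_def clin_add[OF a] clin_scale[OF a])
  qed
  show "x = 0" if "(x, \<gamma> t x) = 0" for x t using that by (simp add: zero_prod_def)
  show "Gr (\<gamma> t) = range (\<lambda>x. (x, \<gamma> t x))" for t unfolding Gr_def by auto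
qed

text \<open>The intersection is the diagonal copy of the fixed vectors; this links the nullity to
  eigenvalue 1 of the relative operator.\<close>

lemma cdim_Gr_Int:
  fixes A :: "'v::complex_normed_vector \<Rightarrow>\<^sub>L 'v"
  assumes fd: "cfd (UNIV :: 'v set)" and A: "clinear (blinfun_apply A)"
  shows "cdim (Gr A \<inter> Gr id_blinfun) = cdim {x. (A - id_blinfun) x = 0}"
proof -
  have "Gr A \<inter> Gr id_blinfun = (\<lambda>x. (x, x)) ` {x. (A - id_blinfun) x = 0}"
    by (auto simp: Gr_def blinfun.diff_left)
  moreover have "csubspace {x. (A - id_blinfun) x = 0}"
    by (rule csubspaceI) (simp_all add: blinfun.diff_left clin_zero[OF A] clin_add[OF A] clin_scale[OF A])
  moreover have "clinear (\<lambda>x::'v. (x, x))" by (rule clinearI) (simp_all add: scaleC_prod_def)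
  ultimately show ?thesis using cdim_image_eq[OF fd, of "\<lambda>x. (x, x)"] by (simp add: zero_prod_def)
qed

lemma cdim_Gr_id:
  assumes fd: "cfd (UNIV :: 'v::complex_normed_vector set)"
  shows "cdim (Gr (id_blinfun :: 'v \<Rightarrow>\<^sub>L 'v)) = cdim (UNIV :: 'v set)"
  using cdim_Gr_Int[OF fd, of id_blinfun] by (simp add: clinearI)

lemma Sp_id: "id_blinfun \<in> Sp \<omega>"
  unfolding Sp_def using bij_id by (simp add: clinearI id_def)

lemma path_iteration_Sp:
  assumes "0 \<le> \<tau>\<^sub>1" "0 \<le> \<tau>\<^sub>2" and \<gamma>\<^sub>1: "\<gamma>\<^sub>1 \<in> symplectic_paths \<omega> \<tau>\<^sub>1" and \<gamma>\<^sub>2: "\<gamma>\<^sub>2 \<in> symplectic_paths \<omega> \<tau>\<^sub>2"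
  shows "path_iteration \<tau>\<^sub>1 \<gamma>\<^sub>1 \<gamma>\<^sub>2 \<in> symplectic_paths \<omega> (\<tau>\<^sub>1 + \<tau>\<^sub>2)"
proof -
  note g1 = \<gamma>\<^sub>1[unfolded symplectic_paths_def, simplified] and g2 = \<gamma>\<^sub>2[unfolded symplectic_paths_def, simplified]
  have U: "{0..\<tau>\<^sub>1 + \<tau>\<^sub>2} = {0..\<tau>\<^sub>1} \<union> {\<tau>\<^sub>1..\<tau>\<^sub>1 + \<tau>\<^sub>2}" using assms(1,2) by auto
  have "continuous_on {\<tau>\<^sub>1..\<tau>\<^sub>1 + \<tau>\<^sub>2} (\<lambda>t. \<gamma>\<^sub>2 (t - \<tau>\<^sub>1))"
    by (rule continuous_on_compose2[of "{0..\<tau>\<^sub>2}" \<gamma>\<^sub>2]) (use g2 in \<open>auto intro!: continuous_intros\<close>)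
  then have 2: "continuous_on {\<tau>\<^sub>1..\<tau>\<^sub>1 + \<tau>\<^sub>2} (\<lambda>t. \<gamma>\<^sub>2 (t - \<tau>\<^sub>1) o\<^sub>L \<gamma>\<^sub>1 \<tau>\<^sub>1)"
    by (intro bounded_bilinear.continuous_on[OF bounded_bilinear_blinfun_compose] continuous_on_const)
  have cont: "continuous_on ({0..\<tau>\<^sub>1} \<union> {\<tau>\<^sub>1..\<tau>\<^sub>1 + \<tau>\<^sub>2}) (path_iteration \<tau>\<^sub>1 \<gamma>\<^sub>1 \<gamma>\<^sub>2)"
    unfolding path_iteration_def[abs_def]
  proof (rule continuous_on_cases[OF closed_real_atLeastAtMost closed_real_atLeastAtMost])
    show "continuous_on {0..\<tau>\<^sub>1} \<gamma>\<^sub>1" using g1 by blast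
    show "continuous_on {\<tau>\<^sub>1..\<tau>\<^sub>1 + \<tau>\<^sub>2} (\<lambda>t. \<gamma>\<^sub>2 (t - \<tau>\<^sub>1) o\<^sub>L \<gamma>\<^sub>1 \<tau>\<^sub>1)" by (rule 2)
    \<comment> \<open>Both branches agree at the junction because the second path starts at the
      identity.\<close>
    have "id_blinfun o\<^sub>L \<gamma>\<^sub>1 \<tau>\<^sub>1 = \<gamma>\<^sub>1 \<tau>\<^sub>1" by (rule blinfun_eqI) simp
    then show "\<forall>t. t \<in> {0..\<tau>\<^sub>1} \<and> \<not> t \<le> \<tau>\<^sub>1 \<or> t \<in> {\<tau>\<^sub>1..\<tau>\<^sub>1 + \<tau>\<^sub>2} \<and> t \<le> \<tau>\<^sub>1 \<longrightarrow> \<gamma>\<^sub>1 t = \<gamma>\<^sub>2 (t - \<tau>\<^sub>1) o\<^sub>L \<gamma>\<^sub>1 \<tau>\<^sub>1"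
      using g2 by auto
  qed
  have Sp: "path_iteration \<tau>\<^sub>1 \<gamma>\<^sub>1 \<gamma>\<^sub>2 t \<in> Sp \<omega>" if "t \<in> {0..\<tau>\<^sub>1 + \<tau>\<^sub>2}" for t
  proof (cases "t \<le> \<tau>\<^sub>1")
    case True
    then have "t \<in> {0..\<tau>\<^sub>1}" using that by simp
    then show ?thesis using g1 True unfolding path_iteration_def by auto
  next
    case False
    then have "t - \<tau>\<^sub>1 \<in> {0..\<tau>\<^sub>2}" "\<tau>\<^sub>1 \<in> {0..\<tau>\<^sub>1}" using that assms(1) by auto
    then have "\<gamma>\<^sub>2 (t - \<tau>\<^sub>1) \<in> Sp \<omega>" "\<gamma>\<^sub>1 \<tau>\<^sub>1 \<in> Sp \<omega>" using g1 g2 by blast+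
    then show ?thesis using False unfolding path_iteration_def by (simp add: Sp_compose)
  qed
  then have "path_iteration \<tau>\<^sub>1 \<gamma>\<^sub>1 \<gamma>\<^sub>2 ` {0..\<tau>\<^sub>1 + \<tau>\<^sub>2} \<subseteq> Sp \<omega>" by blast
  moreover have "path_iteration \<tau>\<^sub>1 \<gamma>\<^sub>1 \<gamma>\<^sub>2 0 = id_blinfun" using g1 assms(1) by (simp add: path_iteration_def)
  ultimately show ?thesis using cont unfolding symplectic_paths_def U by blast
qed

theorem theorem4p9:
  fixes \<omega> :: "'v::complex_normed_vector \<Rightarrow> 'v \<Rightarrow> complex"
    and n :: nat
    and \<alpha>\<^sub>1 \<alpha>\<^sub>2 :: "'v set"
    and \<tau>\<^sub>1 \<tau>\<^sub>2 :: real
    and \<gamma>\<^sub>1 \<gamma>\<^sub>2 :: "real \<Rightarrow> 'v \<Rightarrow>\<^sub>L 'v"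
  assumes "\<exists>B :: 'v set. finite B \<and> cspan B = UNIV"
    and "symplectic_form \<omega>"
    and "cdim (UNIV :: 'v set) = 2 * n"
    and "lagrangian \<omega> \<alpha>\<^sub>1" and "lagrangian \<omega> \<alpha>\<^sub>2"
    and "\<alpha>\<^sub>1 \<inter> \<alpha>\<^sub>2 = {0}" and "{x + y | x y. x \<in> \<alpha>\<^sub>1 \<and> y \<in> \<alpha>\<^sub>2} = UNIV"
    and "0 \<le> \<tau>\<^sub>1" and "0 \<le> \<tau>\<^sub>2"
    and "\<gamma>\<^sub>1 \<in> symplectic_paths \<omega> \<tau>\<^sub>1" and "\<gamma>\<^sub>2 \<in> symplectic_paths \<omega> \<tau>\<^sub>2"
  shows "int (nu1 \<tau>\<^sub>2 \<gamma>\<^sub>2) - 2 * int n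
         \<le> maslov_type_index \<omega> (\<alpha>\<^sub>2 \<times> \<alpha>\<^sub>2) (\<tau>\<^sub>1 + \<tau>\<^sub>2) (path_iteration \<tau>\<^sub>1 \<gamma>\<^sub>1 \<gamma>\<^sub>2)
           - maslov_type_index \<omega> (\<alpha>\<^sub>2 \<times> \<alpha>\<^sub>2) \<tau>\<^sub>1 \<gamma>\<^sub>1
           - i1 \<omega> \<tau>\<^sub>2 \<gamma>\<^sub>2
       \<and> maslov_type_index \<omega> (\<alpha>\<^sub>2 \<times> \<alpha>\<^sub>2) (\<tau>\<^sub>1 + \<tau>\<^sub>2) (path_iteration \<tau>\<^sub>1 \<gamma>\<^sub>1 \<gamma>\<^sub>2)
           - maslov_type_index \<omega> (\<alpha>\<^sub>2 \<times> \<alpha>\<^sub>2) \<tau>\<^sub>1 \<gamma>\<^sub>1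
           - i1 \<omega> \<tau>\<^sub>2 \<gamma>\<^sub>2
         \<le> 0"
proof -
  let ?\<tau> = "\<tau>\<^sub>1 + \<tau>\<^sub>2" and ?\<Omega> = "product_form \<omega>" and ?W = "\<alpha>\<^sub>2 \<times> \<alpha>\<^sub>2"
  define \<gamma> where "\<gamma> = path_iteration \<tau>\<^sub>1 \<gamma>\<^sub>1 \<gamma>\<^sub>2"
  define A where "A = \<gamma>\<^sub>1 \<tau>\<^sub>1"
  \<comment> \<open>With \<open>A\<close> on the first factor, \<open>S\<close> preserves the form
    on the product, carries the graph of B A onto the graph of B, and sends \<open>?W\<close> to the
    product of A(\<open>\<alpha>\<^sub>2\<close>) and \<open>\<alpha>\<^sub>2\<close>.\<close>
  define S :: "'v \<times> 'v \<Rightarrow> 'v \<times> 'v" where "S z = (A (fst z), snd z)" for z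
  note \<omega> = assms(2) and \<tau>\<^sub>1 = assms(8) and \<tau>\<^sub>2 = assms(9)
  note \<Omega> = symplectic_product_form[OF \<omega>]
  have fdV: "cfd (UNIV :: 'v set)" using assms(1) unfolding cfd_def by blast
  then have fd: "cfd (UNIV :: ('v \<times> 'v) set)" using cfd_Times[OF fdV fdV] by simp
  have \<gamma>: "\<gamma> \<in> symplectic_paths \<omega> ?\<tau>" unfolding \<gamma>_def by (rule path_iteration_Sp[OF \<tau>\<^sub>1 \<tau>\<^sub>2 assms(10,11)])
  have path: "continuous_on {0..t} g" "g ` {0..t} \<subseteq> Sp \<omega>" "g 0 = id_blinfun" "\<And>s. s \<in> {0..t} \<Longrightarrow> g s \<in> Sp \<omega>"
    if "g \<in> symplectic_paths \<omega> t" for g t using that unfolding symplectic_paths_def by auto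
  have frame: "cont_frame {0..t} (\<lambda>s. Gr (g s)) UNIV (\<lambda>s x. (x, g s x))" if "g \<in> symplectic_paths \<omega> t" for g t
    by (rule cont_frame_Gr[OF fdV path(1,2)[OF that]])
  have lagGr: "lagrangian ?\<Omega> (Gr (g s))" if "g \<in> symplectic_paths \<omega> t" "s \<in> {0..t}" for g t s
    by (rule lagrangian_Gr[OF \<omega> path(4)[OF that]])
  note toh = iffD2[OF lagrangian_krein]
  have A: "A \<in> Sp \<omega>" unfolding A_def using path(4)[OF assms(10)] \<tau>\<^sub>1 by simp
  note h = herm_krein[OF \<Omega>]
  obtain ip J where J: "inner_product ip" "clinear J" "bij J" "\<And>x y. ?\<Omega> x y = ip (J x) y"
    using inner_product_exists[OF \<Omega> fd] by blast
  define Fm where "Fm = Xminus J"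
  define Fp where "Fp = Xplus J"
  have sp: "splitting (krein ?\<Omega>) Fm Fp" unfolding Fm_def Fp_def by (rule splitting_of_J[OF \<Omega> fd J])
  have lagI: "lagrangian ?\<Omega> (Gr id_blinfun)" by (rule lagrangian_Gr[OF \<omega> Sp_id])
  have lagW: "lagrangian ?\<Omega> ?W" by (rule lagrangian_Times[OF \<omega> assms(5,5)])
  have lagW': "lagrangian ?\<Omega> (blinfun_apply A ` \<alpha>\<^sub>2 \<times> \<alpha>\<^sub>2)"
    by (rule lagrangian_Times[OF \<omega> lagrangian_Sp_image[OF A assms(5)] assms(5)])
  \<comment> \<open>All Lagrangians of the product have the dimension of \<open>Fm\<close>, and the
    graph of the identity is a copy of V.\<close>
  have dim: "cdim Fm = 2 * n"
    using lagrangian_cdim[OF h sp fd toh[OF lagI]] cdim_Gr_id[OF fdV] assms(3) by simp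
  have \<tau>: "0 \<le> ?\<tau>" using \<tau>\<^sub>1 \<tau>\<^sub>2 by simp
  have lift: "\<exists>\<theta>. lifts_eigsp Fm Fp 0 t (\<lambda>s. Gr (g s)) M (cdim Fm) \<theta>"
    if g: "g \<in> symplectic_paths \<omega> t" "0 \<le> t" and M: "lagrangian ?\<Omega> M" for g t M
    by (rule lifts_eigsp_exists[OF h fd sp g(2) _ frame[OF g(1)] toh[OF M]]) (rule toh[OF lagGr[OF g(1)]])
  have index: "maslov_type_index \<omega> M t g = lift_index (cdim Fm) 0 t \<theta>"
    if g: "g \<in> symplectic_paths \<omega> t" "0 \<le> t" and M: "lagrangian ?\<Omega> M"
      and l: "lifts_eigsp Fm Fp 0 t (\<lambda>s. Gr (g s)) M (cdim Fm) \<theta>" for g t M \<theta>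
    unfolding maslov_type_index_def
    by (rule maslov_index_eqI[OF \<Omega> fd sp g(2) _ frame[OF g(1)] M l]) (rule lagGr[OF g(1)])
  obtain \<theta> where \<theta>: "lifts_eigsp Fm Fp 0 ?\<tau> (\<lambda>t. Gr (\<gamma> t)) ?W (cdim Fm) \<theta>"
    using lift[OF \<gamma> \<tau> lagW] by blast
  obtain \<theta>W where \<theta>W: "lifts_eigsp Fm Fp 0 \<tau>\<^sub>2 (\<lambda>t. Gr (\<gamma>\<^sub>2 t)) (blinfun_apply A ` \<alpha>\<^sub>2 \<times> \<alpha>\<^sub>2) (cdim Fm) \<theta>W"
    using lift[OF assms(11) \<tau>\<^sub>2 lagW'] by blast
  obtain \<theta>D where \<theta>D: "lifts_eigsp Fm Fp 0 \<tau>\<^sub>2 (\<lambda>t. Gr (\<gamma>\<^sub>2 t)) (Gr id_blinfun) (cdim Fm) \<theta>D"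
    using lift[OF assms(11) \<tau>\<^sub>2 lagI] by blast
  have \<theta>c: "continuous_on {0..?\<tau>} (\<theta> j)" if "j < cdim Fm" for j using \<theta> that unfolding lifts_eigsp_def by blast
  have \<theta>r: "represents_eigsp Fm Fp (Gr (\<gamma> t)) ?W (cdim Fm) (\<lambda>j. \<theta> j t)" if "t \<in> {0..?\<tau>}" for t
    using \<theta> that unfolding lifts_eigsp_def by blast
  \<comment> \<open>One lift along the whole iteration is used: its restriction to the first
    interval computes the index of \<open>\<gamma>\<^sub>1\<close>, so the remainder is its jump
    over the second interval.\<close>
  have "lifts_eigsp Fm Fp 0 \<tau>\<^sub>1 (\<lambda>t. Gr (\<gamma>\<^sub>1 t)) ?W (cdim Fm) \<theta>" unfolding lifts_eigsp_def
  proof (intro conjI allI impI ballI)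
    show "continuous_on {0..\<tau>\<^sub>1} (\<theta> j)" if "j < cdim Fm" for j
      by (rule continuous_on_subset[OF \<theta>c[OF that]]) (use \<tau>\<^sub>2 in auto)
    show "represents_eigsp Fm Fp (Gr (\<gamma>\<^sub>1 t)) ?W (cdim Fm) (\<lambda>j. \<theta> j t)" if "t \<in> {0..\<tau>\<^sub>1}" for t
      using \<theta>r[of t] that \<tau>\<^sub>2 by (simp add: \<gamma>_def path_iteration_def)
  qed
  note i\<^sub>1 = index[OF assms(10) \<tau>\<^sub>1 lagW this] and i = index[OF \<gamma> \<tau> lagW \<theta>] and i\<^sub>2 = index[OF assms(11) \<tau>\<^sub>2 lagI \<theta>D]
  note a = SpD[OF A]
  have S: "clinear S" by (rule clinearI) (simp_all add: S_def scaleC_prod_def clin_add[OF a(1)] clin_scale[OF a(1)])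
  have surjA: "\<exists>x. y = A x" for y using bij_is_surj[OF a(2)] by (metis surjE)
  have injA: "A x = A y \<longleftrightarrow> x = y" for x y using bij_is_inj[OF a(2)] by (rule inj_eq)
  have bijS: "bij S"
  proof (rule bijI)
    show "inj S" by (rule injI) (simp add: S_def injA prod_eq_iff)
    have "z \<in> range S" for z
    proof -
      obtain x where "fst z = A x" using surjA by blast
      then show ?thesis by (intro image_eqI[of _ _ "(x, snd z)"]) (simp_all add: S_def prod_eq_iff)
    qed
    then show "surj S" by blast
  qed
  have isoS: "krein ?\<Omega> (S x) (S y) = krein ?\<Omega> x y" for x y by (simp add: krein_def product_form_def S_def a(3))
  note spS = splitting_transport[OF S bijS isoS h sp]
  have SW: "S ` ?W = blinfun_apply A ` \<alpha>\<^sub>2 \<times> \<alpha>\<^sub>2"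
  proof (intro subset_antisym subsetI)
    show "z \<in> blinfun_apply A ` \<alpha>\<^sub>2 \<times> \<alpha>\<^sub>2" if "z \<in> S ` ?W" for z using that by (auto simp: S_def)
    show "z \<in> S ` ?W" if z: "z \<in> blinfun_apply A ` \<alpha>\<^sub>2 \<times> \<alpha>\<^sub>2" for z
    proof -
      obtain x where "x \<in> \<alpha>\<^sub>2" "fst z = A x" "snd z \<in> \<alpha>\<^sub>2" using z by auto
      then show ?thesis by (intro image_eqI[of _ _ "(x, snd z)"]) (simp_all add: S_def prod_eq_iff)
    qed
  qed
  have \<gamma>shift: "\<gamma> (s + \<tau>\<^sub>1) = \<gamma>\<^sub>2 s o\<^sub>L A" if "0 \<le> s" for s
  proof (cases "s = 0")
    case True
    have "id_blinfun o\<^sub>L A = A" by (rule blinfun_eqI) simp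
    then show ?thesis using True path(3)[OF assms(11)] by (simp add: \<gamma>_def path_iteration_def A_def)
  qed (use that in \<open>simp add: \<gamma>_def path_iteration_def A_def\<close>)
  have SGr: "S ` Gr (\<gamma> (s + \<tau>\<^sub>1)) = Gr (\<gamma>\<^sub>2 s)" if "0 \<le> s" for s
  proof (intro subset_antisym subsetI)
    show "z \<in> Gr (\<gamma>\<^sub>2 s)" if "z \<in> S ` Gr (\<gamma> (s + \<tau>\<^sub>1))" for z
      using that unfolding \<gamma>shift[OF \<open>0 \<le> s\<close>] by (auto simp: S_def Gr_def)
    show "z \<in> S ` Gr (\<gamma> (s + \<tau>\<^sub>1))" if z: "z \<in> Gr (\<gamma>\<^sub>2 s)" for z
    proof -
      obtain x where "fst z = A x" using surjA by blast
      then show ?thesis using z unfolding \<gamma>shift[OF \<open>0 \<le> s\<close>] Gr_def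
        by (intro image_eqI[of _ _ "(x, snd z)"]) (auto simp: S_def prod_eq_iff)
    qed
  qed
  \<comment> \<open>The eigenvalues are unchanged by \<open>S\<close>, so the shifted lift also
    belongs to the path \<open>\<gamma>\<^sub>2\<close>, but for the transported splitting.\<close>
  have \<theta>S: "lifts_eigsp (S ` Fm) (S ` Fp) 0 \<tau>\<^sub>2 (\<lambda>t. Gr (\<gamma>\<^sub>2 t)) (blinfun_apply A ` \<alpha>\<^sub>2 \<times> \<alpha>\<^sub>2) (cdim Fm) (\<lambda>j s. \<theta> j (s + \<tau>\<^sub>1))"
    unfolding lifts_eigsp_def
  proof (intro conjI allI impI ballI)
    show "continuous_on {0..\<tau>\<^sub>2} (\<lambda>s. \<theta> j (s + \<tau>\<^sub>1))" if "j < cdim Fm" for j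
      by (rule continuous_on_compose2[OF \<theta>c[OF that]]) (use \<tau>\<^sub>1 in \<open>auto intro!: continuous_intros\<close>)
    fix s assume s: "s \<in> {0..\<tau>\<^sub>2}"
    then have s': "s + \<tau>\<^sub>1 \<in> {0..?\<tau>}" using \<tau>\<^sub>1 by auto
    have "csubspace (Gr (\<gamma> (s + \<tau>\<^sub>1)))" "csubspace ?W"
      using lagGr[OF \<gamma> s'] lagW unfolding lagrangian_def by blast+
    from represents_eigsp_transport[OF S bijS fd splitting_subspaces[OF h sp] this \<theta>r[OF s']]
    show "represents_eigsp (S ` Fm) (S ` Fp) (Gr (\<gamma>\<^sub>2 s)) (blinfun_apply A ` \<alpha>\<^sub>2 \<times> \<alpha>\<^sub>2) (cdim Fm) (\<lambda>j. \<theta> j (s + \<tau>\<^sub>1))"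
      unfolding SW using SGr[of s] s by simp
  qed
  have D0: "Gr (\<gamma>\<^sub>2 0) = Gr id_blinfun" using path(3)[OF assms(11)] by simp
  \<comment> \<open>Here independence of the splitting is needed: \<open>S\<close> need not preserve
    \<open>Fm\<close> and \<open>Fp\<close>.\<close>
  have "lift_index (cdim Fm) 0 \<tau>\<^sub>2 (\<lambda>j s. \<theta> j (s + \<tau>\<^sub>1)) = lift_index (cdim Fm) 0 \<tau>\<^sub>2 \<theta>W"
    by (rule lift_index_splitting_independent[OF h fd spS sp \<tau>\<^sub>2 _ frame[OF assms(11)] toh[OF lagW'] \<theta>S \<theta>W])
      (rule toh[OF lagGr[OF assms(11)]])
  then have "lift_index (cdim Fm) 0 ?\<tau> \<theta> - lift_index (cdim Fm) 0 \<tau>\<^sub>1 \<theta> = lift_index (cdim Fm) 0 \<tau>\<^sub>2 \<theta>W"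
    by (simp add: lift_index_def add.commute)
  moreover have "cdim (Gr (\<gamma>\<^sub>2 \<tau>\<^sub>2) \<inter> Gr id_blinfun) = nu1 \<tau>\<^sub>2 \<gamma>\<^sub>2"
    unfolding nu1_def by (rule cdim_Gr_Int[OF fdV SpD(1)[OF path(4)[OF assms(11)]]]) (use \<tau>\<^sub>2 in simp)
  moreover have "int (cdim (Gr (\<gamma>\<^sub>2 \<tau>\<^sub>2) \<inter> Gr id_blinfun)) - int (cdim Fm) \<le>
      lift_index (cdim Fm) 0 \<tau>\<^sub>2 \<theta>W - lift_index (cdim Fm) 0 \<tau>\<^sub>2 \<theta>D"
    by (rule lift_index_comparison(1)[OF h fd sp \<tau>\<^sub>2 _ frame[OF assms(11)] toh[OF lagI] D0 toh[OF lagW'] \<theta>W \<theta>D])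
      (rule toh[OF lagGr[OF assms(11)]])
  moreover have "lift_index (cdim Fm) 0 \<tau>\<^sub>2 \<theta>W \<le> lift_index (cdim Fm) 0 \<tau>\<^sub>2 \<theta>D"
    by (rule lift_index_comparison(2)[OF h fd sp \<tau>\<^sub>2 _ frame[OF assms(11)] toh[OF lagI] D0 toh[OF lagW'] \<theta>W \<theta>D])
      (rule toh[OF lagGr[OF assms(11)]])
  ultimately show ?thesis unfolding \<gamma>_def[symmetric] i i\<^sub>1 i\<^sub>2 using dim by simp
qed

end
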